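(* Let $f$ be an LLD meromorphic function. If $m_0(f)\le d(f)$, then $f$ is of Hadamard type, i.e. $g(f)=g_H(f)=d(f)-1\ge g_W(f)$.
   Context: All meromorphic functions are on $\mathbb{C}$, not identically zero, and of finite order (for entire $f$ the order is $o(f)=\limsup_{R\to\infty}\frac{\log\log\|f\|_{C^0(B(0,R))}}{\log R}$; for meromorphic $f$ it is the usual Nevanlinna order). LLD (left located divisor) meromorphic function: a meromorphic function $f$ of finite order with $\sigma_1=\sup_{\rho\in f^{-1}(\{0,\infty\})}\Re\rho<+\infty$. Divisor: $(\rho)$ is the set of zeros and poles of $f$, with multiplicity $n_\rho\in\mathbb{Z}$ (positive for zeros, negative for poles; $n_0=0$ if $0$ is neither a zero nor a pole). Convergence exponent: $d=d(f)$ is the minimal integer $d\ge 0$ with $\sum_{\rho\ne0}|n_\rho|\,|\rho|^{-d}<+\infty$. Genus: $f$ has the Hadamard factorization $f(s)=s^{n_0}e^{Q_f(s)}\prod_{\rho\neq0}\left(E_{d-1}(s/\rho)\right)^{n_\rho}$, where $E_n(z)=(1-z)e^{z+\frac12z^2+\cdots+\frac1nz^n}$ (empty exponent, i.e. $1-z$, for $n\le 0$) and $Q_f$ is a polynomial, unique up to adding an integer multiple of $2\pi i$. Put $g_W(f)=\deg Q_f$ (Weierstrass genus), $g_H(f)=d(f)-1$ (Hadamard genus), $g(f)=\max(g_W(f),g_H(f))$ (genus). Vertical order: $m_0(f)$ is the minimal integer $m_0\ge0$ such that for $c>\sigma_1$, $c\ne0$, the function $t\mapsto|c+it|^{-m_0}\frac{f'}{f}(c+it)$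 belongs to $L^1(\mathbb{R})$; this does not depend on the choice of $c$.
   Formalization: The formal statement adds the hypothesis d(f) ≥ 1 (infinite divisor); for d(f) = 0 the claim fails, e.g. f = 2 has m_0(f) = d(f) = 0 but g_W(f) = 0 > -1 = d(f) - 1. *)

theory Defs
  imports "HOL-Complex_Analysis.Complex_Analysis"
begin

text \<open>
  A meromorphic function on the plane is represented by its normalised total function:
  \<open>f nicely_meromorphic_on UNIV\<close> says that all removable singularities have been removed and that
  \<open>f\<close> takes the value \<open>0\<close> at its poles. For such \<open>f\<close>, not identically zero, the multiplicity
  \<open>n\<^sub>\<rho>\<close> is \<open>zorder f \<rho>\<close>: positive at zeros, negative at poles, \<open>0\<close> elsewhere.
\<close>

definition divisor_set :: "(complex \<Rightarrow> complex) \<Rightarrow> complex set" where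
  "divisor_set f = {\<rho>. is_pole f \<rho> \<or> f \<rho> = 0}"

definition max_modulus :: "(complex \<Rightarrow> complex) \<Rightarrow> real \<Rightarrow> real" where
  "max_modulus f R = (SUP z\<in>ball 0 R. norm (f z))"

definition entire_order :: "(complex \<Rightarrow> complex) \<Rightarrow> ereal" where
  "entire_order f = Limsup at_top (\<lambda>R::real. ereal (ln (ln (max_modulus f R)) / ln R))"

definition proximity_fun :: "(complex \<Rightarrow> complex) \<Rightarrow> real \<Rightarrow> real" where
  "proximity_fun f R =
     (LBINT \<theta>:{0..2*pi}. max 0 (ln (norm (f (of_real R * cis \<theta>))))) / (2 * pi)"

definition pole_count :: "(complex \<Rightarrow> complex) \<Rightarrow> real \<Rightarrow> real" where
  "pole_count f t = (\<Sum>\<rho> | is_pole f \<rho> \<and> norm \<rho> \<le> t. of_int \<bar>zorder f \<rho>\<bar>)"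

definition counting_fun :: "(complex \<Rightarrow> complex) \<Rightarrow> real \<Rightarrow> real" where
  "counting_fun f R =
     (LBINT t:{0<..R}. (pole_count f t - pole_count f 0) / t) + pole_count f 0 * ln R"

definition nevanlinna_char :: "(complex \<Rightarrow> complex) \<Rightarrow> real \<Rightarrow> real" where
  "nevanlinna_char f R = proximity_fun f R + counting_fun f R"

definition nevanlinna_order :: "(complex \<Rightarrow> complex) \<Rightarrow> ereal" where
  "nevanlinna_order f = Limsup at_top (\<lambda>R::real. ereal (ln (nevanlinna_char f R) / ln R))"

text \<open>The totalised values of \<open>ln\<close> at nonpositive arguments only affect the two orders through
  constant functions, whose order comes out as \<open>0\<close>.\<close>

definition meromorphic_order :: "(complex \<Rightarrow> complex) \<Rightarrow> ereal" where
  "meromorphic_order f =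
     (if f holomorphic_on UNIV then entire_order f else nevanlinna_order f)"

definition finite_order_meromorphic :: "(complex \<Rightarrow> complex) \<Rightarrow> bool" where
  "finite_order_meromorphic f \<longleftrightarrow>
     f nicely_meromorphic_on UNIV \<and> (\<exists>z. f z \<noteq> 0) \<and> meromorphic_order f < \<infinity>"

text \<open>Extended reals, so that \<open>\<sigma>\<^sub>1 = -\<infinity>\<close> for an empty divisor.\<close>

definition sigma1 :: "(complex \<Rightarrow> complex) \<Rightarrow> ereal" where
  "sigma1 f = (SUP \<rho>\<in>divisor_set f. ereal (Re \<rho>))"

definition LLD :: "(complex \<Rightarrow> complex) \<Rightarrow> bool" where
  "LLD f \<longleftrightarrow> finite_order_meromorphic f \<and> sigma1 f < \<infinity>"

definition convergence_exponent :: "(complex \<Rightarrow> complex) \<Rightarrow> nat" where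
  "convergence_exponent f =
     (LEAST d. (\<lambda>\<rho>. of_int \<bar>zorder f \<rho>\<bar> / norm \<rho> ^ d :: real) summable_on (divisor_set f - {0}))"

text \<open>
  The product over the divisor is the unconditional limit of its finite partial products.
  Truncated subtraction turns \<open>E\<^bsub>d-1\<^esub>\<close> for \<open>d = 0\<close> into \<open>weierstrass_factor 0 z = 1 - z\<close>,
  as intended. Since \<open>f s \<noteq> 0\<close> off the divisor, the limit \<open>P\<close> is nonzero there, so \<open>Q\<close> is
  determined up to an additive constant in \<open>2 \<pi> i \<int>\<close>.
\<close>

definition hadamard_factorization :: "(complex \<Rightarrow> complex) \<Rightarrow> complex poly \<Rightarrow> bool" where
  "hadamard_factorization f Q \<longleftrightarrow>
     (\<forall>s. \<not> is_pole f s \<longrightarrow>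
        (\<exists>P. ((\<lambda>X. \<Prod>\<rho>\<in>X.
                 weierstrass_factor (convergence_exponent f - 1) (s / \<rho>) powi zorder f \<rho>)
                \<longlongrightarrow> P) (finite_subsets_at_top (divisor_set f - {0})) \<and>
             f s = s powi zorder f 0 * exp (poly Q s) * P))"

definition weierstrass_genus :: "(complex \<Rightarrow> complex) \<Rightarrow> nat" where
  "weierstrass_genus f = degree (SOME Q. hadamard_factorization f Q)"

text \<open>An integer, since it is \<open>-1\<close> for a finite divisor.\<close>

definition hadamard_genus :: "(complex \<Rightarrow> complex) \<Rightarrow> int" where
  "hadamard_genus f = int (convergence_exponent f) - 1"

definition genus :: "(complex \<Rightarrow> complex) \<Rightarrow> int" where
  "genus f = max (int (weierstrass_genus f)) (hadamard_genus f)"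

definition vertical_order :: "(complex \<Rightarrow> complex) \<Rightarrow> nat" where
  "vertical_order f =
     (LEAST m. \<forall>c::real. sigma1 f < ereal c \<and> c \<noteq> 0 \<longrightarrow>
        integrable lborel
          (\<lambda>t. deriv f (Complex c t) / f (Complex c t) / of_real (norm (Complex c t) ^ m)))"

end

theory Submission
  imports Defs "HOL-Probability.Sinc_Integral"
begin

text \<open>
  Write \<open>d\<close> for the convergence exponent, \<open>n\<^sub>\<rho>\<close> for the multiplicities, and take a factorization
  \<open>f s = s powi n\<^sub>0 * exp (Q s) * (\<Prod>\<rho>. E\<^bsub>d-1\<^esub> (s / \<rho>) powi n\<^sub>\<rho>)\<close>. The conclusion is that \<open>degree Q < d\<close>. Since the
  Weierstrass genus, the convergence exponent and the vertical order are defined by choice or as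
  least elements, the argument has to show first that a factorization and finite exponents exist.

  \<^emph>\<open>Existence of the factorization.\<close> On a disc, divide \<open>f\<close> by the Blaschke factors of its zeros and
  poles; what remains is \<open>exp F\<close> with \<open>F\<close> holomorphic and \<open>Re F = ln \<bar>f\<bar>\<close> on the boundary circle
  (\<open>poisson_jensen\<close>). The mean value of \<open>Re F\<close> is Jensen's formula: with finite order it bounds the
  number of zeros in terms of the proximity function and the number of poles, hence the mean of
  \<open>\<bar>Re F\<bar>\<close>. The Taylor coefficients of \<open>F\<close> at \<open>0\<close> are bounded by that mean
  (\<open>norm_taylor_coefficient_le_integral_Re\<close>), so the coefficients of a fixed large index tend to \<open>0\<close> as
  the radius grows (\<open>finite_order_bounds\<close>). Now the logarithm of \<open>f\<close> divided by its canonical product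
  differs from \<open>F\<close>, in high Taylor coefficients at \<open>0\<close>, only by terms that also tend to \<open>0\<close>; but its own
  coefficients do not depend on the radius, so they vanish from some index on and this logarithm is a
  polynomial (\<open>hadamard_factorization_exists\<close>).

  \<^emph>\<open>The degree.\<close> The logarithmic derivative of the factorization is
  \<open>f'/f s = n\<^sub>0 / s + Q' s + (\<Sum>\<rho>. n\<^sub>\<rho> s\<^bsup>d-1\<^esup> / (\<rho>\<^bsup>d-1\<^esup> (s - \<rho>)))\<close> (\<open>log_derivative_formula\<close>). On a vertical line to the
  right of the divisor it grows polynomially, so the vertical order exists, and \<open>m\<^sub>0 \<le> d\<close> makes
  \<open>\<bar>s\<bar>\<^bsup>-d\<^esup> \<bar>f'/f\<bar>\<close> integrable there. If \<open>degree Q \<ge> d\<close>, then \<open>\<bar>s\<bar>\<^bsup>-d\<^esup> \<bar>Q'\<bar>\<close> is at least a constant over \<open>\<bar>s\<bar>\<close>, and its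
  integral over \<open>[T, 2T]\<close> stays away from \<open>0\<close>. So the sum over the divisor would have to contribute
  as much, for every large \<open>T\<close>. The points \<open>\<rho>\<close> with \<open>\<bar>\<rho>\<bar>\<close> much smaller or much larger than \<open>T\<close>
  contribute \<open>o(1)\<close> because \<open>\<Sum>\<rho>. \<bar>n\<^sub>\<rho>\<bar> \<bar>\<rho>\<bar>\<^bsup>-d\<^esup>\<close> converges (\<open>damped_weight_tendsto_0\<close>). The points of size
  about \<open>T\<close> contribute at most a multiple of \<open>ln T\<close> times their share of that sum, the logarithm being
  \<open>\<integral> dt / \<bar>s - \<rho>\<bar>\<close>. For \<open>T = 16\<^sup>k\<close> these shares \<open>a\<^sub>k\<close> belong to disjoint shells, so \<open>\<Sum>k. a\<^sub>k\<close> converges, whereas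
  \<open>k * a\<^sub>k\<close> bounded below would make it diverge like the harmonic series
  (\<open>harmonic_weights_contradiction\<close>).
\<close>

section \<open>Taylor coefficients and the real part on a circle\<close>

lemma taylor_coefficient_circle_integral:
  fixes F :: "complex \<Rightarrow> complex"
  assumes F: "F holomorphic_on ball 0 r" and R: "0 < R" "R < r"
  shows "((\<lambda>t. F (of_real R * cis t) * cis (- (real k * t))) has_integral
           2 * pi * R ^ k * ((deriv ^^ k) F 0 / fact k)) {0..2*pi}"
proof -
  have "((\<lambda>u. F u / (u - 0) ^ Suc k) has_contour_integral
          (2 * pi) * \<i> / fact k * (deriv ^^ k) F 0) (circlepath 0 R)"
    using R by (intro Cauchy_has_contour_integral_higher_derivative_circlepath)
      (auto intro!: holomorphic_on_imp_continuous_on holomorphic_on_subset[OF F])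
  hence "((\<lambda>t. F (of_real R * cis t) / (of_real R * cis t) ^ Suc k * R * \<i> * cis t) has_integral
          (2 * pi) * \<i> / fact k * (deriv ^^ k) F 0) {0..2*pi}"
    unfolding circlepath_def by (subst (asm) has_contour_integral_part_circlepath_iff) auto
  hence "((\<lambda>t. of_real (R ^ k) / \<i> * (F (of_real R * cis t) / (of_real R * cis t) ^ Suc k * R * \<i> * cis t))
      has_integral of_real (R ^ k) / \<i> * ((2 * pi) * \<i> / fact k * (deriv ^^ k) F 0)) {0..2*pi}"
    by (rule has_integral_mult_right)
  also have "(\<lambda>t. of_real (R ^ k) / \<i> * (F (of_real R * cis t) / (of_real R * cis t) ^ Suc k * R * \<i> * cis t))
     = (\<lambda>t. F (of_real R * cis t) * cis (- (real k * t)))"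
  proof
    fix t
    have "cis (- (real k * t)) = inverse (cis t ^ k)"
      by (metis cis_inverse Complex.DeMoivre)
    thus "of_real (R ^ k) / \<i> * (F (of_real R * cis t) / (of_real R * cis t) ^ Suc k * R * \<i> * cis t)
      = F (of_real R * cis t) * cis (- (real k * t))"
      using R by (simp add: field_simps power_mult_distrib)
  qed
  finally show ?thesis by (simp add: field_simps)
qed

text \<open>
  Negative Fourier coefficients of a holomorphic function on a circle vanish, by Cauchy's theorem.
\<close>

lemma circle_integral_times_cis_eq_0:
  fixes F :: "complex \<Rightarrow> complex"
  assumes F: "F holomorphic_on ball 0 r" and R: "0 < R" "R < r" and k: "k > 0"
  shows "((\<lambda>t. F (of_real R * cis t) * cis (real k * t)) has_integral 0) {0..2*pi}"
proof -
  have "((\<lambda>u. F u * u ^ (k - 1)) has_contour_integral 0) (circlepath 0 R)"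
    by (rule Cauchy_theorem_disc_simple[of _ 0 r])
      (use R in \<open>auto intro!: holomorphic_intros F\<close>)
  hence "((\<lambda>t. F (of_real R * cis t) * (of_real R * cis t) ^ (k - 1) * R * \<i> * cis t) has_integral 0) {0..2*pi}"
    unfolding circlepath_def by (subst (asm) has_contour_integral_part_circlepath_iff) auto
  hence "((\<lambda>t. 1 / (\<i> * of_real (R ^ k)) * (F (of_real R * cis t) * (of_real R * cis t) ^ (k - 1) * R * \<i> * cis t))
      has_integral 1 / (\<i> * of_real (R ^ k)) * 0) {0..2*pi}"
    by (rule has_integral_mult_right)
  also have "(\<lambda>t. 1 / (\<i> * of_real (R ^ k)) * (F (of_real R * cis t) * (of_real R * cis t) ^ (k - 1) * R * \<i> * cis t))
     = (\<lambda>t. F (of_real R * cis t) * cis (real k * t))"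
  proof
    fix t
    obtain j where j: "k = Suc j" using k gr0_implies_Suc by blast
    have "cis (real k * t) = cis t ^ k"
      by (simp only: Complex.DeMoivre)
    thus "1 / (\<i> * of_real (R ^ k)) * (F (of_real R * cis t) * (of_real R * cis t) ^ (k - 1) * R * \<i> * cis t)
      = F (of_real R * cis t) * cis (real k * t)"
      using R by (simp add: field_simps power_mult_distrib j)
  qed
  finally show ?thesis by simp
qed

lemma mean_value_Re:
  fixes F :: "complex \<Rightarrow> complex"
  assumes F: "F holomorphic_on ball 0 r" and R: "0 < R" "R < r"
  shows "((\<lambda>t. Re (F (of_real R * cis t))) has_integral 2 * pi * Re (F 0)) {0..2*pi}"
  using has_integral_linear[OF taylor_coefficient_circle_integral[OF assms, of 0] bounded_linear_Re]
  by (simp add: o_def)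

text \<open>
  An \<open>L\<^sup>1\<close> form of the Borel--Caratheodory inequality: adding to the \<open>k\<close>-th Fourier coefficient of \<open>F\<close> the
  conjugate of the vanishing \<open>-k\<close>-th one leaves a Fourier coefficient of \<open>2 * Re F\<close>.
\<close>

lemma norm_taylor_coefficient_le_integral_Re:
  fixes F :: "complex \<Rightarrow> complex"
  assumes F: "F holomorphic_on ball 0 r" and R: "0 < R" "R < r" and k: "k > 0"
  shows "norm ((deriv ^^ k) F 0 / fact k) * R ^ k * pi
           \<le> integral {0..2*pi} (\<lambda>t. \<bar>Re (F (of_real R * cis t))\<bar>)"
proof -
  define c where "c = (deriv ^^ k) F 0 / fact k"
  have "((\<lambda>t. cnj (F (of_real R * cis t) * cis (real k * t))) has_integral 0) {0..2*pi}"
    using has_integral_linear[OF circle_integral_times_cis_eq_0[OF assms] bounded_linear_cnj]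
    by (simp add: o_def)
  from has_integral_add[OF taylor_coefficient_circle_integral[OF F R, of k] this]
  have "((\<lambda>t. 2 * of_real (Re (F (of_real R * cis t))) * cis (- (real k * t))) has_integral
           2 * pi * R ^ k * c) {0..2*pi}"
    by (simp add: cis_cnj c_def complex_add_cnj flip: distrib_right)
  hence int: "integral {0..2*pi} (\<lambda>t. 2 * of_real (Re (F (of_real R * cis t))) * cis (- (real k * t)))
      = 2 * pi * R ^ k * c"
    by (rule integral_unique)
  have cont: "continuous_on {0..2*pi} (\<lambda>t. F (of_real R * cis t))"
    by (rule continuous_on_compose2[OF holomorphic_on_imp_continuous_on[OF F]])
      (use R in \<open>auto intro!: continuous_intros simp: norm_mult\<close>)
  have "norm (2 * pi * R ^ k * c) \<le> integral {0..2*pi} (\<lambda>t. 2 * \<bar>Re (F (of_real R * cis t))\<bar>)"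
    unfolding int[symmetric]
    by (rule integral_norm_bound_integral)
      (auto intro!: integrable_continuous_real continuous_intros cont simp: norm_mult)
  moreover have "norm (2 * pi * R ^ k * c) = 2 * (norm c * R ^ k * pi)"
    using R by (simp add: norm_mult norm_power)
  ultimately show ?thesis
    unfolding c_def by simp
qed

section \<open>Zeros and poles of a meromorphic function\<close>

locale nonzero_meromorphic =
  fixes f :: "complex \<Rightarrow> complex"
  assumes nice: "f nicely_meromorphic_on UNIV"
    and not_zero: "\<exists>z. f z \<noteq> 0"
begin

lemma meromorphic: "f meromorphic_on A"
  using nice meromorphic_on_subset unfolding nicely_meromorphic_on_def by blast

lemma divisor_set_eq: "divisor_set f = {z. f z = 0}"
  using is_pole_zero_at_nicely_mero[OF nice] by (auto simp: divisor_set_def)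

lemma divisor_sparse: "divisor_set f sparse_in UNIV"
proof -
  have "\<forall>\<^sub>\<approx>x\<in>UNIV. f x \<noteq> 0"
    using nicely_meromorphic_imp_constant_or_avoid[OF nice, of 0] not_zero
    by (auto simp: Convex.connected_UNIV)
  thus ?thesis
    by (simp add: eventually_cosparse divisor_set_eq)
qed

lemma closed_divisor: "closed (divisor_set f)"
  using divisor_sparse by (rule sparse_in_UNIV_imp_closed)

lemma finite_divisor_cball: "finite (divisor_set f \<inter> cball 0 r)"
  using sparse_in_compact_finite[OF sparse_in_subset[OF divisor_sparse, of "cball 0 r"]]
  by (simp add: Int_commute)

lemma finite_divisor_ball: "finite (divisor_set f \<inter> ball 0 r)"
  by (rule finite_subset[OF _ finite_divisor_cball[of r]]) auto

lemma eventually_nonzero: "eventually (\<lambda>z. f z \<noteq> 0) (at w)"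
  using divisor_sparse eventually_cosparse[of "\<lambda>z. f z \<noteq> 0" UNIV]
  by (auto simp: divisor_set_eq intro: eventually_cosparse_imp_eventually_at)

lemma analytic_off_divisor:
  assumes "z \<notin> divisor_set f"
  shows "f analytic_on {z}"
  using assms nice by (intro nicely_meromorphic_on_imp_analytic_at) (auto simp: divisor_set_def)

lemma holomorphic_off_divisor: "f holomorphic_on - divisor_set f"
  using analytic_off_divisor analytic_on_analytic_at analytic_imp_holomorphic by blast

lemma zorder_pole: "is_pole f z \<Longrightarrow> zorder f z < 0"
  by (rule isolated_pole_imp_neg_zorder[OF meromorphic_on_isolated_singularity[OF meromorphic]])

lemma zorder_zero: "f z = 0 \<Longrightarrow> \<not> is_pole f z \<Longrightarrow> zorder f z > 0"
  using zorder_pos_iff'[of f z] nicely_meromorphic_on_imp_analytic_at[OF nice, of z]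
    eventually_nonzero[of z] by (auto simp: eventually_frequently)

lemma zorder_off_divisor: "z \<notin> divisor_set f \<Longrightarrow> zorder f z = 0"
  using zorder_eq_0I[OF analytic_off_divisor] by (auto simp: divisor_set_eq)

text \<open>
  Multiplying \<open>f\<close> by \<open>(s - \<rho>) powi (- n\<^sub>\<rho>)\<close> for all zeros and poles \<open>\<rho>\<close> in the disc gives a function of order \<open>0\<close> at
  every point of the disc, that is, one without zeros after removal of its singularities. On the
  convex disc it has a holomorphic logarithm.
\<close>

lemma disc_factorization:
  obtains L where "L holomorphic_on ball 0 b"
    "\<And>s. s \<in> ball 0 b - divisor_set f \<Longrightarrow>
        f s = exp (L s) * (\<Prod>\<rho>\<in>divisor_set f \<inter> ball 0 b. (s - \<rho>) powi zorder f \<rho>)"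
proof -
  define D where "D = divisor_set f \<inter> ball 0 b"
  have fin: "finite D" unfolding D_def by (rule finite_divisor_ball)
  define g where "g = (\<lambda>s. f s * (\<Prod>\<rho>\<in>D. (s - \<rho>) powi (- zorder f \<rho>)))"
  have g_mero: "g meromorphic_on A" for A
    unfolding g_def by (intro meromorphic_intros meromorphic)
  define G where "G = remove_sings g"
  have G_nice: "G nicely_meromorphic_on UNIV"
    unfolding G_def by (intro remove_sings_nicely_meromorphic g_mero)
  have ev_lin: "eventually (\<lambda>s. s - \<rho> \<noteq> 0) (at z)" for \<rho> z :: complex
    by (cases "\<rho> = z")
       (auto simp: eventually_at_filter intro: eventually_mono[OF t1_space_nhds])
  have ev_prod: "eventually (\<lambda>s. (\<Prod>\<rho>\<in>D. (s - \<rho>) powi (- zorder f \<rho>)) \<noteq> 0) (at z)" for z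
  proof -
    have "eventually (\<lambda>s. \<forall>\<rho>\<in>D. s - \<rho> \<noteq> 0) (at z)"
      using ev_lin by (intro eventually_ball_finite fin) auto
    thus ?thesis by eventually_elim (use fin in auto)
  qed
  have ev_g: "eventually (\<lambda>s. g s \<noteq> 0) (at z)" for z
    using eventually_nonzero[of z] ev_prod[of z] by eventually_elim (auto simp: g_def)
  have lin_order: "zorder (\<lambda>s. s - \<rho>) z = (if z = \<rho> then 1 else 0)" for \<rho> z :: complex
  proof (cases "z = \<rho>")
    case True
    show ?thesis using True
      by (auto intro!: zorder_eqI[of UNIV _ "\<lambda>_. 1"] holomorphic_intros)
  next
    case False
    thus ?thesis by (auto intro!: zorder_eq_0I analytic_intros)
  qed
  have g_order: "zorder g z = 0" if z: "z \<in> ball 0 b" for z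
  proof -
    have "zorder g z = zorder f z + zorder (\<lambda>s. \<Prod>\<rho>\<in>D. (s - \<rho>) powi (- zorder f \<rho>)) z"
      unfolding g_def
      by (intro zorder_mult meromorphic meromorphic_intros
          eventually_frequently eventually_nonzero ev_prod) auto
    also have "zorder (\<lambda>s. \<Prod>\<rho>\<in>D. (s - \<rho>) powi (- zorder f \<rho>)) z
      = (\<Sum>\<rho>\<in>D. zorder (\<lambda>s. (s - \<rho>) powi (- zorder f \<rho>)) z)"
      by (intro zorder_prod meromorphic_intros ev_prod)
    also have "\<dots> = (\<Sum>\<rho>\<in>D. if \<rho> = z then - zorder f \<rho> else 0)"
    proof (intro sum.cong refl)
      fix \<rho> assume "\<rho> \<in> D"
      show "zorder (\<lambda>s. (s - \<rho>) powi (- zorder f \<rho>)) z = (if \<rho> = z then - zorder f \<rho> else 0)"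
        by (subst zorder_power_int)
           (use ev_lin in \<open>auto simp: lin_order intro!: meromorphic_intros eventually_frequently\<close>)
    qed
    also have "\<dots> = (if z \<in> D then - zorder f z else 0)"
      using fin by simp
    also have "zorder f z + \<dots> = 0"
      using z zorder_off_divisor[of z] by (auto simp: D_def)
    finally show ?thesis .
  qed
  have iso: "isolated_singularity_at g z" for z
    by (rule meromorphic_on_isolated_singularity[OF g_mero])
  have G_order: "zorder G z = 0" if z: "z \<in> ball 0 b" for z
    unfolding G_def using g_order[OF z] iso by simp
  have isoG: "isolated_singularity_at G z" for z
    using nicely_meromorphic_on_subset[OF G_nice, of "{z}"]
    by (intro meromorphic_on_isolated_singularity) (simp add: nicely_meromorphic_on_def)
  have G_analytic: "G analytic_on {z}" if z: "z \<in> ball 0 b" for z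
    using G_order[OF z] isolated_pole_imp_neg_zorder[OF isoG, of z]
    by (intro nicely_meromorphic_on_imp_analytic_at[OF G_nice]) auto
  have ev_G: "eventually (\<lambda>s. G s \<noteq> 0) (at z)" for z
    using ev_g[of z] eventually_remove_sings_eq_at[OF iso[of z]]
    by eventually_elim (auto simp: G_def)
  have G_nz: "G z \<noteq> 0" if z: "z \<in> ball 0 b" for z
    using zorder_eq_0_iff[OF G_analytic[OF z]] G_order[OF z] ev_G[of z]
    by (auto simp: eventually_frequently)
  have "G holomorphic_on ball 0 b"
    using G_analytic analytic_on_analytic_at analytic_imp_holomorphic by blast
  then obtain L where L: "L holomorphic_on ball 0 b" "\<And>z. z \<in> ball 0 b \<Longrightarrow> G z = exp (L z)"
    using contractible_imp_holomorphic_log[of G "ball 0 b"] G_nz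
    by (metis convex_ball convex_imp_contractible)
  show thesis
  proof (rule that[OF L(1)])
    fix s assume s: "s \<in> ball 0 b - divisor_set f"
    hence sD: "s - \<rho> \<noteq> 0" if "\<rho> \<in> D" for \<rho> using that by (auto simp: D_def)
    have "g analytic_on {s}"
      unfolding g_def using s sD by (intro analytic_intros analytic_off_divisor) auto
    hence "g s = exp (L s)"
      using L(2)[of s] s by (simp add: G_def)
    moreover have "(\<Prod>\<rho>\<in>D. (s - \<rho>) powi (- zorder f \<rho>)) * (\<Prod>\<rho>\<in>D. (s - \<rho>) powi zorder f \<rho>) = 1"
      unfolding prod.distrib[symmetric] using sD
      by (intro prod.neutral) (auto simp: power_int_minus)
    ultimately show "f s = exp (L s) * (\<Prod>\<rho>\<in>divisor_set f \<inter> ball 0 b. (s - \<rho>) powi zorder f \<rho>)"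
      by (simp add: g_def D_def[symmetric] mult.assoc)
         (metis (no_types, lifting) mult.assoc mult.right_neutral)
  qed
qed

end

section \<open>Growth of functions of finite order\<close>

text \<open>
  Finite order means a polynomial bound. Where \<open>g R \<le> 0\<close>, the logarithm carries no information, but the
  bound is trivial.
\<close>

lemma power_bound_of_finite_limsup:
  fixes g :: "real \<Rightarrow> real"
  assumes "Limsup at_top (\<lambda>R. ereal (ln (g R) / ln R)) < \<infinity>"
  obtains K :: nat and R0 where "\<And>R. R \<ge> R0 \<Longrightarrow> g R \<le> R ^ K"
proof -
  obtain K :: nat where K: "Limsup at_top (\<lambda>R. ereal (ln (g R) / ln R)) < ereal (real K)"
    using assms less_PInf_Ex_of_nat by auto
  have "eventually (\<lambda>R. g R \<le> R ^ K) at_top"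
    using Limsup_lessD[OF K] eventually_gt_at_top[of 1]
  proof eventually_elim
    case (elim R)
    show ?case
    proof (cases "g R > 0")
      case True
      have "ln (g R) < real K * ln R"
        using elim by (simp add: field_simps)
      hence "g R < exp (real K * ln R)"
        using True by (metis exp_ln exp_less_mono)
      thus ?thesis using elim by (simp add: exp_of_nat_mult)
    next
      case False
      thus ?thesis using elim by (smt (verit) zero_le_power)
    qed
  qed
  thus thesis
    using that by (auto simp: eventually_at_top_linorder)
qed

lemma power_bound_absorb:
  fixes C :: real and K :: nat
  assumes "C \<ge> 0" "R \<ge> 1" "R \<ge> C * 2 ^ K"
  shows "C * (2 * R) ^ K \<le> R ^ Suc K"
  using mult_right_mono[OF assms(3), of "R ^ K"] assms by (simp add: power_mult_distrib mult_ac)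

context nonzero_meromorphic
begin

text \<open>
  This is \<open>2 * pi\<close> times the proximity function, as a gauge integral. The two agree on circles that
  avoid the divisor, where the integrand is continuous; only such circles are used.
\<close>

definition log_plus_integral :: "real \<Rightarrow> real" where
  "log_plus_integral R = integral {0..2*pi} (\<lambda>\<theta>. max 0 (ln (norm (f (of_real R * cis \<theta>)))))"

lemma continuous_on_circle:
  assumes "\<forall>\<rho>\<in>divisor_set f. norm \<rho> \<noteq> R" "R > 0"
  shows "continuous_on {0..2*pi} (\<lambda>\<theta>. f (of_real R * cis \<theta>))"
  by (rule continuous_on_compose2[OF holomorphic_on_imp_continuous_on[OF holomorphic_off_divisor]])
    (use assms in \<open>auto intro!: continuous_intros simp: norm_mult\<close>)

lemma nonzero_on_circle:
  assumes "\<forall>\<rho>\<in>divisor_set f. norm \<rho> \<noteq> R" "R > 0"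
  shows "f (of_real R * cis \<theta>) \<noteq> 0"
  using assms by (auto simp: divisor_set_eq norm_mult)

lemma continuous_on_log_circle:
  assumes "\<forall>\<rho>\<in>divisor_set f. norm \<rho> \<noteq> R" "R > 0"
  shows "continuous_on {0..2*pi} (\<lambda>\<theta>. ln (norm (f (of_real R * cis \<theta>))))"
  by (intro continuous_intros continuous_on_circle[OF assms])
    (use nonzero_on_circle[OF assms] in auto)

lemma finite_poles: "finite {\<rho>. is_pole f \<rho> \<and> norm \<rho> \<le> t}"
  by (rule finite_subset[OF _ finite_divisor_cball[of t]]) (auto simp: divisor_set_def)

lemma pole_count_mono: "s \<le> t \<Longrightarrow> pole_count f s \<le> pole_count f t"
  unfolding pole_count_def by (rule sum_mono2) (auto intro: finite_poles)

lemma pole_count_nonneg: "pole_count f s \<ge> 0"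
  unfolding pole_count_def by (rule sum_nonneg) auto

text \<open>
  This keeps the integrand of the counting function bounded near \<open>0\<close>, hence integrable.
\<close>

lemma pole_count_near_0:
  obtains r where "r > 0" "\<And>t. 0 \<le> t \<Longrightarrow> t < r \<Longrightarrow> pole_count f t = pole_count f 0"
proof -
  define S where "S = insert 1 (norm ` ({\<rho>. is_pole f \<rho> \<and> norm \<rho> \<le> 1} - {0}))"
  have S: "finite S" "S \<noteq> {}" unfolding S_def using finite_poles[of 1] by auto
  have "pole_count f t = pole_count f 0" if t: "0 \<le> t" "t < Min S" for t
  proof -
    have "{\<rho>. is_pole f \<rho> \<and> norm \<rho> \<le> t} = {\<rho>. is_pole f \<rho> \<and> norm \<rho> \<le> 0}"
    proof -
      have "\<rho> = 0" if "is_pole f \<rho>" "norm \<rho> \<le> t" for \<rho>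
      proof (rule ccontr)
        assume "\<rho> \<noteq> 0"
        have "t < 1" using t S by (auto simp: S_def)
        hence "norm \<rho> \<in> S" using that \<open>\<rho> \<noteq> 0\<close> by (auto simp: S_def)
        hence "Min S \<le> norm \<rho>" using S by simp
        thus False using t that by simp
      qed
      thus ?thesis using t by auto
    qed
    thus ?thesis by (simp add: pole_count_def)
  qed
  moreover have "Min S > 0" using S by (subst Min_gr_iff) (auto simp: S_def)
  ultimately show thesis using that by blast
qed

text \<open>
  The integrand of \<open>N(2R)\<close> is at least \<open>(n(R) - n(0)) / (2R)\<close> on \<open>]R, 2R]\<close>, an interval of length \<open>R\<close>.
\<close>

lemma pole_count_le_counting_fun:
  assumes R: "R \<ge> 1"
  shows "pole_count f R \<le> 2 * counting_fun f (2 * R)" and "counting_fun f (2 * R) \<ge> 0"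
proof -
  define h where "h = (\<lambda>t. (pole_count f t - pole_count f 0) / t)"
  obtain r where r: "r > 0" "\<And>t. 0 \<le> t \<Longrightarrow> t < r \<Longrightarrow> pole_count f t = pole_count f 0"
    using pole_count_near_0 by blast
  have [measurable]: "pole_count f \<in> borel_measurable borel"
    by (intro borel_measurable_mono monoI pole_count_mono)
  have h_nonneg: "h t \<ge> 0" if "t > 0" for t
    using that pole_count_mono[of 0 t] by (simp add: h_def)
  have h_le: "h t \<le> pole_count f (2*R) / r" if "t \<in> {0<..2*R}" for t
  proof (cases "t < r")
    case True
    thus ?thesis using r(1) r(2)[of t] that pole_count_nonneg[of "2*R"] by (simp add: h_def)
  next
    case False
    thus ?thesis
      unfolding h_def using r(1) that pole_count_mono[of t "2*R"] pole_count_nonneg[of 0]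
        pole_count_nonneg[of "2*R"] by (intro frac_le) auto
  qed
  have int: "set_integrable lborel {0<..2*R} h"
  proof (rule set_integrable_bound)
    show "set_integrable lborel {0<..2*R} (\<lambda>_. pole_count f (2*R) / r)"
      unfolding set_integrable_def
      using R by (intro integrable_scaleR_left integrable_real_indicator) auto
    show "set_borel_measurable lborel {0<..2*R} h"
      unfolding set_borel_measurable_def h_def by measurable
    show "AE x in lborel. x \<in> {0<..2*R} \<longrightarrow> norm (h x) \<le> norm (pole_count f (2*R) / r)"
      using h_nonneg h_le r(1) pole_count_nonneg[of "2*R"] by (intro AE_I2) auto
  qed
  have int': "set_integrable lborel {R<..2*R} h"
    by (rule set_integrable_subset[OF int]) (use R in auto)
  have "(pole_count f R - pole_count f 0) / 2 = (LBINT t:{R<..2*R}. (pole_count f R - pole_count f 0) / (2 * R))"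
    using R by (simp add: set_lebesgue_integral_def)
  also have "\<dots> \<le> (LBINT t:{R<..2*R}. h t)"
  proof (rule set_integral_mono[OF _ int'])
    show "set_integrable lborel {R<..2*R} (\<lambda>t. (pole_count f R - pole_count f 0) / (2 * R))"
      unfolding set_integrable_def
      using R by (intro integrable_scaleR_left integrable_real_indicator) auto
    fix t assume "t \<in> {R<..2*R}"
    thus "(pole_count f R - pole_count f 0) / (2 * R) \<le> h t"
      unfolding h_def using R pole_count_mono[of R t] pole_count_mono[of 0 R]
      by (intro frac_le) auto
  qed
  also have "\<dots> \<le> (LBINT t:{0<..2*R}. h t)"
    unfolding set_lebesgue_integral_def
    using int int' R h_nonneg
    by (intro integral_mono) (auto simp: set_integrable_def indicator_def)
  finally have 1: "(pole_count f R - pole_count f 0) / 2 \<le> (LBINT t:{0<..2*R}. h t)" .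
  have "1 / 2 \<le> ln (2 * R)"
  proof -
    have "ln (2 * R) = ln 2 + ln R" using R by (simp add: ln_mult)
    thus ?thesis using ln_ge_zero[OF R] ln2_ge_two_thirds by linarith
  qed
  from mult_left_mono[OF this pole_count_nonneg[of 0]]
  have "pole_count f 0 / 2 \<le> pole_count f 0 * ln (2 * R)" by simp
  with 1 show "pole_count f R \<le> 2 * counting_fun f (2 * R)"
    by (simp add: counting_fun_def h_def)
  with pole_count_nonneg[of R] show "counting_fun f (2 * R) \<ge> 0" by linarith
qed

lemma log_plus_integral_proximity:
  assumes "\<forall>\<rho>\<in>divisor_set f. norm \<rho> \<noteq> R" "R > 0"
  shows "log_plus_integral R = 2 * pi * proximity_fun f R"
proof -
  have "set_integrable lborel {0..2*pi} (\<lambda>\<theta>. max 0 (ln (norm (f (of_real R * cis \<theta>)))))"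
    unfolding set_integrable_def
    by (rule borel_integrable_compact)
      (auto intro!: continuous_intros continuous_on_log_circle[OF assms])
  thus ?thesis
    by (simp add: log_plus_integral_def proximity_fun_def set_borel_integral_eq_integral)
qed

lemma proximity_nonneg: "proximity_fun f R \<ge> 0"
  unfolding proximity_fun_def set_lebesgue_integral_def
  by (intro divide_nonneg_pos integral_nonneg_AE) auto

lemma growth_of_finite_nevanlinna_order:
  assumes "nevanlinna_order f < \<infinity>"
  obtains K :: nat and R0 where
    "\<And>R. R \<ge> R0 \<Longrightarrow> \<forall>\<rho>\<in>divisor_set f. norm \<rho> \<noteq> R \<Longrightarrow> log_plus_integral R \<le> R ^ K"
    "\<And>R. R \<ge> R0 \<Longrightarrow> pole_count f R \<le> R ^ K"
proof -
  obtain K :: nat and R0 where KR: "\<And>R. R \<ge> R0 \<Longrightarrow> nevanlinna_char f R \<le> R ^ K"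
    using power_bound_of_finite_limsup[OF assms(1)[unfolded nevanlinna_order_def]] by blast
  define R1 where "R1 = Max {2, 2 * R0, R0, 8 * 2 ^ K}"
  show thesis
  proof (rule that[of R1 "Suc K"])
    fix R assume R: "R \<ge> R1"
    have R': "R \<ge> 2" "R \<ge> 2 * R0" "R \<ge> R0" "R \<ge> 8 * 2 ^ K"
      using R by (auto simp: R1_def)
    have "pole_count f R \<le> 2 * counting_fun f (2 * R)"
      by (rule pole_count_le_counting_fun) (use R' in auto)
    also have "\<dots> \<le> 2 * nevanlinna_char f (2 * R)"
      using proximity_nonneg by (simp add: nevanlinna_char_def)
    also have "\<dots> \<le> 8 * (2 * R) ^ K"
      using KR[of "2 * R"] R' by (smt (verit) zero_le_power)
    also have "\<dots> \<le> R ^ Suc K"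
      by (rule power_bound_absorb) (use R' in auto)
    finally show "pole_count f R \<le> R ^ Suc K" .
    assume nd: "\<forall>\<rho>\<in>divisor_set f. norm \<rho> \<noteq> R"
    have "log_plus_integral R = 2 * pi * proximity_fun f R"
      by (rule log_plus_integral_proximity) (use nd R' in auto)
    also have "\<dots> \<le> 2 * pi * nevanlinna_char f R"
      using pole_count_le_counting_fun(2)[of "R/2"] R' by (simp add: nevanlinna_char_def)
    also have "\<dots> \<le> 2 * pi * R ^ K"
      using KR[of R] R' by simp
    also have "\<dots> \<le> 8 * (2 * R) ^ K"
      using pi_less_4 R' by (intro mult_mono power_mono) auto
    also have "\<dots> \<le> R ^ Suc K"
      by (rule power_bound_absorb) (use R' in auto)
    finally show "log_plus_integral R \<le> R ^ Suc K" .
  qed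
qed

lemma growth_of_finite_entire_order:
  assumes "entire_order f < \<infinity>" "f holomorphic_on UNIV"
  obtains K :: nat and R0 where
    "\<And>R. R \<ge> R0 \<Longrightarrow> \<forall>\<rho>\<in>divisor_set f. norm \<rho> \<noteq> R \<Longrightarrow> log_plus_integral R \<le> R ^ K"
    "\<And>R. R \<ge> R0 \<Longrightarrow> pole_count f R \<le> R ^ K"
proof -
  obtain K :: nat and R0 where KR: "\<And>R. R \<ge> R0 \<Longrightarrow> ln (max_modulus f R) \<le> R ^ K"
    by (rule power_bound_of_finite_limsup[OF assms(1)[unfolded entire_order_def]]) blast
  define R1 where "R1 = Max {2, R0, 8 * 2 ^ K}"
  have cont: "continuous_on A f" for A
    using assms(2) holomorphic_on_imp_continuous_on holomorphic_on_subset by blast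
  show thesis
  proof (rule that[of R1 "Suc K"])
    fix R assume R: "R \<ge> R1"
    have R': "R \<ge> 2" "R \<ge> R0" "R \<ge> 8 * 2 ^ K"
      using R by (auto simp: R1_def)
    have "\<not> is_pole f \<rho>" for \<rho>
      using not_is_pole_holomorphic[of UNIV \<rho> f] assms(2) by auto
    thus "pole_count f R \<le> R ^ Suc K" using R' by (simp add: pole_count_def)
    assume nd: "\<forall>\<rho>\<in>divisor_set f. norm \<rho> \<noteq> R"
    have "norm (f (of_real R * cis \<theta>)) \<le> max_modulus f (R + 1)" for \<theta>
      unfolding max_modulus_def
    proof (rule cSUP_upper)
      have "bounded (f ` cball 0 (R + 1))"
        by (intro compact_imp_bounded compact_continuous_image cont) auto
      hence "bdd_above ((\<lambda>z. norm (f z)) ` cball 0 (R + 1))"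
        by (auto simp: bounded_iff bdd_above_def)
      thus "bdd_above ((\<lambda>z. norm (f z)) ` ball 0 (R + 1))"
        by (rule bdd_above_mono) auto
    qed (use R' in \<open>auto simp: norm_mult\<close>)
    hence le: "max 0 (ln (norm (f (of_real R * cis \<theta>)))) \<le> (R + 1) ^ K" for \<theta>
      using nonzero_on_circle[OF nd, of \<theta>] R' KR[of "R + 1"]
      by (smt (verit) ln_mono zero_le_power zero_less_norm_iff)
    have "log_plus_integral R \<le> integral {0..2*pi} (\<lambda>_. (R + 1) ^ K)"
      unfolding log_plus_integral_def using R' nd le
      by (intro integral_le integrable_continuous_real continuous_intros continuous_on_log_circle) auto
    also have "\<dots> = 2 * pi * (R + 1) ^ K" by simp
    also have "\<dots> \<le> 8 * (2 * R) ^ K"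
      using pi_less_4 R' by (intro mult_mono power_mono) auto
    also have "\<dots> \<le> R ^ Suc K"
      by (rule power_bound_absorb) (use R' in auto)
    finally show "log_plus_integral R \<le> R ^ Suc K" .
  qed
qed

lemma growth_of_finite_order:
  assumes "meromorphic_order f < \<infinity>"
  obtains K :: nat and R0 where
    "\<And>R. R \<ge> R0 \<Longrightarrow> \<forall>\<rho>\<in>divisor_set f. norm \<rho> \<noteq> R \<Longrightarrow> log_plus_integral R \<le> R ^ K"
    "\<And>R. R \<ge> R0 \<Longrightarrow> pole_count f R \<le> R ^ K"
proof (cases "f holomorphic_on UNIV")
  case True
  hence "entire_order f < \<infinity>" using assms by (simp add: meromorphic_order_def)
  thus thesis by (rule growth_of_finite_entire_order[OF _ True that])
next
  case False
  hence "nevanlinna_order f < \<infinity>" using assms by (simp add: meromorphic_order_def)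
  thus thesis by (rule growth_of_finite_nevanlinna_order[OF _ that])
qed

end

section \<open>The Poisson--Jensen formula\<close>

lemma ln_powi:
  fixes x :: real
  assumes "x > 0"
  shows "ln (x powi n) = of_int n * ln x"
  using assms by (cases n rule: int_cases2) (auto simp: power_int_minus ln_inverse ln_realpow)

context nonzero_meromorphic
begin

definition divisor_free_annulus :: "real \<Rightarrow> real \<Rightarrow> bool" where
  "divisor_free_annulus a b \<longleftrightarrow> 0 < a \<and> a < b \<and> (\<forall>\<rho>\<in>divisor_set f. norm \<rho> < a \<or> b < norm \<rho>)"

text \<open>
  \<open>L\<close> is a logarithm, on the disc of radius \<open>b\<close>, of \<open>f\<close> with its zeros and poles there divided out.
\<close>

definition log_factor :: "real \<Rightarrow> (complex \<Rightarrow> complex) \<Rightarrow> bool" where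
  "log_factor b L \<longleftrightarrow> L holomorphic_on ball 0 b \<and>
     (\<forall>s\<in>ball 0 b - divisor_set f.
        f s = exp (L s) * (\<Prod>\<rho>\<in>divisor_set f \<inter> ball 0 b. (s - \<rho>) powi zorder f \<rho>))"

definition divisor_mass :: "real \<Rightarrow> real" where
  "divisor_mass R = (\<Sum>\<rho>\<in>divisor_set f \<inter> ball 0 R. of_int \<bar>zorder f \<rho>\<bar>)"

lemma divisor_mass_mono: "R \<le> S \<Longrightarrow> divisor_mass R \<le> divisor_mass S"
  unfolding divisor_mass_def by (rule sum_mono2) (auto intro: finite_divisor_ball)

lemma log_factor_exists: obtains L where "log_factor b L"
proof (rule disc_factorization[of b])
  fix L assume "L holomorphic_on ball 0 b"
    "\<And>s. s \<in> ball 0 b - divisor_set f \<Longrightarrow>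
      f s = exp (L s) * (\<Prod>\<rho>\<in>divisor_set f \<inter> ball 0 b. (s - \<rho>) powi zorder f \<rho>)"
  thus thesis by (intro that[of L]) (simp add: log_factor_def)
qed

lemma divisor_free_annulus_exists:
  assumes "x \<ge> 0"
  obtains a b where "x < a" "b < x + 1" "divisor_free_annulus a b"
proof -
  define N where "N = norm ` (divisor_set f \<inter> cball 0 (x + 1))"
  have "finite N" unfolding N_def by (intro finite_imageI finite_divisor_cball)
  hence "open ({x<..<x+1} - N)"
    by (intro open_Diff finite_imp_closed) auto
  moreover have "infinite ({x<..<x+1} - N)"
    using \<open>finite N\<close> by (simp add: infinite_Ioo)
  then obtain y where y: "y \<in> {x<..<x+1} - N"
    by (metis ex_in_conv finite.emptyI)
  ultimately obtain e where e: "e > 0" "ball y e \<subseteq> {x<..<x+1} - N"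
    by (meson open_contains_ball)
  define b where "b = y + e / 2"
  have sub: "{y..b} \<subseteq> ball y e"
    using e by (auto simp: b_def dist_real_def)
  have "b \<in> {x<..<x+1}"
  proof -
    have "b \<in> {y..b}" using e by (simp add: b_def)
    thus ?thesis using sub e by blast
  qed
  hence "b < x + 1" by simp
  have "x < y" using y by simp
  have "divisor_free_annulus y b"
    unfolding divisor_free_annulus_def
  proof (intro conjI ballI)
    fix \<rho> assume \<rho>: "\<rho> \<in> divisor_set f"
    show "norm \<rho> < y \<or> b < norm \<rho>"
    proof (rule ccontr)
      assume "\<not> (norm \<rho> < y \<or> b < norm \<rho>)"
      hence "norm \<rho> \<in> {y..b}" by auto
      moreover from this have "norm \<rho> \<in> N"
        using \<rho> \<open>b < x + 1\<close> by (auto simp: N_def)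
      ultimately show False using sub e by blast
    qed
  qed (use e y assms in \<open>auto simp: b_def\<close>)
  with that show thesis using \<open>b < x + 1\<close> \<open>x < y\<close> by blast
qed

text \<open>
  On the circle of radius \<open>a\<close>, \<open>a\<^sup>2 = s * cnj s\<close>; so the linear factor \<open>s - \<rho>\<close> can be traded for
  \<open>(a\<^sup>2 - cnj \<rho> * s) / a\<close>, which has no zero in the disc, without changing the modulus.
\<close>

lemma norm_blaschke_on_circle:
  assumes "norm s = a" "a > 0"
  shows "a * norm (1 - cnj \<rho> * s / of_real (a\<^sup>2)) = norm (s - \<rho>)"
proof -
  have "of_real (a\<^sup>2) = s * cnj s"
    using assms by (simp add: complex_norm_square[symmetric])
  hence "of_real a * (1 - cnj \<rho> * s / of_real (a\<^sup>2)) = s * (cnj s - cnj \<rho>) / of_real a"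
    using assms by (simp add: field_simps power2_eq_square)
  hence "norm (of_real a * (1 - cnj \<rho> * s / of_real (a\<^sup>2))) = norm (s * (cnj s - cnj \<rho>) / of_real a)"
    by (rule arg_cong)
  thus ?thesis
    using assms by (simp add: norm_mult norm_divide flip: complex_cnj_diff)
qed

text \<open>
  \<open>F\<close> is a logarithm of \<open>f\<close> divided by its Blaschke product for the disc of radius \<open>a\<close>. It extends
  beyond the closed disc because the finitely many points \<open>\<rho>\<close> stay away from the circle, and so do their
  reflections \<open>a\<^sup>2 / cnj \<rho>\<close>.
\<close>

lemma poisson_jensen:
  assumes "divisor_free_annulus a b" "log_factor b L"
  defines "F \<equiv> \<lambda>s. L s + (\<Sum>\<rho>\<in>divisor_set f \<inter> ball 0 b. of_int (zorder f \<rho>) *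
                     (of_real (ln a) + Ln (1 - cnj \<rho> * s / of_real (a\<^sup>2))))"
  obtains r where "r > a" "F holomorphic_on ball 0 r"
    "\<And>t. Re (F (of_real a * cis t)) = ln (norm (f (of_real a * cis t)))"
proof -
  define D where "D = divisor_set f \<inter> ball 0 b"
  have fin: "finite D" unfolding D_def by (rule finite_divisor_ball)
  have ab: "0 < a" "a < b" using assms(1) by (auto simp: divisor_free_annulus_def)
  have D_less: "norm \<rho> < a" if "\<rho> \<in> D" for \<rho>
    using assms(1) that by (auto simp: D_def divisor_free_annulus_def)
  have L: "L holomorphic_on ball 0 b"
    "\<And>s. s \<in> ball 0 b - divisor_set f \<Longrightarrow> f s = exp (L s) * (\<Prod>\<rho>\<in>D. (s - \<rho>) powi zorder f \<rho>)"
    using assms(2) by (auto simp: log_factor_def D_def)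
  \<comment> \<open>a / 2 is a filler that keeps m positive when D is empty or consists of 0\<close>
  define m where "m = Max (insert (a / 2) (norm ` D))"
  have m: "0 < m" "m < a" "\<And>\<rho>. \<rho> \<in> D \<Longrightarrow> norm \<rho> \<le> m"
    using fin ab D_less by (auto simp: m_def less_max_iff_disj Max_gr_iff)
  define r where "r = min b (a\<^sup>2 / m)"
  have "r > a"
    using ab m by (simp add: r_def field_simps power2_eq_square)
  moreover have "F holomorphic_on ball 0 r"
  proof -
    have "1 - cnj \<rho> * s / of_real (a\<^sup>2) \<notin> \<real>\<^sub>\<le>\<^sub>0" if "\<rho> \<in> D" "s \<in> ball 0 r" for \<rho> s
    proof -
      have "norm (cnj \<rho> * s / of_real (a\<^sup>2)) = norm \<rho> * norm s / a\<^sup>2"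
        using ab by (simp add: norm_mult norm_divide norm_power)
      also have "\<dots> \<le> m * norm s / a\<^sup>2"
        using m that by (intro divide_right_mono mult_right_mono) auto
      also have "\<dots> < 1"
        using that m ab by (auto simp: r_def field_simps)
      finally have "Re (cnj \<rho> * s / of_real (a\<^sup>2)) < 1"
        using complex_Re_le_cmod order_le_less_trans by blast
      hence "Re (1 - cnj \<rho> * s / of_real (a\<^sup>2)) > 0" by simp
      thus ?thesis by (auto simp: complex_nonpos_Reals_iff)
    qed
    moreover have "L holomorphic_on ball 0 r"
      by (rule holomorphic_on_subset[OF L(1)]) (auto simp: r_def)
    ultimately show ?thesis
      unfolding F_def D_def[symmetric] using ab by (intro holomorphic_intros) auto
  qed
  moreover have "Re (F (of_real a * cis t)) = ln (norm (f (of_real a * cis t)))" for t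
  proof -
    define s where "s = of_real a * cis t"
    have s: "norm s = a" using ab by (simp add: s_def norm_mult)
    have nd: "s \<in> ball 0 b - divisor_set f"
      using assms(1) s ab by (auto simp: divisor_free_annulus_def)
    have nz: "norm (s - \<rho>) > 0" if "\<rho> \<in> D" for \<rho> using that nd by (auto simp: D_def)
    have "Re (F s) = Re (L s) + (\<Sum>\<rho>\<in>D. of_int (zorder f \<rho>) * ln (norm (s - \<rho>)))"
    proof -
      have "Re (of_real (ln a) + Ln (1 - cnj \<rho> * s / of_real (a\<^sup>2))) = ln (norm (s - \<rho>))"
        if "\<rho> \<in> D" for \<rho>
      proof -
        have eq: "norm (s - \<rho>) = a * norm (1 - cnj \<rho> * s / of_real (a\<^sup>2))"
          by (rule norm_blaschke_on_circle[symmetric, OF s ab(1)])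
        hence pos: "norm (1 - cnj \<rho> * s / of_real (a\<^sup>2)) > 0"
          using nz[OF that] ab by (simp add: zero_less_mult_iff)
        hence "1 - cnj \<rho> * s / of_real (a\<^sup>2) \<noteq> 0" by force
        thus ?thesis unfolding eq using pos ab by (simp add: ln_mult)
      qed
      moreover have "Re (of_int (zorder f \<rho>) * z) = of_int (zorder f \<rho>) * Re z" for \<rho> z
        by simp
      ultimately show ?thesis
        unfolding F_def D_def[symmetric] by (simp only: plus_complex.simps Re_sum cong: sum.cong)
    qed
    also have "\<dots> = ln (norm (f s))"
    proof -
      have "norm (f s) = exp (Re (L s)) * (\<Prod>\<rho>\<in>D. norm (s - \<rho>) powi zorder f \<rho>)"
        using L(2)[OF nd] by (simp add: norm_mult prod_norm[symmetric] norm_power_int)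
      also have "ln \<dots> = Re (L s) + ln (\<Prod>\<rho>\<in>D. norm (s - \<rho>) powi zorder f \<rho>)"
      proof -
        have "(\<Prod>\<rho>\<in>D. norm (s - \<rho>) powi zorder f \<rho>) > 0" using nz by (intro prod_pos) auto
        thus ?thesis by (simp add: ln_mult)
      qed
      also have "ln (\<Prod>\<rho>\<in>D. norm (s - \<rho>) powi zorder f \<rho>) = (\<Sum>\<rho>\<in>D. of_int (zorder f \<rho>) * ln (norm (s - \<rho>)))"
        using nz fin by (subst ln_prod) (auto simp: ln_powi intro!: sum.cong)
      finally show ?thesis by simp
    qed
    finally show ?thesis by (simp add: s_def)
  qed
  ultimately show thesis using that by blast
qed

text \<open>
  Two discs give two logarithms; the quotient of their exponentials is the product of the linear
  factors of the points between the discs. Evaluated at \<open>0\<close>, which may itself be in the divisor, so the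
  comparison goes through a limit.
\<close>

lemma log_factor_at_0:
  assumes "log_factor b L" "log_factor b0 L0" "0 < b0" "b0 \<le> b"
  shows "Re (L0 0) = Re (L 0) + (\<Sum>\<rho>\<in>divisor_set f \<inter> ball 0 b - ball 0 b0. of_int (zorder f \<rho>) * ln (norm \<rho>))"
proof -
  define D where "D = divisor_set f \<inter> ball 0 b"
  define E where "E = D - ball 0 b0"
  have fin: "finite D" unfolding D_def by (rule finite_divisor_ball)
  have D0: "divisor_set f \<inter> ball 0 b0 = D - E" "E \<subseteq> D"
    using assms(4) by (auto simp: D_def E_def)
  have E0: "\<rho> \<noteq> 0" if "\<rho> \<in> E" for \<rho> using that assms(3) by (auto simp: E_def)
  have cont: "isCont L 0" "isCont L0 0"
    using assms by (auto simp: log_factor_def intro!: continuous_on_interior[OF holomorphic_on_imp_continuous_on])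
  have "eventually (\<lambda>s. s \<in> ball 0 b0) (at 0)"
    using assms(3) by (intro eventually_at_in_open') auto
  hence "eventually (\<lambda>s. exp (L0 s) = exp (L s) * (\<Prod>\<rho>\<in>E. (s - \<rho>) powi zorder f \<rho>)) (at 0)"
    using eventually_nonzero[of 0]
  proof eventually_elim
    case (elim s)
    have s: "s \<in> ball 0 b0 - divisor_set f" "s \<in> ball 0 b - divisor_set f"
      using elim assms by (auto simp: divisor_set_eq)
    have "exp (L0 s) * (\<Prod>\<rho>\<in>D - E. (s - \<rho>) powi zorder f \<rho>)
        = exp (L s) * (\<Prod>\<rho>\<in>D. (s - \<rho>) powi zorder f \<rho>)"
      using assms(1,2) s unfolding log_factor_def D_def[symmetric] D0(1) by metis
    also have "(\<Prod>\<rho>\<in>D. (s - \<rho>) powi zorder f \<rho>)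
      = (\<Prod>\<rho>\<in>D - E. (s - \<rho>) powi zorder f \<rho>) * (\<Prod>\<rho>\<in>E. (s - \<rho>) powi zorder f \<rho>)"
      using prod.subset_diff[OF D0(2) fin] by blast
    finally show ?case
      using s fin by (auto simp: D_def)
  qed
  moreover have "((\<lambda>s. exp (L0 s)) \<longlongrightarrow> exp (L0 0)) (at 0)"
    using cont by (intro tendsto_intros) (auto simp: isCont_def)
  ultimately have "((\<lambda>s. exp (L s) * (\<Prod>\<rho>\<in>E. (s - \<rho>) powi zorder f \<rho>)) \<longlongrightarrow> exp (L0 0)) (at 0)"
    by (rule Lim_transform_eventually[rotated])
  moreover have "((\<lambda>s. exp (L s) * (\<Prod>\<rho>\<in>E. (s - \<rho>) powi zorder f \<rho>))
      \<longlongrightarrow> exp (L 0) * (\<Prod>\<rho>\<in>E. (0 - \<rho>) powi zorder f \<rho>)) (at 0)"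
    using cont E0 by (intro tendsto_intros) (auto simp: isCont_def)
  ultimately have "exp (L0 0) = exp (L 0) * (\<Prod>\<rho>\<in>E. (0 - \<rho>) powi zorder f \<rho>)"
    using tendsto_unique[OF at_neq_bot] by blast
  hence "norm (exp (L0 0)) = norm (exp (L 0) * (\<Prod>\<rho>\<in>E. (0 - \<rho>) powi zorder f \<rho>))"
    by (rule arg_cong)
  hence "exp (Re (L0 0)) = exp (Re (L 0)) * (\<Prod>\<rho>\<in>E. norm \<rho> powi zorder f \<rho>)"
    by (simp add: norm_mult prod_norm[symmetric] norm_power_int)
  hence "ln (exp (Re (L0 0))) = ln (exp (Re (L 0)) * (\<Prod>\<rho>\<in>E. norm \<rho> powi zorder f \<rho>))"
    by (rule arg_cong)
  also have "\<dots> = Re (L 0) + ln (\<Prod>\<rho>\<in>E. norm \<rho> powi zorder f \<rho>)"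
  proof -
    have "(\<Prod>\<rho>\<in>E. norm \<rho> powi zorder f \<rho>) > 0" using E0 by (intro prod_pos) auto
    thus ?thesis by (simp add: ln_mult)
  qed
  also have "ln (\<Prod>\<rho>\<in>E. norm \<rho> powi zorder f \<rho>) = (\<Sum>\<rho>\<in>E. of_int (zorder f \<rho>) * ln (norm \<rho>))"
    using E0 finite_subset[OF D0(2) fin] by (subst ln_prod) (auto simp: ln_powi intro!: sum.cong)
  finally show ?thesis by (simp add: E_def D_def)
qed

text \<open>
  The mean value of \<open>Re F\<close> over the circle is at most the proximity function. By \<open>log_factor_at_0\<close> it is also a
  constant plus \<open>\<Sum>\<rho>. n\<^sub>\<rho> * ln (a / \<bar>\<rho>\<bar>)\<close>. Poles enter this sum negatively, and their number is under
  control; so zeros of modulus below \<open>a / 3\<close>, each of weight at least \<open>ln 3 \<ge> 1\<close>, are few. The same two facts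
  bound the mean of \<open>\<bar>Re F\<bar>\<close>, since \<open>\<bar>x\<bar> = 2 * max 0 x - x\<close>. Passing from \<open>F\<close> to \<open>L\<close> costs the logarithms
  of the reflected factors, which Cauchy's inequality on the disc of radius \<open>a / 2\<close> controls by the number
  of points.
\<close>

lemma finite_order_bounds:
  assumes "meromorphic_order f < \<infinity>"
  obtains M :: nat and C R1 :: real where "C \<ge> 0" "R1 \<ge> 1"
    "\<And>R. R \<ge> R1 \<Longrightarrow> divisor_mass R \<le> C * R ^ M"
    "\<And>a b L k. divisor_free_annulus a b \<Longrightarrow> a \<ge> R1 \<Longrightarrow> log_factor b L \<Longrightarrow> k > 0 \<Longrightarrow>
        norm ((deriv ^^ k) L 0 / fact k) * a ^ k \<le> C * 2 ^ k * a ^ M"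
proof -
  obtain K :: nat and R0 where
    K: "\<And>R. R \<ge> R0 \<Longrightarrow> \<forall>\<rho>\<in>divisor_set f. norm \<rho> \<noteq> R \<Longrightarrow> log_plus_integral R \<le> R ^ K"
       "\<And>R. R \<ge> R0 \<Longrightarrow> pole_count f R \<le> R ^ K"
    using growth_of_finite_order[OF assms] by metis
  obtain L0 where L0: "log_factor 1 L0" by (rule log_factor_exists)
  define c0 where "c0 = \<bar>Re (L0 0)\<bar>"
  \<comment> \<open>from radius 3 on, ln a is at least 1\<close>
  define R2 where "R2 = max 3 R0"
  define n where "n = zorder f"
  define F where "F = (\<lambda>a b L s. L s + (\<Sum>\<rho>\<in>divisor_set f \<inter> ball 0 b. of_int (zorder f \<rho>) *
                     (of_real (ln a) + Ln (1 - cnj \<rho> * s / of_real (a\<^sup>2)))))"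
  have jensen:
    "divisor_mass (a / 3) \<le> (c0 + 4) * a ^ Suc K \<and>
     (\<forall>k>0. norm ((deriv ^^ k) (F a b L) 0 / fact k) * a ^ k \<le> (2 * c0 + 4) * a ^ Suc K) \<and>
     (\<exists>r>a. F a b L holomorphic_on ball 0 r)"
    if ab: "divisor_free_annulus a b" and a: "a \<ge> R2" and L: "log_factor b L" for a b L
  proof -
    define D where "D = divisor_set f \<inter> ball 0 b"
    have fin: "finite D" unfolding D_def by (rule finite_divisor_ball)
    have a3: "a \<ge> 3" "a \<ge> R0" using a by (auto simp: R2_def)
    have ab': "a < b" using ab by (auto simp: divisor_free_annulus_def)
    have clear: "\<forall>\<rho>\<in>divisor_set f. norm \<rho> \<noteq> a"
      using ab by (auto simp: divisor_free_annulus_def)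
    have D_less: "norm \<rho> < a" if "\<rho> \<in> D" for \<rho>
      using ab that by (auto simp: D_def divisor_free_annulus_def)
    obtain r where r: "r > a" "F a b L holomorphic_on ball 0 r"
      "\<And>t. Re (F a b L (of_real a * cis t)) = ln (norm (f (of_real a * cis t)))"
      using poisson_jensen[OF ab L] unfolding F_def by blast
    define I where "I = integral {0..2*pi} (\<lambda>t. ln (norm (f (of_real a * cis t))))"
    define u where "u = Re (F a b L 0)"
    have cont: "continuous_on {0..2*pi} (\<lambda>t. ln (norm (f (of_real a * cis t))))"
      using clear a3 by (intro continuous_on_log_circle) auto
    have "I = 2 * pi * u"
      using mean_value_Re[OF r(2), of a] r a3 unfolding I_def u_def
      by (intro integral_unique) simp
    have pos: "log_plus_integral a \<le> a ^ K" using K(1)[of a] clear a3 by auto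
    have "I \<le> log_plus_integral a"
      unfolding I_def log_plus_integral_def
      by (intro integral_le integrable_continuous_real continuous_intros cont) auto
    have abs: "integral {0..2*pi} (\<lambda>t. \<bar>Re (F a b L (of_real a * cis t))\<bar>) = 2 * log_plus_integral a - I"
    proof -
      have "integral {0..2*pi} (\<lambda>t. \<bar>Re (F a b L (of_real a * cis t))\<bar>)
        = integral {0..2*pi} (\<lambda>t. 2 * max 0 (ln (norm (f (of_real a * cis t)))) - ln (norm (f (of_real a * cis t))))"
        unfolding r(3) by (intro integral_cong) auto
      also have "\<dots> = 2 * log_plus_integral a - I"
        unfolding log_plus_integral_def I_def
        by (subst integral_diff) (auto intro!: integrable_continuous_real continuous_intros cont)
      finally show ?thesis .
    qed
    (* points in the unit disc, among them possibly 0, are weighted by ln a instead of ln (a / |rho|);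
       the difference is absorbed in the logarithm L0 for the unit disc *)
    define w where "w = (\<lambda>\<rho>::complex. if \<rho> \<in> ball 0 1 then ln a else ln (a / norm \<rho>))"
    have u_eq: "u = Re (L0 0) + (\<Sum>\<rho>\<in>D. n \<rho> * w \<rho>)"
    proof -
      have "u = Re (L 0) + (\<Sum>\<rho>\<in>D. n \<rho> * ln a)"
        by (simp add: u_def F_def D_def n_def)
      also have "(\<Sum>\<rho>\<in>D. n \<rho> * ln a)
        = (\<Sum>\<rho>\<in>D. n \<rho> * w \<rho>) + (\<Sum>\<rho>\<in>D. if \<rho> \<in> ball 0 1 then 0 else n \<rho> * ln (norm \<rho>))"
        unfolding sum.distrib[symmetric] using a3
        by (intro sum.cong refl) (auto simp: w_def ln_div algebra_simps)
      also have "(\<Sum>\<rho>\<in>D. if \<rho> \<in> ball 0 1 then 0 else n \<rho> * ln (norm \<rho>))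
        = (\<Sum>\<rho>\<in>D - ball 0 1. n \<rho> * ln (norm \<rho>))"
        using fin by (intro sum.mono_neutral_cong_right) auto
      also have "Re (L 0) + ((\<Sum>\<rho>\<in>D. n \<rho> * w \<rho>) + \<dots>) = Re (L0 0) + (\<Sum>\<rho>\<in>D. n \<rho> * w \<rho>)"
        using log_factor_at_0[OF L L0] a3 ab' by (simp add: D_def n_def)
      finally show ?thesis .
    qed
    have w_nonneg: "0 \<le> w \<rho>" and w_le: "w \<rho> \<le> a" and w_ge_1: "norm \<rho> < a / 3 \<Longrightarrow> 1 \<le> w \<rho>"
      if "\<rho> \<in> D" for \<rho>
    proof -
      have ln3: "1 \<le> ln (3::real)" using exp_le by (subst ln_ge_iff) auto
      have "ln 3 \<le> ln a" using a3 by (intro ln_mono) auto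
      hence lna: "ln a \<le> a" "1 \<le> ln a"
        using a3 ln_le_minus_one[of a] ln3 by linarith+
      have "0 \<le> ln (a / norm \<rho>)" if "norm \<rho> \<ge> 1"
        using that D_less[OF \<open>\<rho> \<in> D\<close>] by (intro ln_ge_zero) (auto simp: le_divide_eq)
      thus "0 \<le> w \<rho>" using lna by (auto simp: w_def)
      have "ln (a / norm \<rho>) \<le> ln a" if "norm \<rho> \<ge> 1"
        using that a3 by (simp add: ln_div)
      thus "w \<rho> \<le> a" using lna by (auto simp: w_def)
      assume "norm \<rho> < a / 3"
      hence "norm \<rho> \<ge> 1 \<Longrightarrow> 3 \<le> a / norm \<rho>" by (auto simp: le_divide_eq)
      hence "norm \<rho> \<ge> 1 \<Longrightarrow> ln 3 \<le> ln (a / norm \<rho>)" by (intro ln_mono) auto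
      thus "1 \<le> w \<rho>" using ln3 lna by (auto simp: w_def)
    qed
    define P where "P = (\<Sum>\<rho> | \<rho> \<in> D \<and> is_pole f \<rho>. of_int \<bar>n \<rho>\<bar> :: real)"
    define Z where "Z = (\<Sum>\<rho> | \<rho> \<in> D \<and> \<not> is_pole f \<rho> \<and> norm \<rho> < a / 3. of_int \<bar>n \<rho>\<bar> :: real)"
    have "P \<le> pole_count f a"
      unfolding P_def pole_count_def n_def
      by (rule sum_mono2) (auto intro: finite_poles dest: D_less)
    hence P_le: "P \<le> a ^ K" using K(2)[of a] a3 by auto
    have P_nonneg: "P \<ge> 0" unfolding P_def by (intro sum_nonneg) auto
    have Z_nonneg: "Z \<ge> 0" unfolding Z_def by (intro sum_nonneg) auto
    have sum_ge: "(\<Sum>\<rho>\<in>D. n \<rho> * w \<rho>) \<ge> Z - P * a"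
    proof -
      have "n \<rho> * w \<rho> \<ge> (if \<not> is_pole f \<rho> \<and> norm \<rho> < a / 3 then of_int \<bar>n \<rho>\<bar> else 0)
          - (if is_pole f \<rho> then of_int \<bar>n \<rho>\<bar> * a else 0)" if "\<rho> \<in> D" for \<rho>
      proof (cases "is_pole f \<rho>")
        case True
        hence "n \<rho> < 0" by (simp add: n_def zorder_pole)
        thus ?thesis using True w_le[OF that] by (simp add: mult_left_mono)
      next
        case False
        hence "n \<rho> > 0" using that by (auto simp: n_def D_def divisor_set_eq zorder_zero)
        thus ?thesis using False w_nonneg[OF that] w_ge_1[OF that]
          mult_left_mono[of 1 "w \<rho>" "of_int (n \<rho>)"] by auto
      qed
      hence "(\<Sum>\<rho>\<in>D. n \<rho> * w \<rho>) \<ge> (\<Sum>\<rho>\<in>D. (if \<not> is_pole f \<rho> \<and> norm \<rho> < a / 3 then of_int \<bar>n \<rho>\<bar> else 0)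
          - (if is_pole f \<rho> then of_int \<bar>n \<rho>\<bar> * a else 0))"
        by (intro sum_mono) auto
      also have "(\<Sum>\<rho>\<in>D. (if \<not> is_pole f \<rho> \<and> norm \<rho> < a / 3 then of_int \<bar>n \<rho>\<bar> else 0)
          - (if is_pole f \<rho> then of_int \<bar>n \<rho>\<bar> * a else 0)) = Z - P * a"
        unfolding sum_subtractf Z_def P_def sum_distrib_right
        using fin by (intro arg_cong2[of _ _ _ _ "(-)"] sum.mono_neutral_cong_right) auto
      finally show ?thesis .
    qed
    have pw: "1 \<le> a ^ K" "a ^ K \<le> a ^ Suc K" "1 \<le> a ^ Suc K"
      using a3 by (auto intro!: one_le_power power_increasing simp del: power_Suc)
    have Pa: "P * a \<le> a ^ Suc K" using mult_right_mono[OF P_le, of a] a3 by (simp add: mult.commute)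
    have c0: "c0 \<le> c0 * a ^ Suc K" "0 \<le> c0"
      using mult_left_mono[OF pw(3), of c0] by (simp_all add: c0_def)
    have u_ge: "u \<ge> Z - c0 - a ^ Suc K"
      using sum_ge u_eq Pa unfolding c0_def by linarith
    have "u \<le> log_plus_integral a"
    proof -
      have "log_plus_integral a \<ge> 0" unfolding log_plus_integral_def by (intro integral_nonneg integrable_continuous_real continuous_intros cont) auto
      moreover have "2 * pi * u \<le> log_plus_integral a" using \<open>I = 2 * pi * u\<close> \<open>I \<le> log_plus_integral a\<close> by simp
      moreover have "u \<le> 2 * pi * u" if "u \<ge> 0"
        using mult_right_mono[of 1 "2 * pi" u] pi_ge_two that by simp
      ultimately show ?thesis by linarith
    qed
    hence "Z \<le> c0 + 2 * a ^ Suc K" using u_ge pos pw by linarith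
    moreover have "divisor_mass (a / 3) \<le> Z + P"
    proof -
      have "divisor_mass (a / 3) \<le> (\<Sum>\<rho>\<in>{\<rho> \<in> D. \<not> is_pole f \<rho> \<and> norm \<rho> < a / 3} \<union> {\<rho> \<in> D. is_pole f \<rho>}. of_int \<bar>n \<rho>\<bar>)"
        unfolding divisor_mass_def n_def
      proof (rule sum_mono2)
        show "finite ({\<rho> \<in> D. \<not> is_pole f \<rho> \<and> norm \<rho> < a / 3} \<union> {\<rho> \<in> D. is_pole f \<rho>})"
          using fin by simp
      qed (use a3 ab' in \<open>auto simp: D_def\<close>)
      also have "\<dots> = Z + P"
        unfolding Z_def P_def using fin by (intro sum.union_disjoint) auto
      finally show ?thesis .
    qed
    ultimately have mass: "divisor_mass (a / 3) \<le> (c0 + 4) * a ^ Suc K"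
      using P_le pw c0 by (simp only: distrib_right)
    have "norm ((deriv ^^ k) (F a b L) 0 / fact k) * a ^ k \<le> (2 * c0 + 4) * a ^ Suc K" if "k > 0" for k
    proof -
      have "norm ((deriv ^^ k) (F a b L) 0 / fact k) * a ^ k * pi \<le> 2 * log_plus_integral a - 2 * pi * u"
        using norm_taylor_coefficient_le_integral_Re[OF r(2) _ r(1) that] a3
        unfolding abs \<open>I = 2 * pi * u\<close> by simp
      also have "\<dots> \<le> 2 * a ^ Suc K + 2 * pi * (c0 + a ^ Suc K)"
      proof -
        have "- u \<le> c0 + a ^ Suc K" using u_ge Z_nonneg by linarith
        from mult_left_mono[OF this, of "2 * pi"]
        have "- (2 * pi * u) \<le> 2 * pi * (c0 + a ^ Suc K)" by (simp del: power_Suc)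
        thus ?thesis using pos pw(2) by linarith
      qed
      also have "\<dots> \<le> pi * a ^ Suc K + 2 * pi * (c0 * a ^ Suc K + a ^ Suc K)"
        using c0 pi_ge_two pw by (intro add_mono mult_mono) auto
      also have "\<dots> \<le> ((2 * c0 + 4) * a ^ Suc K) * pi"
        using pw by (simp add: algebra_simps)
      finally show ?thesis by simp
    qed
    with mass r show ?thesis by blast
  qed
  define C1 where "C1 = (c0 + 4) * 4 ^ Suc K"
  have c0_nonneg: "c0 \<ge> 0" by (simp add: c0_def)
  have mass: "divisor_mass R \<le> C1 * R ^ Suc K" if "R \<ge> R2" for R
  proof -
    have R3: "R \<ge> 3" using that by (simp add: R2_def)
    obtain a b where ab: "3 * R < a" "b < 3 * R + 1" "divisor_free_annulus a b"
      using divisor_free_annulus_exists[of "3 * R"] R3 by auto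
    have ab': "a < b" using ab by (auto simp: divisor_free_annulus_def)
    obtain L where L: "log_factor b L" by (rule log_factor_exists)
    have "divisor_mass R \<le> divisor_mass (a / 3)"
      using ab by (intro divisor_mass_mono) simp
    also have "\<dots> \<le> (c0 + 4) * a ^ Suc K"
      using jensen[OF ab(3) _ L] ab R3 that by simp
    also have "\<dots> \<le> (c0 + 4) * (4 * R) ^ Suc K"
      using ab ab' R3 c0_nonneg by (intro mult_left_mono power_mono) auto
    also have "\<dots> = C1 * R ^ Suc K"
      unfolding C1_def power_mult_distrib by (simp only: mult.assoc)
    finally show ?thesis .
  qed
  define C where "C = 2 * c0 + 5 + C1"
  have C1: "C1 \<ge> 0" "C1 \<le> C" using c0_nonneg by (auto simp: C_def C1_def)
  show thesis
  proof (rule that[of C R2 "Suc K"])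
    show "C \<ge> 0" "R2 \<ge> 1" using C1 by (auto simp: R2_def)
    fix R assume R: "R \<ge> R2"
    hence "R ^ Suc K \<ge> 0" by (intro zero_le_power) (simp add: R2_def)
    from mult_right_mono[OF C1(2) this] mass[OF R]
    show "divisor_mass R \<le> C * R ^ Suc K" by linarith
  next
    fix a b L and k :: nat
    assume ab: "divisor_free_annulus a b" and a: "a \<ge> R2" and L: "log_factor b L" and k: "k > 0"
    define D where "D = divisor_set f \<inter> ball 0 b"
    define W where "W = (\<lambda>s. \<Sum>\<rho>\<in>D. of_int (n \<rho>) *
                     (of_real (ln a) + Ln (1 - cnj \<rho> * s / of_real (a\<^sup>2))))"
    have a0: "a \<ge> 1" using a by (simp add: R2_def)
    have D_less: "norm \<rho> < a" if "\<rho> \<in> D" for \<rho>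
      using ab that by (auto simp: D_def divisor_free_annulus_def)
    have small: "norm (cnj \<rho> * s / of_real (a\<^sup>2)) < c" if "\<rho> \<in> D" "norm s \<le> c * a" "c > 0" for \<rho> s :: complex and c
    proof -
      have "norm \<rho> * norm s \<le> norm \<rho> * (c * a)" using that by (intro mult_left_mono) auto
      also have "\<dots> < a * (c * a)" using that a0 D_less[OF that(1)] by (intro mult_strict_right_mono) auto
      finally show ?thesis
        using a0 by (simp add: norm_mult norm_divide norm_power field_simps power2_eq_square)
    qed
    have W_holo: "W holomorphic_on ball 0 a"
    proof -
      have "1 - cnj \<rho> * s / of_real (a\<^sup>2) \<notin> \<real>\<^sub>\<le>\<^sub>0" if "\<rho> \<in> D" "s \<in> ball 0 a" for \<rho> s :: complex
      proof -
        have "norm (cnj \<rho> * s / of_real (a\<^sup>2)) < 1" using small[OF that(1), of s 1] that by simp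
        hence "Re (cnj \<rho> * s / of_real (a\<^sup>2)) < 1"
          using complex_Re_le_cmod order_le_less_trans by blast
        hence "Re (1 - cnj \<rho> * s / of_real (a\<^sup>2)) > 0" by simp
        thus ?thesis by (auto simp: complex_nonpos_Reals_iff)
      qed
      thus ?thesis unfolding W_def using a0 by (intro holomorphic_intros) auto
    qed
    have "norm ((deriv ^^ k) W 0) \<le> fact k * (divisor_mass a + 1) / (a / 2) ^ k"
    proof (rule Cauchy_higher_deriv_bound[where y = "\<Sum>\<rho>\<in>D. of_int (n \<rho>) * of_real (ln a)"])
      show "W holomorphic_on ball 0 (a / 2)"
        by (rule holomorphic_on_subset[OF W_holo]) (use a0 in auto)
      show "continuous_on (cball 0 (a / 2)) W"
        by (rule holomorphic_on_imp_continuous_on[OF holomorphic_on_subset[OF W_holo]]) (use a0 in auto)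
      fix s :: complex assume s: "s \<in> ball 0 (a / 2)"
      have "norm (\<Sum>\<rho>\<in>D. of_int (n \<rho>) * Ln (1 - cnj \<rho> * s / of_real (a\<^sup>2))) \<le> (\<Sum>\<rho>\<in>D. of_int \<bar>n \<rho>\<bar>)"
      proof (rule sum_norm_le)
        fix \<rho> assume "\<rho> \<in> D"
        hence *: "norm (cnj \<rho> * s / of_real (a\<^sup>2)) < 1 / 2" using small[of \<rho> s "1/2"] s by simp
        have "norm (Ln (1 + (- (cnj \<rho> * s / of_real (a\<^sup>2))))) \<le> 2 * norm (- (cnj \<rho> * s / of_real (a\<^sup>2)))"
          by (rule norm_Ln_le) (use * in simp)
        also have "\<dots> \<le> 1" using * by simp
        finally have "norm (Ln (1 - cnj \<rho> * s / of_real (a\<^sup>2))) \<le> 1" by simp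
        from mult_left_mono[OF this, of "of_int \<bar>n \<rho>\<bar>"]
        show "norm (of_int (n \<rho>) * Ln (1 - cnj \<rho> * s / of_real (a\<^sup>2))) \<le> of_int \<bar>n \<rho>\<bar>"
          by (simp add: norm_mult)
      qed
      also have "(\<Sum>\<rho>\<in>D. of_int \<bar>n \<rho>\<bar>) \<le> divisor_mass a"
        unfolding divisor_mass_def n_def
        by (rule sum_mono2) (use D_less in \<open>auto simp: D_def intro: finite_divisor_ball\<close>)
      finally show "W s \<in> ball (\<Sum>\<rho>\<in>D. of_int (n \<rho>) * of_real (ln a)) (divisor_mass a + 1)"
        by (simp add: W_def dist_norm norm_minus_commute distrib_left sum.distrib)
    qed (use a0 k in auto)
    hence "norm ((deriv ^^ k) W 0 / fact k) * a ^ k \<le> 2 ^ k * (divisor_mass a + 1)"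
      using a0 by (simp add: norm_divide field_simps)
    also have "\<dots> \<le> 2 ^ k * (C1 * a ^ Suc K + a ^ Suc K)"
      using mass[OF a] a0 by (intro mult_left_mono add_mono one_le_power) auto
    finally have W_le: "norm ((deriv ^^ k) W 0 / fact k) * a ^ k \<le> 2 ^ k * (C1 * a ^ Suc K + a ^ Suc K)" .
    have FL: "F a b L = (\<lambda>s. L s + W s)" by (simp add: F_def W_def D_def n_def fun_eq_iff)
    have F_le: "norm ((deriv ^^ k) (F a b L) 0 / fact k) * a ^ k \<le> 2 ^ k * ((2 * c0 + 4) * a ^ Suc K)"
    proof -
      have "norm ((deriv ^^ k) (F a b L) 0 / fact k) * a ^ k \<le> (2 * c0 + 4) * a ^ Suc K"
        using jensen[OF ab a L] k by blast
      also have "\<dots> \<le> 2 ^ k * ((2 * c0 + 4) * a ^ Suc K)"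
        using a0 c0_nonneg mult_right_mono[of 1 "2 ^ k" "(2 * c0 + 4) * a ^ Suc K"] by simp
      finally show ?thesis .
    qed
    obtain r where r: "r > a" "F a b L holomorphic_on ball 0 r"
      using jensen[OF ab a L] by blast
    have "(deriv ^^ k) (\<lambda>s. F a b L s - W s) 0 = (deriv ^^ k) (F a b L) 0 - (deriv ^^ k) W 0"
      by (rule higher_deriv_diff[where S = "ball 0 a"])
        (use r W_holo a0 in \<open>auto intro: holomorphic_on_subset\<close>)
    hence "(deriv ^^ k) L 0 / fact k = (deriv ^^ k) (F a b L) 0 / fact k - (deriv ^^ k) W 0 / fact k"
      by (simp add: FL diff_divide_distrib)
    hence "norm ((deriv ^^ k) L 0 / fact k)
        \<le> norm ((deriv ^^ k) (F a b L) 0 / fact k) + norm ((deriv ^^ k) W 0 / fact k)"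
      by (simp only: norm_triangle_ineq4)
    hence "norm ((deriv ^^ k) L 0 / fact k) * a ^ k
        \<le> (norm ((deriv ^^ k) (F a b L) 0 / fact k) + norm ((deriv ^^ k) W 0 / fact k)) * a ^ k"
      using a0 by (intro mult_right_mono) auto
    also have "\<dots> \<le> 2 ^ k * ((2 * c0 + 4) * a ^ Suc K) + 2 ^ k * (C1 * a ^ Suc K + a ^ Suc K)"
      using W_le F_le by (simp only: distrib_right)
    also have "\<dots> = C * 2 ^ k * a ^ Suc K"
      unfolding C_def by (simp only: algebra_simps)
    finally show "norm ((deriv ^^ k) L 0 / fact k) * a ^ k \<le> C * 2 ^ k * a ^ Suc K" .
  qed
qed

end

section \<open>Canonical products\<close>

text \<open>
  Canonical products and their logarithmic derivatives depend only on a discrete set of points, integer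
  weights, and an exponent of convergence.
\<close>

locale weighted_points =
  fixes A :: "complex set" and n :: "complex \<Rightarrow> int" and d :: nat
  assumes zero_notin: "0 \<notin> A"
    and finite_ball: "\<And>r. finite (A \<inter> ball 0 r)"
    and d_pos: "d \<ge> 1"
    and weight_summable: "(\<lambda>\<rho>. of_int \<bar>n \<rho>\<bar> / norm \<rho> ^ d :: real) summable_on A"
begin

definition weight :: "complex \<Rightarrow> real" where
  "weight \<rho> = of_int \<bar>n \<rho>\<bar> / norm \<rho> ^ d"

text \<open>
  The logarithm of the Weierstrass factor \<open>E\<^bsub>d-1\<^esub>\<close> on the unit disc that vanishes at \<open>0\<close>.
\<close>

definition log_E :: "complex \<Rightarrow> complex" where
  "log_E z = Ln (1 - z) + (\<Sum>k=1..d-1. z ^ k / of_nat k)"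

text \<open>
  The logarithm of that part of the canonical product whose factors have no zero in the disc of radius
  \<open>b\<close>.
\<close>

definition tail_log :: "real \<Rightarrow> complex \<Rightarrow> complex" where
  "tail_log b s = (\<Sum>\<^sub>\<infinity>\<rho>\<in>A - ball 0 b. of_int (n \<rho>) * log_E (s / \<rho>))"

lemma weight_nonneg: "weight \<rho> \<ge> 0"
  by (simp add: weight_def)

lemma weight_summable_subset: "B \<subseteq> A \<Longrightarrow> weight summable_on B"
  using weight_summable summable_on_subset_banach[of weight A B] by (simp add: weight_def[abs_def])

lemma exp_log_E: "z \<noteq> 1 \<Longrightarrow> exp (log_E z) = weierstrass_factor (d - 1) z"
  by (simp add: log_E_def weierstrass_factor_def exp_add)

lemma log_E_0 [simp]: "log_E 0 = 0"
  by (auto simp: log_E_def intro!: sum.neutral)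

lemma sum_powers_deriv:
  assumes "z \<noteq> (1::complex)"
  shows "((\<lambda>z. \<Sum>k=1..m. z ^ k / of_nat k) has_field_derivative (1 - z ^ m) / (1 - z)) (at z)"
proof -
  have "((\<lambda>z. \<Sum>k=1..m. z ^ k / of_nat k) has_field_derivative (\<Sum>k=1..m. z ^ (k - 1))) (at z)"
    by (rule DERIV_sum) (auto intro!: derivative_eq_intros)
  also have "(\<Sum>k=1..m. z ^ (k - 1)) = (\<Sum>k<m. z ^ k)"
    by (rule sum.reindex_bij_witness[of _ Suc "\<lambda>k. k - 1"]) auto
  also have "\<dots> = (1 - z ^ m) / (1 - z)"
    using assms by (simp add: sum_gp_strict)
  finally show ?thesis .
qed

lemma log_E_deriv:
  assumes "norm z < 1"
  shows "(log_E has_field_derivative - (z ^ (d - 1) / (1 - z))) (at z)"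
proof -
  have z: "z \<noteq> 1" "1 - z \<notin> \<real>\<^sub>\<le>\<^sub>0"
    using assms complex_Re_le_cmod[of z] by (auto simp: complex_nonpos_Reals_iff)
  have "((\<lambda>z. Ln (1 - z) + (\<Sum>k=1..d-1. z ^ k / of_nat k)) has_field_derivative
      - inverse (1 - z) + (1 - z ^ (d - 1)) / (1 - z)) (at z)"
    using z by (intro DERIV_add sum_powers_deriv) (auto intro!: derivative_eq_intros)
  moreover have "- inverse (1 - z) + (1 - z ^ (d - 1)) / (1 - z) = - (z ^ (d - 1) / (1 - z))"
    using z by (simp add: diff_divide_distrib inverse_eq_divide)
  ultimately show ?thesis
    unfolding log_E_def[abs_def] by simp
qed

text \<open>
  \<open>log_E\<close> vanishes to order \<open>d\<close> at \<open>0\<close>: its derivative is \<open>- z ^ (d - 1) / (1 - z)\<close>, and the bound follows by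
  integrating from \<open>0\<close>.
\<close>

lemma norm_log_E_le:
  assumes "norm z \<le> q" "q < 1"
  shows "norm (log_E z) \<le> norm z ^ d / (1 - q)"
proof -
  have "norm (log_E z - log_E 0) \<le> (norm z ^ (d - 1) / (1 - q)) * norm (z - 0)"
  proof (rule field_differentiable_bound[of "cball 0 (norm z)"])
    fix w :: complex assume "w \<in> cball 0 (norm z)"
    hence w: "norm w \<le> norm z" "norm w \<le> q" using assms by auto
    show "(log_E has_field_derivative - (w ^ (d - 1) / (1 - w))) (at w within cball 0 (norm z))"
      by (rule has_field_derivative_at_within[OF log_E_deriv]) (use w assms in linarith)
    have "1 - q \<le> norm (1 - w)"
      using norm_triangle_ineq2[of 1 w] w by simp
    thus "norm (- (w ^ (d - 1) / (1 - w))) \<le> norm z ^ (d - 1) / (1 - q)"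
      using w assms by (auto simp: norm_divide norm_power intro!: frac_le power_mono)
  qed auto
  also have "(norm z ^ (d - 1) / (1 - q)) * norm (z - 0) = norm z ^ d / (1 - q)"
    using d_pos by (cases d) auto
  finally show ?thesis by simp
qed

lemma tail_term_bound:
  assumes "\<rho> \<in> A - ball 0 b" "norm s \<le> r" "r < b"
  shows "norm (of_int (n \<rho>) * log_E (s / \<rho>)) \<le> weight \<rho> * (r ^ d / (1 - r / b))"
proof -
  have \<rho>: "norm \<rho> \<ge> b" "norm \<rho> > 0" using assms zero_notin by auto
  have r: "r \<ge> 0" using assms norm_ge_zero[of s] by linarith
  have b: "b > 0" using r assms by linarith
  have q: "r / b < 1" using b assms by simp
  have "norm (s / \<rho>) \<le> r / b"
    unfolding norm_divide using assms \<rho> b r by (intro frac_le) auto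
  hence "norm (log_E (s / \<rho>)) \<le> norm (s / \<rho>) ^ d / (1 - r / b)"
    using q by (rule norm_log_E_le)
  also have "\<dots> \<le> (r / norm \<rho>) ^ d / (1 - r / b)"
    using q \<rho> assms unfolding norm_divide by (intro divide_right_mono power_mono) auto
  finally have "\<bar>of_int (n \<rho>)\<bar> * norm (log_E (s / \<rho>)) \<le> \<bar>of_int (n \<rho>)\<bar> * ((r / norm \<rho>) ^ d / (1 - r / b))"
    by (rule mult_left_mono) auto
  thus ?thesis by (simp add: norm_mult weight_def power_divide mult_ac)
qed

lemma tail_uniform_limit:
  assumes "r < b"
  shows "uniform_limit (cball 0 r) (\<lambda>X s. \<Sum>\<rho>\<in>X. of_int (n \<rho>) * log_E (s / \<rho>)) (tail_log b)
           (finite_subsets_at_top (A - ball 0 b))"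
  unfolding tail_log_def[abs_def]
  by (rule Weierstrass_m_test_general[where M = "\<lambda>\<rho>. weight \<rho> * (r ^ d / (1 - r / b))"])
    (use tail_term_bound assms in
      \<open>auto intro!: summable_on_cmult_left weight_summable_subset simp del: times_divide_eq_right\<close>)

lemma tail_has_sum:
  assumes "norm s < b"
  shows "((\<lambda>\<rho>. of_int (n \<rho>) * log_E (s / \<rho>)) has_sum tail_log b s) (A - ball 0 b)"
  unfolding has_sum_def
  by (rule tendsto_uniform_limitI[OF tail_uniform_limit[OF assms]]) auto

lemma tail_norm_le:
  assumes "norm s \<le> 1" "b \<ge> 2"
  shows "norm (tail_log b s) \<le> 2 * infsum weight (A - ball 0 b)"
proof -
  have "norm (tail_log b s) \<le> infsum (\<lambda>\<rho>. weight \<rho> * 2) (A - ball 0 b)"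
  proof (rule norm_infsum_le[OF tail_has_sum])
    fix \<rho> assume "\<rho> \<in> A - ball 0 b"
    from tail_term_bound[OF this, of s 1]
    have "norm (of_int (n \<rho>) * log_E (s / \<rho>)) \<le> weight \<rho> * (1 / (1 - 1 / b))"
      using assms by simp
    also have "\<dots> \<le> weight \<rho> * 2"
      using assms by (intro mult_left_mono weight_nonneg) (simp add: field_simps)
    finally show "norm (of_int (n \<rho>) * log_E (s / \<rho>)) \<le> weight \<rho> * 2" .
  qed (use assms in \<open>auto intro!: has_sum_infsum summable_on_cmult_left weight_summable_subset\<close>)
  also have "\<dots> = infsum weight (A - ball 0 b) * 2"
    by (rule infsum_cmult_left')
  finally show ?thesis by (simp only: mult.commute)
qed

text \<open>
  Termwise differentiation, which locally uniform convergence permits.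
\<close>

lemma tail_deriv:
  assumes "norm s < b"
  obtains D where "(tail_log b has_field_derivative D) (at s)"
    "((\<lambda>\<rho>. of_int (n \<rho>) * s ^ (d - 1) / (\<rho> ^ (d - 1) * (s - \<rho>))) has_sum D) (A - ball 0 b)"
proof -
  define r where "r = (norm s + b) / 2"
  have r: "norm s < r" "r < b" using assms by (auto simp: r_def)
  define f' where "f' = (\<lambda>X w. \<Sum>\<rho>\<in>X. of_int (n \<rho>) * w ^ (d - 1) / (\<rho> ^ (d - 1) * (w - \<rho>)))"
  have der: "((\<lambda>s. \<Sum>\<rho>\<in>X. of_int (n \<rho>) * log_E (s / \<rho>)) has_field_derivative f' X w) (at w)"
    if X: "X \<subseteq> A - ball 0 b" and w: "norm w < b" for X w
    unfolding f'_def
  proof (rule DERIV_sum)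
    fix \<rho> assume "\<rho> \<in> X"
    hence "\<rho> \<in> A - ball 0 b" using X by blast
    hence \<rho>: "norm \<rho> \<ge> b" "\<rho> \<noteq> 0" using zero_notin by auto
    have "norm (w / \<rho>) < 1" using \<rho> w by (auto simp: norm_divide divide_less_eq)
    have "((\<lambda>s. s / \<rho>) has_field_derivative 1 / \<rho>) (at w)"
      using \<rho> by (auto intro!: derivative_eq_intros)
    from DERIV_chain2[where f = log_E and g = "\<lambda>s. s / \<rho>", OF log_E_deriv this] \<open>norm (w / \<rho>) < 1\<close>
    have "((\<lambda>s. of_int (n \<rho>) * log_E (s / \<rho>)) has_field_derivative
        of_int (n \<rho>) * (- ((w / \<rho>) ^ (d - 1) / (1 - w / \<rho>)) * (1 / \<rho>))) (at w)"
      by (intro DERIV_cmult) blast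
    also have "of_int (n \<rho>) * (- ((w / \<rho>) ^ (d - 1) / (1 - w / \<rho>)) * (1 / \<rho>))
       = of_int (n \<rho>) * w ^ (d - 1) / (\<rho> ^ (d - 1) * (w - \<rho>))"
    proof -
      have "w \<noteq> \<rho>" using \<rho> w by auto
      thus ?thesis using \<rho> by (simp add: power_divide divide_simps) (simp add: algebra_simps)
    qed
    finally show "((\<lambda>s. of_int (n \<rho>) * log_E (s / \<rho>)) has_field_derivative
       of_int (n \<rho>) * w ^ (d - 1) / (\<rho> ^ (d - 1) * (w - \<rho>))) (at w)" .
  qed
  have "eventually (\<lambda>X. continuous_on (cball 0 r) (\<lambda>s. \<Sum>\<rho>\<in>X. of_int (n \<rho>) * log_E (s / \<rho>)) \<and>
     (\<forall>w\<in>ball 0 r. ((\<lambda>s. \<Sum>\<rho>\<in>X. of_int (n \<rho>) * log_E (s / \<rho>)) has_field_derivative f' X w) (at w)))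
     (finite_subsets_at_top (A - ball 0 b))"
  proof (rule eventually_finite_subsets_at_top_weakI)
    fix X assume X: "finite X" "X \<subseteq> A - ball 0 b"
    thus "continuous_on (cball 0 r) (\<lambda>s. \<Sum>\<rho>\<in>X. of_int (n \<rho>) * log_E (s / \<rho>)) \<and>
     (\<forall>w\<in>ball 0 r. ((\<lambda>s. \<Sum>\<rho>\<in>X. of_int (n \<rho>) * log_E (s / \<rho>)) has_field_derivative f' X w) (at w))"
      using r by (auto intro!: der continuous_at_imp_continuous_on DERIV_isCont[OF der])
  qed
  from has_complex_derivative_uniform_limit[OF this tail_uniform_limit[OF r(2)]]
  obtain g' where g': "\<And>w. w \<in> ball 0 r \<Longrightarrow> (tail_log b has_field_derivative g' w) (at w) \<and>
      ((\<lambda>X. f' X w) \<longlongrightarrow> g' w) (finite_subsets_at_top (A - ball 0 b))"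
    using r norm_ge_zero[of s] by (metis finite_subsets_at_top_neq_bot order_le_less_trans)
  show thesis
    by (rule that[of "g' s"]) (use g'[of s] r in \<open>auto simp: has_sum_def f'_def\<close>)
qed

lemma tail_holomorphic: "tail_log b holomorphic_on ball 0 b"
proof (subst holomorphic_on_open)
  show "\<forall>s\<in>ball 0 b. \<exists>D. (tail_log b has_field_derivative D) (at s)"
  proof
    fix s :: complex assume "s \<in> ball 0 b"
    hence "norm s < b" by simp
    then obtain D where "(tail_log b has_field_derivative D) (at s)" by (rule tail_deriv)
    thus "\<exists>D. (tail_log b has_field_derivative D) (at s)" by blast
  qed
qed simp

text \<open>
  Once a finite set contains all points of the disc, its partial product is the finite product over the
  disc times the exponential of a partial sum of the tail.
\<close>

lemma canonical_product_tendsto: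
  assumes s: "norm s < b"
  shows "((\<lambda>X. \<Prod>\<rho>\<in>X. weierstrass_factor (d - 1) (s / \<rho>) powi n \<rho>) \<longlongrightarrow>
           (\<Prod>\<rho>\<in>A \<inter> ball 0 b. weierstrass_factor (d - 1) (s / \<rho>) powi n \<rho>) * exp (tail_log b s))
           (finite_subsets_at_top A)"
proof -
  define N where "N = A \<inter> ball 0 b"
  \<comment> \<open>extends the terms of the tail by 0, so that the sums run along the same net as the products\<close>
  define h where "h = (\<lambda>\<rho>. if \<rho> \<in> N then 0 else of_int (n \<rho>) * log_E (s / \<rho>))"
  define E where "E = (\<lambda>\<rho>. weierstrass_factor (d - 1) (s / \<rho>) powi n \<rho>)"
  have N: "finite N" "N \<subseteq> A" unfolding N_def by (auto intro: finite_ball)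
  have "(h has_sum tail_log b s) A \<longleftrightarrow>
     ((\<lambda>\<rho>. of_int (n \<rho>) * log_E (s / \<rho>)) has_sum tail_log b s) (A - ball 0 b)"
    by (rule has_sum_cong_neutral) (auto simp: h_def N_def)
  hence "(h has_sum tail_log b s) A" using tail_has_sum[OF s] by blast
  hence "((\<lambda>X. (\<Prod>\<rho>\<in>N. E \<rho>) * exp (\<Sum>\<rho>\<in>X. h \<rho>)) \<longlongrightarrow> (\<Prod>\<rho>\<in>N. E \<rho>) * exp (tail_log b s))
           (finite_subsets_at_top A)"
    unfolding has_sum_def by (intro tendsto_intros)
  moreover have "eventually (\<lambda>X. (\<Prod>\<rho>\<in>N. E \<rho>) * exp (\<Sum>\<rho>\<in>X. h \<rho>) = (\<Prod>\<rho>\<in>X. E \<rho>)) (finite_subsets_at_top A)"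
    unfolding eventually_finite_subsets_at_top
  proof (intro exI[of _ N] conjI N allI impI)
    fix X assume X: "finite X \<and> N \<subseteq> X \<and> X \<subseteq> A"
    have "exp (\<Sum>\<rho>\<in>X. h \<rho>) = (\<Prod>\<rho>\<in>X. exp (h \<rho>))" using X by (intro exp_sum) auto
    also have "\<dots> = (\<Prod>\<rho>\<in>X - N. E \<rho>)"
    proof (rule prod.mono_neutral_cong_right)
      fix \<rho> assume "\<rho> \<in> X - N"
      hence \<rho>: "\<rho> \<notin> N" "norm \<rho> \<ge> b" "\<rho> \<noteq> 0" using X zero_notin by (auto simp: N_def)
      hence "s / \<rho> \<noteq> 1" using s by auto
      thus "exp (h \<rho>) = E \<rho>"
        using \<rho> by (simp add: h_def E_def exp_log_E flip: exp_power_int)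
    qed (use X in \<open>auto simp: h_def\<close>)
    finally show "(\<Prod>\<rho>\<in>N. E \<rho>) * exp (\<Sum>\<rho>\<in>X. h \<rho>) = (\<Prod>\<rho>\<in>X. E \<rho>)"
      using prod.subset_diff[of N X E] X by (simp add: mult.commute)
  qed
  ultimately show ?thesis
    unfolding N_def E_def by (rule Lim_transform_eventually)
qed

text \<open>
  By \<open>canonical_product_tendsto\<close> this is the full canonical product on the disc of radius \<open>b\<close>, in a form
  that can be differentiated there.
\<close>

definition partial_canonical :: "real \<Rightarrow> complex \<Rightarrow> complex" where
  "partial_canonical b s =
     (\<Prod>\<rho>\<in>A \<inter> ball 0 b. weierstrass_factor (d - 1) (s / \<rho>) powi n \<rho>) * exp (tail_log b s)"

lemma partial_canonical_nonzero:
  assumes "s \<notin> A"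
  shows "partial_canonical b s \<noteq> 0"
proof -
  have "s / \<rho> \<noteq> 1" if "\<rho> \<in> A" for \<rho> using that assms zero_notin by auto
  thus ?thesis using finite_ball[of b] by (auto simp: partial_canonical_def)
qed

lemma weierstrass_factor_deriv:
  assumes "z \<noteq> 1"
  shows "(weierstrass_factor m has_field_derivative weierstrass_factor m z * (- (z ^ m / (1 - z)))) (at z)"
proof -
  have "((\<lambda>z. (1 - z) * exp (\<Sum>k=1..m. z ^ k / of_nat k)) has_field_derivative
     (- 1) * exp (\<Sum>k=1..m. z ^ k / of_nat k)
       + exp (\<Sum>k=1..m. z ^ k / of_nat k) * ((1 - z ^ m) / (1 - z)) * (1 - z)) (at z)"
    by (intro DERIV_mult DERIV_chain2[OF DERIV_exp] sum_powers_deriv assms)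
      (auto intro!: derivative_eq_intros)
  also have "(- 1) * exp (\<Sum>k=1..m. z ^ k / of_nat k)
       + exp (\<Sum>k=1..m. z ^ k / of_nat k) * ((1 - z ^ m) / (1 - z)) * (1 - z)
     = weierstrass_factor m z * (- (z ^ m / (1 - z)))"
  proof -
    have "- 1 * e + e * ((1 - p) / w) * w = w * e * (- (p / w))" if "w \<noteq> 0" for e p w :: complex
      using that by (simp add: right_diff_distrib)
    from this[of "1 - z"] assms show ?thesis by (simp add: weierstrass_factor_def)
  qed
  finally show ?thesis by (simp add: weierstrass_factor_def[abs_def])
qed

lemma partial_canonical_deriv:
  assumes s: "norm s < b" "s \<notin> A"
  obtains S where
    "((\<lambda>\<rho>. of_int (n \<rho>) * s ^ (d - 1) / (\<rho> ^ (d - 1) * (s - \<rho>))) has_sum S) A"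
    "(partial_canonical b has_field_derivative partial_canonical b s * S) (at s)"
proof -
  define t where "t = (\<lambda>\<rho>. of_int (n \<rho>) * s ^ (d - 1) / (\<rho> ^ (d - 1) * (s - \<rho>)))"
  define E where "E = (\<lambda>\<rho> s. weierstrass_factor (d - 1) (s / \<rho>) powi n \<rho>)"
  define N where "N = A \<inter> ball 0 b"
  obtain D where D: "(tail_log b has_field_derivative D) (at s)" "(t has_sum D) (A - ball 0 b)"
    using tail_deriv[OF s(1)] unfolding t_def by blast
  have sum: "(t has_sum (\<Sum>\<rho>\<in>N. t \<rho>) + D) A"
  proof -
    have "(t has_sum (\<Sum>\<rho>\<in>N. t \<rho>) + D) (N \<union> (A - ball 0 b))"
      using finite_ball by (intro has_sum_Un_disjoint has_sum_finite D) (auto simp: N_def)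
    also have "N \<union> (A - ball 0 b) = A" by (auto simp: N_def)
    finally show ?thesis .
  qed
  have ne: "\<rho> \<noteq> 0" "s / \<rho> \<noteq> 1" "s \<noteq> \<rho>" if "\<rho> \<in> N" for \<rho>
    using that s zero_notin by (auto simp: N_def)
  have E_deriv: "(E \<rho> has_field_derivative E \<rho> s * t \<rho>) (at s)" if "\<rho> \<in> N" for \<rho>
  proof -
    note nz = ne[OF that]
    have lin: "((\<lambda>s. s / \<rho>) has_field_derivative 1 / \<rho>) (at s)"
      using nz by (auto intro!: derivative_eq_intros)
    have "(E \<rho> has_field_derivative
        of_int (n \<rho>) * weierstrass_factor (d - 1) (s / \<rho>) powi (n \<rho> - 1) *
        (weierstrass_factor (d - 1) (s / \<rho>) * (- ((s / \<rho>) ^ (d - 1) / (1 - s / \<rho>))) * (1 / \<rho>))) (at s)"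
      unfolding E_def
      using nz by (intro DERIV_power_int DERIV_chain2[OF weierstrass_factor_deriv lin]) auto
    also have "of_int (n \<rho>) * weierstrass_factor (d - 1) (s / \<rho>) powi (n \<rho> - 1) *
        (weierstrass_factor (d - 1) (s / \<rho>) * (- ((s / \<rho>) ^ (d - 1) / (1 - s / \<rho>))) * (1 / \<rho>))
      = (weierstrass_factor (d - 1) (s / \<rho>) powi (n \<rho> - 1) * weierstrass_factor (d - 1) (s / \<rho>)) *
        (of_int (n \<rho>) * (- ((s / \<rho>) ^ (d - 1) / (1 - s / \<rho>)) * (1 / \<rho>)))"
      by (simp only: mult_ac)
    also have "weierstrass_factor (d - 1) (s / \<rho>) powi (n \<rho> - 1) * weierstrass_factor (d - 1) (s / \<rho>) = E \<rho> s"
      using nz by (simp add: E_def power_int_minus_mult)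
    also have "of_int (n \<rho>) * (- ((s / \<rho>) ^ (d - 1) / (1 - s / \<rho>)) * (1 / \<rho>)) = t \<rho>"
      using nz by (simp add: t_def power_divide divide_simps) (simp add: algebra_simps)
    finally show ?thesis .
  qed
  have E_nz: "E \<rho> s \<noteq> 0" if "\<rho> \<in> N" for \<rho> using ne[OF that] by (simp add: E_def)
  have "((\<lambda>s. \<Prod>\<rho>\<in>N. E \<rho> s) has_field_derivative
      (\<Prod>\<rho>\<in>N. E \<rho> s) * (\<Sum>\<rho>\<in>N. E \<rho> s * t \<rho> / E \<rho> s)) (at s)"
    by (rule has_field_derivative_prod') (use E_nz E_deriv in auto)
  also have "(\<Sum>\<rho>\<in>N. E \<rho> s * t \<rho> / E \<rho> s) = (\<Sum>\<rho>\<in>N. t \<rho>)"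
    using E_nz by (intro sum.cong) auto
  finally have "((\<lambda>s. (\<Prod>\<rho>\<in>N. E \<rho> s) * exp (tail_log b s)) has_field_derivative
      (\<Prod>\<rho>\<in>N. E \<rho> s) * (\<Sum>\<rho>\<in>N. t \<rho>) * exp (tail_log b s) + exp (tail_log b s) * D * (\<Prod>\<rho>\<in>N. E \<rho> s)) (at s)"
    by (intro DERIV_mult DERIV_chain2[OF DERIV_exp] D)
  moreover have "(\<Prod>\<rho>\<in>N. E \<rho> s) * (\<Sum>\<rho>\<in>N. t \<rho>) * exp (tail_log b s) + exp (tail_log b s) * D * (\<Prod>\<rho>\<in>N. E \<rho> s)
     = partial_canonical b s * ((\<Sum>\<rho>\<in>N. t \<rho>) + D)"
    by (simp add: partial_canonical_def N_def E_def algebra_simps)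
  ultimately have "(partial_canonical b has_field_derivative partial_canonical b s * ((\<Sum>\<rho>\<in>N. t \<rho>) + D)) (at s)"
    by (simp add: partial_canonical_def[abs_def] N_def E_def)
  with sum that show thesis by (simp add: t_def)
qed

lemma tail_weight_small:
  assumes "\<epsilon> > 0"
  obtains b0 where "\<And>b. b \<ge> b0 \<Longrightarrow> infsum weight (A - ball 0 b) < \<epsilon>"
proof -
  have "(weight has_sum infsum weight A) A"
    using weight_summable_subset[of A] by simp
  hence "eventually (\<lambda>X. dist (sum weight X) (infsum weight A) < \<epsilon>) (finite_subsets_at_top A)"
    using assms unfolding has_sum_def by (rule tendstoD)
  then obtain X where X: "finite X" "X \<subseteq> A" "dist (sum weight X) (infsum weight A) < \<epsilon>"
    unfolding eventually_finite_subsets_at_top by (metis order_refl)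
  define b0 where "b0 = Max (insert 0 (norm ` X)) + 1"
  show thesis
  proof (rule that[of b0])
    fix b assume b: "b \<ge> b0"
    have "norm \<rho> < b" if "\<rho> \<in> X" for \<rho>
    proof -
      have "norm \<rho> \<le> Max (insert 0 (norm ` X))" using X that by (intro Max_ge) auto
      thus ?thesis using b by (simp add: b0_def)
    qed
    hence "A - ball 0 b \<subseteq> A - X" by auto
    hence "infsum weight (A - ball 0 b) \<le> infsum weight (A - X)"
      by (intro infsum_mono_neutral weight_summable_subset) (auto simp: weight_nonneg)
    also have "infsum weight (A - X) = infsum weight A - sum weight X"
      using X by (subst infsum_Diff) (auto intro: weight_summable_subset)
    also have "\<dots> < \<epsilon>" using X(3) by (simp add: dist_real_def)
    finally show "infsum weight (A - ball 0 b) < \<epsilon>" .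
  qed
qed

end

section \<open>The Hadamard factorization\<close>

lemma higher_pderiv_eq_0: "degree p < k \<Longrightarrow> (pderiv ^^ k) p = 0" for p :: "complex poly"
proof (induction k arbitrary: p)
  case (Suc k)
  have zero: "(pderiv ^^ m) 0 = (0 :: complex poly)" for m by (induction m) auto
  show ?case
  proof (cases "degree p = 0")
    case True
    hence "pderiv p = 0" by (simp add: pderiv_eq_0_iff)
    thus ?thesis using zero by (simp add: funpow_Suc_right del: funpow.simps)
  next
    case False
    thus ?thesis using Suc by (simp add: funpow_Suc_right degree_pderiv del: funpow.simps)
  qed
qed auto

lemma higher_deriv_poly: "(deriv ^^ k) (poly p) = poly ((pderiv ^^ k) p)" for p :: "complex poly"
proof (induction k)
  case (Suc k)
  have "deriv (poly q) = poly (pderiv q)" for q :: "complex poly"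
    by (intro ext DERIV_imp_deriv poly_DERIV)
  thus ?case by (simp add: Suc.IH)
qed auto

lemma exp_eq_1_imp_constant:
  assumes X: "X holomorphic_on ball 0 r" and r: "r > 0"
    and S: "\<And>s. s \<in> ball 0 r - S \<Longrightarrow> exp (X s) = 1"
    and ev: "\<And>w. eventually (\<lambda>s. s \<notin> S) (at w)"
  obtains c where "exp c = 1" "\<And>s. s \<in> ball 0 r \<Longrightarrow> X s = c"
proof -
  have exp1: "exp (X w) = 1" if w: "w \<in> ball 0 r" for w
  proof -
    have "isCont X w"
      using X w by (intro continuous_on_interior[OF holomorphic_on_imp_continuous_on]) auto
    hence "((\<lambda>s. exp (X s)) \<longlongrightarrow> exp (X w)) (at w)"
      by (intro tendsto_intros) (simp add: isCont_def)
    moreover have "eventually (\<lambda>s. s \<in> ball 0 r) (at w)"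
      using w by (intro eventually_at_in_open') auto
    hence "eventually (\<lambda>s. exp (X s) = 1) (at w)"
      using ev[of w] by eventually_elim (use S in auto)
    hence "((\<lambda>s. exp (X s)) \<longlongrightarrow> 1) (at w)"
      by (rule tendsto_eventually)
    ultimately show ?thesis using tendsto_unique[OF at_neq_bot] by blast
  qed
  have "\<exists>c. \<forall>s\<in>ball 0 r. X s = c"
  proof (rule has_field_derivative_zero_constant)
    fix w assume w: "w \<in> ball (0::complex) r"
    have der: "(X has_field_derivative deriv X w) (at w)"
      using X w by (intro holomorphic_derivI) auto
    have "((\<lambda>s. exp (X s)) has_field_derivative exp (X w) * deriv X w) (at w)"
      by (rule DERIV_chain2[OF DERIV_exp der])
    moreover have "((\<lambda>s. exp (X s)) has_field_derivative 0) (at w)"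
      by (rule has_field_derivative_transform_within_open[of "\<lambda>_. 1" _ _ "ball 0 r"])
        (use w exp1 in auto)
    ultimately have "exp (X w) * deriv X w = 0" by (rule DERIV_unique)
    hence "deriv X w = 0" by simp
    thus "(X has_field_derivative 0) (at w within ball 0 r)"
      using der by (metis has_field_derivative_at_within)
  qed auto
  then obtain c where c: "\<And>s. s \<in> ball 0 r \<Longrightarrow> X s = c" by blast
  with exp1[of 0] r have "exp c = 1" by simp
  with c that show thesis by blast
qed

lemma geometric_half_sum_le: "(\<Sum>j<J. (1 / 2) ^ j) \<le> (2 :: real)"
proof -
  have "(\<Sum>j<J. (1 / 2) ^ j) = 2 - 2 * (1 / 2 :: real) ^ J"
    by (induction J) auto
  thus ?thesis by simp
qed

context nonzero_meromorphic
begin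

text \<open>
  Dyadic summation: the shell \<open>R1 * 2 ^ j \<le> \<bar>\<rho>\<bar> < R1 * 2 ^ (j + 1)\<close> has mass of order \<open>2 ^ (j * M)\<close>, and each point in it
  costs \<open>2 ^ (- j * (M + 1))\<close>.
\<close>

lemma divisor_shell_sum:
  assumes "\<And>R. R \<ge> R1 \<Longrightarrow> divisor_mass R \<le> C * R ^ M" "R1 \<ge> 1" "C \<ge> 0"
    and X: "finite X" "X \<subseteq> divisor_set f - ball 0 R1"
  shows "(\<Sum>\<rho>\<in>X. of_int \<bar>zorder f \<rho>\<bar> / norm \<rho> ^ Suc M) \<le> C * 2 ^ Suc M"
proof -
  define g where "g = (\<lambda>\<rho>::complex. LEAST j. norm \<rho> < R1 * 2 ^ Suc j)"
  have g: "norm \<rho> < R1 * 2 ^ Suc (g \<rho>)" "R1 * 2 ^ g \<rho> \<le> norm \<rho>" if "\<rho> \<in> X" for \<rho>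
  proof -
    obtain j where "norm \<rho> / R1 < 2 ^ j" using real_arch_pow[of 2] by auto
    also have "(2::real) ^ j \<le> 2 ^ Suc j" by simp
    finally have "norm \<rho> < R1 * 2 ^ Suc j" using assms(2) by (simp add: field_simps)
    thus "norm \<rho> < R1 * 2 ^ Suc (g \<rho>)" unfolding g_def by (rule LeastI)
    show "R1 * 2 ^ g \<rho> \<le> norm \<rho>"
    proof (cases "g \<rho>")
      case 0
      thus ?thesis using X that by auto
    next
      case (Suc h)
      hence "h < g \<rho>" by simp
      from not_less_Least[OF this[unfolded g_def]] Suc show ?thesis by simp
    qed
  qed
  define J where "J = Suc (Max (g ` X))"
  have gJ: "g ` X \<subseteq> {..<J}"
    using X unfolding J_def by (auto simp: less_Suc_eq_le)
  have "(\<Sum>\<rho>\<in>X. of_int \<bar>zorder f \<rho>\<bar> / norm \<rho> ^ Suc M)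
    = (\<Sum>j<J. \<Sum>\<rho>\<in>{\<rho>\<in>X. g \<rho> = j}. of_int \<bar>zorder f \<rho>\<bar> / norm \<rho> ^ Suc M)"
    using X gJ by (intro sum.group[symmetric]) auto
  also have "\<dots> \<le> (\<Sum>j<J. C * 2 ^ M * (1 / 2) ^ j)"
  proof (rule sum_mono)
    fix j
    have "(\<Sum>\<rho>\<in>{\<rho>\<in>X. g \<rho> = j}. of_int \<bar>zorder f \<rho>\<bar> / norm \<rho> ^ Suc M)
      \<le> (\<Sum>\<rho>\<in>{\<rho>\<in>X. g \<rho> = j}. of_int \<bar>zorder f \<rho>\<bar> / (R1 * 2 ^ j) ^ Suc M)"
    proof (intro sum_mono)
      fix \<rho> assume "\<rho> \<in> {\<rho>\<in>X. g \<rho> = j}"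
      hence le: "R1 * 2 ^ j \<le> norm \<rho>" using g(2)[of \<rho>] by auto
      have pos: "0 < R1 * 2 ^ j" using assms(2) by simp
      have "(R1 * 2 ^ j) ^ Suc M \<le> norm \<rho> ^ Suc M" using le pos by (intro power_mono) auto
      thus "of_int \<bar>zorder f \<rho>\<bar> / norm \<rho> ^ Suc M \<le> of_int \<bar>zorder f \<rho>\<bar> / (R1 * 2 ^ j) ^ Suc M"
        using zero_less_power[OF pos, of "Suc M"] by (intro frac_le) auto
    qed
    also have "\<dots> = (\<Sum>\<rho>\<in>{\<rho>\<in>X. g \<rho> = j}. of_int \<bar>zorder f \<rho>\<bar>) / (R1 * 2 ^ j) ^ Suc M"
      by (simp add: sum_divide_distrib)
    also have "\<dots> \<le> divisor_mass (R1 * 2 ^ Suc j) / (R1 * 2 ^ j) ^ Suc M"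
      unfolding divisor_mass_def using g X assms(2)
      by (intro divide_right_mono sum_mono2 finite_divisor_ball) auto
    also have "\<dots> \<le> C * (R1 * 2 ^ Suc j) ^ M / (R1 * 2 ^ j) ^ Suc M"
    proof (intro divide_right_mono assms(1))
      show "R1 \<le> R1 * 2 ^ Suc j" using assms(2) one_le_power[of "2::real" "Suc j"] by (simp add: mult_le_cancel_left1)
    qed (use assms in auto)
    also have "\<dots> = C * 2 ^ M * (1 / 2) ^ j / R1"
      using assms(2) by (simp add: power_mult_distrib field_simps flip: power_mult)
    also have "\<dots> \<le> C * 2 ^ M * (1 / 2) ^ j"
      using assms(2,3) mult_left_mono[of 1 R1 "C * 2 ^ M * (1 / 2) ^ j"] by (simp add: divide_le_eq)
    finally show "(\<Sum>\<rho>\<in>{\<rho>\<in>X. g \<rho> = j}. of_int \<bar>zorder f \<rho>\<bar> / norm \<rho> ^ Suc M) \<le> C * 2 ^ M * (1 / 2) ^ j" .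
  qed
  also have "\<dots> = C * 2 ^ M * (\<Sum>j<J. (1 / 2) ^ j)" by (simp add: sum_distrib_left)
  also have "\<dots> \<le> C * 2 ^ M * 2"
    using geometric_half_sum_le assms(3) by (intro mult_left_mono) auto
  finally show ?thesis by simp
qed

text \<open>
  Some exponent works, so the least one does.
\<close>

lemma convergence_exponent_summable:
  assumes "meromorphic_order f < \<infinity>"
  shows "(\<lambda>\<rho>. of_int \<bar>zorder f \<rho>\<bar> / norm \<rho> ^ convergence_exponent f :: real) summable_on (divisor_set f - {0})"
proof -
  obtain M C R1 where *: "C \<ge> 0" "R1 \<ge> 1" "\<And>R. R \<ge> R1 \<Longrightarrow> divisor_mass R \<le> C * R ^ M"
    by (rule finite_order_bounds[OF assms]) blast
  let ?h = "\<lambda>\<rho>. of_int \<bar>zorder f \<rho>\<bar> / norm \<rho> ^ Suc M :: real"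
  have "?h summable_on (divisor_set f - ball 0 R1)"
  proof (rule nonneg_bdd_above_summable_on)
    show "bdd_above (sum ?h ` {F. F \<subseteq> divisor_set f - ball 0 R1 \<and> finite F})"
      using divisor_shell_sum[OF *(3,2,1)] by (intro bdd_aboveI2[where M = "C * 2 ^ Suc M"]) auto
  qed auto
  moreover have "?h summable_on (divisor_set f \<inter> ball 0 R1 - {0})"
    by (intro summable_on_finite finite_Diff finite_divisor_ball)
  ultimately have "?h summable_on ((divisor_set f - ball 0 R1) \<union> (divisor_set f \<inter> ball 0 R1 - {0}))"
    by (rule summable_on_union)
  also have "(divisor_set f - ball 0 R1) \<union> (divisor_set f \<inter> ball 0 R1 - {0}) = divisor_set f - {0}"
    using *(2) by auto
  finally show ?thesis
    unfolding convergence_exponent_def by (rule LeastI)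
qed

lemma weighted_divisor:
  assumes "meromorphic_order f < \<infinity>" "convergence_exponent f \<ge> 1"
  shows "weighted_points (divisor_set f - {0}) (zorder f) (convergence_exponent f)"
proof
  show "finite ((divisor_set f - {0}) \<inter> ball 0 r)" for r
    by (rule finite_subset[OF _ finite_divisor_ball[of r]]) auto
qed (use assms convergence_exponent_summable in auto)

text \<open>
  Each linear factor \<open>s - \<rho>\<close> is \<open>- \<rho>\<close> times \<open>E\<^bsub>d-1\<^esub> (s / \<rho>)\<close> times the exponential of a polynomial of degree at
  most \<open>d - 1\<close>. Hence \<open>L\<close>, up to such a polynomial, a constant and the tail, is a logarithm of \<open>f\<close> divided
  by its canonical product.
\<close>

lemma log_factor_canonical:
  assumes "weighted_points (divisor_set f - {0}) (zorder f) d" "log_factor b L" "b > 0"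
  obtains P c where "degree P \<le> d - 1"
    "\<And>s. s \<in> ball 0 b - divisor_set f \<Longrightarrow>
       f s = s powi zorder f 0 *
         exp (L s - poly P s - weighted_points.tail_log (divisor_set f - {0}) (zorder f) d b s + c) *
         weighted_points.partial_canonical (divisor_set f - {0}) (zorder f) d b s"
proof -
  interpret W: weighted_points "divisor_set f - {0}" "zorder f" d by fact
  define A where "A = divisor_set f - {0}"
  define N where "N = A \<inter> ball 0 b"
  have fin: "finite N" unfolding N_def A_def by (rule W.finite_ball)
  define P where "P = (\<Sum>\<rho>\<in>N. smult (of_int (zorder f \<rho>)) (\<Sum>k=1..d-1. monom (1 / (of_nat k * \<rho> ^ k)) k))"
  define C where "C = (\<Prod>\<rho>\<in>N. (- \<rho>) powi zorder f \<rho>)"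
  have N0: "\<rho> \<noteq> 0" if "\<rho> \<in> N" for \<rho> using that by (auto simp: N_def A_def)
  have C0: "C \<noteq> 0" using fin N0 by (auto simp: C_def)
  have deg: "degree P \<le> d - 1"
    unfolding P_def
    by (intro degree_sum_le fin degree_smult_le[THEN order_trans] finite_atLeastAtMost
        degree_monom_le[THEN order_trans]) auto
  have poly_P: "poly P s = (\<Sum>\<rho>\<in>N. of_int (zorder f \<rho>) * (\<Sum>k=1..d-1. (s / \<rho>) ^ k / of_nat k))" for s
    by (simp add: P_def poly_sum poly_monom power_divide mult.commute)
  have lin: "s - \<rho> = (- \<rho>) * (weierstrass_factor (d - 1) (s / \<rho>) * exp (- (\<Sum>k=1..d-1. (s / \<rho>) ^ k / of_nat k)))"
    if "\<rho> \<in> N" for s \<rho>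
    using N0[OF that] by (simp add: weierstrass_factor_def exp_minus field_simps)
  show thesis
  proof (rule that[OF deg, of "Ln C"])
    fix s assume s: "s \<in> ball 0 b - divisor_set f"
    define Z where "Z = W.tail_log b s"
    have "f s = exp (L s) * (\<Prod>\<rho>\<in>divisor_set f \<inter> ball 0 b. (s - \<rho>) powi zorder f \<rho>)"
      using assms(2) s by (auto simp: log_factor_def)
    also have "(\<Prod>\<rho>\<in>divisor_set f \<inter> ball 0 b. (s - \<rho>) powi zorder f \<rho>)
       = s powi zorder f 0 * (\<Prod>\<rho>\<in>N. (s - \<rho>) powi zorder f \<rho>)"
    proof (cases "0 \<in> divisor_set f")
      case True
      hence "divisor_set f \<inter> ball 0 b = insert 0 N" "0 \<notin> N" using assms(3) by (auto simp: N_def A_def)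
      thus ?thesis using fin by simp
    next
      case False
      hence "divisor_set f \<inter> ball 0 b = N" by (auto simp: N_def A_def)
      thus ?thesis using zorder_off_divisor[OF False] by simp
    qed
    also have "(\<Prod>\<rho>\<in>N. (s - \<rho>) powi zorder f \<rho>)
      = (\<Prod>\<rho>\<in>N. (- \<rho>) powi zorder f \<rho> * (weierstrass_factor (d - 1) (s / \<rho>) powi zorder f \<rho> *
          exp (- (of_int (zorder f \<rho>) * (\<Sum>k=1..d-1. (s / \<rho>) ^ k / of_nat k)))))"
      by (intro prod.cong refl) (subst lin, simp_all only: power_int_mult_distrib exp_power_int mult_minus_right)
    also have "\<dots> = C * ((\<Prod>\<rho>\<in>N. weierstrass_factor (d - 1) (s / \<rho>) powi zorder f \<rho>) * exp (- poly P s))"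
      unfolding poly_P sum_negf[symmetric] by (simp only: prod.distrib C_def exp_sum[OF fin])
    finally have "f s = s powi zorder f 0 * (exp (L s) * exp (- poly P s) * C * exp (- Z)) *
       ((\<Prod>\<rho>\<in>N. weierstrass_factor (d - 1) (s / \<rho>) powi zorder f \<rho>) * exp Z)"
      by (simp add: exp_minus field_simps)
    also have "exp (L s) * exp (- poly P s) * C * exp (- Z) = exp (L s - poly P s - Z + Ln C)"
      using C0 by (simp add: exp_add exp_diff exp_minus field_simps)
    also have "(\<Prod>\<rho>\<in>N. weierstrass_factor (d - 1) (s / \<rho>) powi zorder f \<rho>) * exp Z = W.partial_canonical b s"
      by (simp add: W.partial_canonical_def N_def A_def Z_def)
    finally show "f s = s powi zorder f 0 * exp (L s - poly P s - W.tail_log b s + Ln C) * W.partial_canonical b s"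
      by (simp add: Z_def)
  qed
qed

text \<open>
  On every disc \<open>f\<close> is \<open>exp H\<close> times its canonical product. On a smaller disc the logarithms \<open>H\<close> of two
  discs differ by a constant, so their derivatives at \<open>0\<close> agree. From the index \<open>m\<close> on they are bounded by
  quantities that tend to \<open>0\<close> with growing radius, hence they vanish: all \<open>H\<close> are the same polynomial, up
  to multiples of \<open>2 \<pi> i\<close>.
\<close>

theorem hadamard_factorization_exists:
  assumes order: "meromorphic_order f < \<infinity>" and d: "convergence_exponent f \<ge> 1"
  obtains Q where "hadamard_factorization f Q"
proof -
  define d where "d = convergence_exponent f"
  define A where "A = divisor_set f - {0}"
  have W: "weighted_points A (zorder f) d"
    unfolding A_def d_def by (rule weighted_divisor[OF order d])
  interpret W: weighted_points A "zorder f" d by (rule W)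
  obtain M C R1 where bounds: "C \<ge> 0" "R1 \<ge> 1"
    "\<And>a b L k. divisor_free_annulus a b \<Longrightarrow> a \<ge> R1 \<Longrightarrow> log_factor b L \<Longrightarrow> k > 0 \<Longrightarrow>
        norm ((deriv ^^ k) L 0 / fact k) * a ^ k \<le> C * 2 ^ k * a ^ M"
    by (rule finite_order_bounds[OF order]) blast
  define m where "m = max (Suc M) d"
  \<comment> \<open>exp H represents f, divided by its canonical product, on the disc of radius b\<close>
  define rep where "rep = (\<lambda>b H. H holomorphic_on ball 0 b \<and> (\<forall>s\<in>ball 0 b - divisor_set f.
      f s = s powi zorder f 0 * exp (H s) * W.partial_canonical b s))"
  have good: "\<exists>b H. x \<le> b \<and> rep b H \<and>
      (\<forall>k\<ge>m. norm ((deriv ^^ k) H 0 / fact k) \<le> C * 2 ^ k / x + 2 * infsum W.weight (A - ball 0 b))"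
    if x: "x \<ge> R1" "x \<ge> 2" for x
  proof -
    obtain a b where ab: "x < a" "b < x + 1" "divisor_free_annulus a b"
      by (rule divisor_free_annulus_exists[of x]) (use x in auto)
    have a_b: "a < b" "b \<ge> 2" using ab x by (auto simp: divisor_free_annulus_def)
    obtain L where L: "log_factor b L" by (rule log_factor_exists)
    have L_holo: "L holomorphic_on ball 0 b" using L by (simp add: log_factor_def)
    obtain P c where Pc: "degree P \<le> d - 1"
      "\<And>s. s \<in> ball 0 b - divisor_set f \<Longrightarrow>
         f s = s powi zorder f 0 * exp (L s - poly P s - W.tail_log b s + c) * W.partial_canonical b s"
      by (rule log_factor_canonical[OF W[unfolded A_def] L]) (use a_b in \<open>auto simp: A_def\<close>)
    define H where "H = (\<lambda>s. L s - (poly P s + W.tail_log b s - c))"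
    have "rep b H"
      unfolding rep_def H_def using Pc(2) W.tail_holomorphic[of b] L_holo
      by (auto intro!: holomorphic_intros simp: algebra_simps)
    moreover have "norm ((deriv ^^ k) H 0 / fact k) \<le> C * 2 ^ k / x + 2 * infsum W.weight (A - ball 0 b)"
      if k: "k \<ge> m" for k
    proof -
      have k': "k > 0" "k > M" "k > degree P" using k Pc(1) d by (auto simp: m_def d_def)
      have S: "open (ball 0 b)" "(0::complex) \<in> ball 0 b" using a_b by auto
      have holo: "poly P holomorphic_on ball 0 b" "W.tail_log b holomorphic_on ball 0 b"
        by (auto intro!: W.tail_holomorphic holomorphic_intros)
      have holo2: "(\<lambda>s. poly P s + W.tail_log b s) holomorphic_on ball 0 b"
        by (intro holomorphic_on_add holo)
      have holo3: "(\<lambda>s. poly P s + W.tail_log b s - c) holomorphic_on ball 0 b"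
        by (intro holomorphic_on_diff holo2 holomorphic_on_const)
      have "(deriv ^^ k) H 0 = (deriv ^^ k) L 0 - (deriv ^^ k) (\<lambda>s. poly P s + W.tail_log b s - c) 0"
        unfolding H_def by (rule higher_deriv_diff[OF L_holo holo3 S])
      also have "(deriv ^^ k) (\<lambda>s. poly P s + W.tail_log b s - c) 0
         = (deriv ^^ k) (\<lambda>s. poly P s + W.tail_log b s) 0 - (deriv ^^ k) (\<lambda>_. c) 0"
        by (rule higher_deriv_diff[OF holo2 holomorphic_on_const S])
      also have "(deriv ^^ k) (\<lambda>s. poly P s + W.tail_log b s) 0
         = (deriv ^^ k) (poly P) 0 + (deriv ^^ k) (W.tail_log b) 0"
        by (rule higher_deriv_add[OF holo S])
      also have "(deriv ^^ k) (poly P) 0 = 0"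
        using k' by (simp add: higher_deriv_poly higher_pderiv_eq_0)
      finally have "(deriv ^^ k) H 0 = (deriv ^^ k) L 0 - (deriv ^^ k) (W.tail_log b) 0"
        using k' by simp
      hence "norm ((deriv ^^ k) H 0 / fact k)
          \<le> norm ((deriv ^^ k) L 0 / fact k) + norm ((deriv ^^ k) (W.tail_log b) 0 / fact k)"
        by (simp only: diff_divide_distrib norm_triangle_ineq4)
      also have "norm ((deriv ^^ k) L 0 / fact k) \<le> C * 2 ^ k / x"
      proof -
        have a: "a \<ge> R1" "a > 0" "a \<ge> 1" "x > 0" using ab x by auto
        have "norm ((deriv ^^ k) L 0 / fact k) \<le> C * 2 ^ k * a ^ M / a ^ k"
          using bounds(3)[OF ab(3) a(1) L k'(1)] a by (simp add: pos_le_divide_eq)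
        also have "a ^ M / a ^ k \<le> 1 / x"
        proof -
          have "x * a ^ M \<le> a ^ Suc M" using a ab by simp
          also have "\<dots> \<le> a ^ k" using a k' by (intro power_increasing) auto
          finally show ?thesis using a by (simp add: field_simps)
        qed
        from mult_left_mono[OF this, of "C * 2 ^ k"]
        have "C * 2 ^ k * a ^ M / a ^ k \<le> C * 2 ^ k / x" using bounds(1) by simp
        finally show ?thesis by simp
      qed
      also have "norm ((deriv ^^ k) (W.tail_log b) 0 / fact k) \<le> 2 * infsum W.weight (A - ball 0 b)"
      proof -
        have "norm ((deriv ^^ k) (W.tail_log b) 0) \<le> fact k * (2 * infsum W.weight (A - ball 0 b)) / 1 ^ k"
          using a_b W.tail_norm_le[of _ b]
          by (intro Cauchy_inequality holomorphic_on_imp_continuous_on holomorphic_on_subset[OF W.tail_holomorphic[of b]])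
             auto
        thus ?thesis by (simp add: norm_divide field_simps)
      qed
      finally show ?thesis by simp
    qed
    ultimately show ?thesis using ab a_b by (intro exI[of _ b] exI[of _ H]) auto
  qed
  have same: "\<exists>c. exp c = 1 \<and> (\<forall>s\<in>ball 0 b. H s - H' s = c)"
    if "rep b H" "rep b' H'" "0 < b" "b \<le> b'" for b b' H H'
  proof -
    have holo: "(\<lambda>s. H s - H' s) holomorphic_on ball 0 b"
      using that unfolding rep_def by (intro holomorphic_intros) (auto intro: holomorphic_on_subset)
    have exp1: "exp (H s - H' s) = 1" if s: "s \<in> ball 0 b - divisor_set f" for s
    proof -
      have s': "s \<in> ball 0 b' - divisor_set f" using s \<open>b \<le> b'\<close> by auto
      have eq: "W.partial_canonical b s = W.partial_canonical b' s"
        unfolding W.partial_canonical_def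
        by (rule tendsto_unique[OF finite_subsets_at_top_neq_bot W.canonical_product_tendsto W.canonical_product_tendsto])
          (use s s' in auto)
      have "W.partial_canonical b' s \<noteq> 0" using s by (intro W.partial_canonical_nonzero) (simp add: A_def)
      moreover have "f s = s powi zorder f 0 * exp (H s) * W.partial_canonical b' s"
        "f s = s powi zorder f 0 * exp (H' s) * W.partial_canonical b' s"
        using \<open>rep b H\<close> \<open>rep b' H'\<close> s s' eq unfolding rep_def by metis+
      moreover have "f s \<noteq> 0" using s by (simp add: divisor_set_eq)
      ultimately have "exp (H s) = exp (H' s)" by auto
      thus ?thesis by (simp add: exp_diff)
    qed
    have ev: "eventually (\<lambda>s. s \<notin> divisor_set f) (at w)" for w
      using eventually_nonzero[of w] by (simp add: divisor_set_eq)
    show ?thesis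
      by (rule exp_eq_1_imp_constant[OF holo \<open>0 < b\<close>, of "divisor_set f"]) (use exp1 ev in blast)+
  qed
  define x0 where "x0 = max 2 R1"
  obtain b0 H0 where H0: "x0 \<le> b0" "rep b0 H0"
    using good[of x0] by (auto simp: x0_def)
  have b0: "b0 > 0" using H0(1) by (simp add: x0_def)
  have same_deriv: "(deriv ^^ k) H 0 = (deriv ^^ k) H0 0" if "rep b H" "b \<ge> b0" "k > 0" for b H k
  proof -
    obtain c where c: "\<And>s. s \<in> ball 0 b0 \<Longrightarrow> H0 s - H s = c"
      using same[OF H0(2) \<open>rep b H\<close> b0 \<open>b \<ge> b0\<close>] by blast
    have S: "open (ball 0 b0)" "(0::complex) \<in> ball 0 b0" using b0 by auto
    have holo: "H0 holomorphic_on ball 0 b0" "H holomorphic_on ball 0 b0"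
      using H0 that unfolding rep_def by (auto intro: holomorphic_on_subset)
    have "(deriv ^^ k) H0 0 - (deriv ^^ k) H 0 = (deriv ^^ k) (\<lambda>s. H0 s - H s) 0"
      using S holo by (intro higher_deriv_diff[symmetric, where S = "ball 0 b0"]) auto
    also have "\<dots> = (deriv ^^ k) (\<lambda>s. c) 0"
      by (rule higher_deriv_cong_ev) (use c S eventually_nhds_in_open[OF S] in \<open>auto elim: eventually_mono\<close>)
    also have "\<dots> = 0" using that by simp
    finally show ?thesis by simp
  qed
  have vanish: "(deriv ^^ k) H0 0 = 0" if k: "k \<ge> m" for k
  proof -
    have kpos: "k > 0" using k by (auto simp: m_def)
    have small: "norm ((deriv ^^ k) H0 0 / fact k) \<le> \<epsilon>" if \<epsilon>: "\<epsilon> > 0" for \<epsilon>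
    proof -
      obtain b1 where b1: "\<And>b. b \<ge> b1 \<Longrightarrow> infsum W.weight (A - ball 0 b) < \<epsilon> / 4"
        by (rule W.tail_weight_small[of "\<epsilon> / 4"]) (use \<epsilon> in auto)
      define x where "x = Max {x0, b1, b0, 2 * C * 2 ^ k / \<epsilon>}"
      have x: "x \<ge> x0" "x \<ge> b1" "x \<ge> b0" "x \<ge> 2 * C * 2 ^ k / \<epsilon>" by (auto simp: x_def)
      obtain b H where bH: "x \<le> b" "rep b H"
        "norm ((deriv ^^ k) H 0 / fact k) \<le> C * 2 ^ k / x + 2 * infsum W.weight (A - ball 0 b)"
        using good[of x] x k by (auto simp: x0_def)
      have "C * 2 ^ k / x \<le> \<epsilon> / 2"
        using x \<epsilon> by (simp add: x0_def field_simps)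
      moreover have "infsum W.weight (A - ball 0 b) < \<epsilon> / 4" using b1 bH x by simp
      ultimately have "norm ((deriv ^^ k) H 0 / fact k) \<le> \<epsilon>" using bH(3) by linarith
      thus ?thesis using same_deriv[OF bH(2) _ kpos] bH x by simp
    qed
    show ?thesis
    proof (rule ccontr)
      assume "(deriv ^^ k) H0 0 \<noteq> 0"
      hence "norm ((deriv ^^ k) H0 0 / fact k) / 2 > 0" by simp
      with small[OF this] show False by linarith
    qed
  qed
  define Q where "Q = (\<Sum>k<m. monom ((deriv ^^ k) H0 0 / fact k) k)"
  have poly_Q: "poly Q s = (\<Sum>k<m. (deriv ^^ k) H0 0 / fact k * s ^ k)" for s
    by (simp add: Q_def poly_sum poly_monom)
  have m_pos: "m > 0" by (simp add: m_def)
  have exp_Q: "exp (H s) = exp (poly Q s)" if H: "rep b H" "b \<ge> b0" and s: "s \<in> ball 0 b" for b H s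
  proof -
    have "(\<lambda>k. (deriv ^^ k) H 0 / fact k * (s - 0) ^ k) sums H s"
      using H s unfolding rep_def by (intro holomorphic_power_series[of H 0 b]) auto
    moreover have "(\<lambda>k. (deriv ^^ k) H 0 / fact k * (s - 0) ^ k) sums
        (\<Sum>k<m. (deriv ^^ k) H 0 / fact k * (s - 0) ^ k)"
      using same_deriv[OF H] vanish m_pos by (intro sums_finite) (auto simp: not_less)
    ultimately have "H s = (\<Sum>k<m. (deriv ^^ k) H 0 / fact k * s ^ k)"
      by (simp add: sums_unique2)
    also have "\<dots> = H 0 + (\<Sum>k\<in>{..<m} - {0}. (deriv ^^ k) H 0 / fact k * s ^ k)"
      using m_pos by (subst sum.remove[of _ 0]) auto
    also have "(\<Sum>k\<in>{..<m} - {0}. (deriv ^^ k) H 0 / fact k * s ^ k) = poly Q s - H0 0"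
      unfolding poly_Q using m_pos same_deriv[OF H]
      by (subst (2) sum.remove[of _ 0]) (auto intro!: sum.cong)
    \<comment> \<open>Q has the constant term of H0; that of H differs by a period of exp\<close>
    finally have eq: "H s = poly Q s - (H0 0 - H 0)" by simp
    have "exp (H0 0 - H 0) = 1"
      using same[OF H0(2) H(1) b0 H(2)] b0 by force
    thus ?thesis unfolding eq by (simp add: exp_diff)
  qed
  have "hadamard_factorization f Q"
    unfolding hadamard_factorization_def
  proof (intro allI impI)
    fix s assume s: "\<not> is_pole f s"
    define x where "x = Max {x0, b0, norm s + 1}"
    have x: "x \<ge> x0" "x \<ge> b0" "x \<ge> norm s + 1" by (auto simp: x_def)
    obtain b H where bH: "x \<le> b" "rep b H"
      using good[of x] x by (auto simp: x0_def)
    have sb: "norm s < b" using bH x by auto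
    have lim: "((\<lambda>X. \<Prod>\<rho>\<in>X. weierstrass_factor (d - 1) (s / \<rho>) powi zorder f \<rho>)
        \<longlongrightarrow> W.partial_canonical b s) (finite_subsets_at_top A)"
      unfolding W.partial_canonical_def by (rule W.canonical_product_tendsto[OF sb])
    have "f s = s powi zorder f 0 * exp (poly Q s) * W.partial_canonical b s"
    proof (cases "s \<in> divisor_set f")
      case False
      hence "f s = s powi zorder f 0 * exp (H s) * W.partial_canonical b s"
        using bH(2) sb by (simp add: rep_def)
      thus ?thesis using exp_Q[OF bH(2)] bH(1) x sb by simp
    next
      case True
      hence fs: "f s = 0" "zorder f s > 0" using s zorder_zero by (auto simp: divisor_set_eq)
      show ?thesis
      proof (cases "s = 0")
        case True
        thus ?thesis using fs by simp
      next
        case False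
        hence "s \<in> A \<inter> ball 0 b" using True sb by (simp add: A_def)
        moreover have "weierstrass_factor (d - 1) (s / s) powi zorder f s = 0"
          using False fs by simp
        ultimately have "W.partial_canonical b s = 0"
          using W.finite_ball[of b] unfolding W.partial_canonical_def by (auto intro!: prod_zero)
        thus ?thesis using fs by simp
      qed
    qed
    with lim show "\<exists>P. ((\<lambda>X. \<Prod>\<rho>\<in>X. weierstrass_factor (convergence_exponent f - 1) (s / \<rho>) powi zorder f \<rho>)
                \<longlongrightarrow> P) (finite_subsets_at_top (divisor_set f - {0})) \<and>
             f s = s powi zorder f 0 * exp (poly Q s) * P"
      unfolding d_def A_def by blast
  qed
  thus thesis by (rule that)
qed

end

section \<open>Sums of simple fractions on a vertical line\<close>

lemma poly_lower_bound_at_infinity: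
  fixes p :: "complex poly"
  assumes "p \<noteq> 0"
  obtains \<kappa> r where "\<kappa> > 0" "\<And>z. norm z \<ge> r \<Longrightarrow> \<kappa> * norm z ^ degree p \<le> norm (poly p z)"
  using assms
proof (induction p arbitrary: thesis)
  case (pCons a p)
  show ?case
  proof (cases "p = 0")
    case True
    thus ?thesis using pCons.hyps by (intro pCons.prems(1)[of "norm a" 0]) auto
  next
    case False
    obtain \<kappa> r where \<kappa>: "\<kappa> > 0" "\<And>z. norm z \<ge> r \<Longrightarrow> \<kappa> * norm z ^ degree p \<le> norm (poly p z)"
      using pCons.IH False by blast
    show ?thesis
    proof (rule pCons.prems(1)[of "\<kappa> / 2" "Max {r, 1, 2 * norm a / \<kappa>}"])
      fix z :: complex assume "norm z \<ge> Max {r, 1, 2 * norm a / \<kappa>}"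
      hence z: "norm z \<ge> r" "norm z \<ge> 1" "norm z \<ge> 2 * norm a / \<kappa>" by auto
      have "norm a \<le> \<kappa> / 2 * norm z"
        using z(3) \<kappa>(1) by (simp add: field_simps)
      also have "\<dots> \<le> \<kappa> / 2 * norm z ^ Suc (degree p)"
        using z(2) \<kappa>(1) self_le_power[of "norm z" "Suc (degree p)"] by (intro mult_left_mono) auto
      finally have "norm a \<le> \<kappa> / 2 * norm z ^ Suc (degree p)" .
      moreover have "norm z * (\<kappa> * norm z ^ degree p) \<le> norm z * norm (poly p z)"
        using \<kappa>(2)[OF z(1)] by (intro mult_left_mono) auto
      hence "\<kappa> * norm z ^ Suc (degree p) \<le> norm (z * poly p z)"
        by (simp add: norm_mult mult_ac)
      moreover have "norm (z * poly p z) - norm a \<le> norm (a + z * poly p z)"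
        using norm_diff_ineq[of "z * poly p z" a] by (simp add: add.commute)
      ultimately show "\<kappa> / 2 * norm z ^ degree (pCons a p) \<le> norm (poly (pCons a p) z)"
        using False by (simp add: field_simps)
    qed (use \<kappa> in auto)
  qed
qed auto

lemma power_le_scaled_power:
  fixes x \<kappa> :: real
  assumes "0 < \<kappa>" "\<kappa> \<le> x" "j \<le> k"
  shows "x ^ j \<le> x ^ k / \<kappa> ^ (k - j)"
proof -
  have "x ^ j * \<kappa> ^ (k - j) \<le> x ^ j * x ^ (k - j)"
    using assms by (intro mult_left_mono power_mono) auto
  also have "\<dots> = x ^ k" using assms by (simp flip: power_add)
  finally show ?thesis using assms by (simp add: field_simps)
qed

lemma poly_upper_bound_off_disc:
  fixes p :: "complex poly"
  assumes "\<kappa> > 0" "degree p \<le> k"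
  obtains B where "B \<ge> 0" "\<And>z. norm z \<ge> \<kappa> \<Longrightarrow> norm (poly p z) \<le> B * norm z ^ k"
proof (rule that)
  show "0 \<le> (\<Sum>i\<le>degree p. norm (coeff p i) / \<kappa> ^ (k - i))"
    using assms by (intro sum_nonneg) auto
  fix z :: complex assume z: "norm z \<ge> \<kappa>"
  have "norm (poly p z) \<le> (\<Sum>i\<le>degree p. norm (coeff p i) * (norm z ^ k / \<kappa> ^ (k - i)))"
    unfolding poly_altdef
    by (rule sum_norm_le)
      (use z assms in \<open>auto simp: norm_mult norm_power intro!: mult_left_mono power_le_scaled_power
        simp del: times_divide_eq_right\<close>)
  thus "norm (poly p z) \<le> (\<Sum>i\<le>degree p. norm (coeff p i) / \<kappa> ^ (k - i)) * norm z ^ k"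
    by (simp add: sum_distrib_left mult_ac)
qed

text \<open>
  If \<open>(k + 1) * a k\<close> is bounded below for large \<open>k\<close>, then \<open>a\<close> dominates the harmonic series.
\<close>

lemma harmonic_weights_contradiction:
  fixes a e :: "nat \<Rightarrow> real"
  assumes a: "summable a" and e: "e \<longlonglongrightarrow> 0" and "c > 0" "K > 0"
    and le: "eventually (\<lambda>k. c \<le> e k + K * real (Suc k) * a k) sequentially"
  shows False
proof -
  have "eventually (\<lambda>k. e k < c / 2) sequentially"
    using e assms(3) by (intro order_tendstoD) auto
  hence "eventually (\<lambda>k. norm (1 / real (Suc k)) \<le> 2 * K / c * a k) sequentially"
    using le
  proof eventually_elim
    case (elim k)
    hence "c / 2 \<le> K * real (Suc k) * a k" by linarith
    thus ?case using assms(3,4) by (simp add: field_simps)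
  qed
  hence "summable (\<lambda>k. 1 / real (Suc k))"
    by (rule summable_comparison_test_ev) (intro summable_mult a)
  thus False
    using not_summable_harmonic[where 'a = real] summable_Suc_iff[of "\<lambda>k. inverse (real k)"]
    by (simp add: inverse_eq_divide)
qed

text \<open>
  The integrand is the derivative of \<open>arsinh (t - \<gamma>)\<close>; it bounds \<open>1 / \<bar>s - \<rho>\<bar>\<close> on a vertical line at distance at
  least \<open>1\<close> from \<open>\<rho>\<close>.
\<close>

lemma integral_inverse_sqrt_le:
  fixes T \<gamma> :: real
  assumes "T > 0" "\<bar>\<gamma>\<bar> \<le> 8 * T"
  shows "integral {T..2*T} (\<lambda>t. 1 / sqrt (1 + (t - \<gamma>)\<^sup>2)) \<le> 2 * arsinh (10 * T)"
proof -
  have "((\<lambda>t. 1 / sqrt (1 + (t - \<gamma>)\<^sup>2)) has_integral arsinh (2 * T - \<gamma>) - arsinh (T - \<gamma>)) {T..2*T}"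
  proof (rule fundamental_theorem_of_calculus)
    fix x
    have "((\<lambda>t. arsinh (t - \<gamma>)) has_real_derivative 1 / sqrt ((x - \<gamma>)\<^sup>2 + 1) * 1) (at x within {T..2*T})"
      by (rule DERIV_chain2[OF arsinh_real_has_field_derivative]) (auto intro!: derivative_eq_intros)
    thus "((\<lambda>t. arsinh (t - \<gamma>)) has_vector_derivative 1 / sqrt (1 + (x - \<gamma>)\<^sup>2)) (at x within {T..2*T})"
      by (simp add: add.commute has_real_derivative_iff_has_vector_derivative)
  qed (use assms(1) in simp)
  hence "integral {T..2*T} (\<lambda>t. 1 / sqrt (1 + (t - \<gamma>)\<^sup>2)) = arsinh (2 * T - \<gamma>) - arsinh (T - \<gamma>)"
    by (rule integral_unique)
  moreover have mono: "arsinh x \<le> arsinh y" if "x \<le> y" for x y :: real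
    using that by (metis arsinh_less_iff_real not_less)
  have "arsinh (2 * T - \<gamma>) \<le> arsinh (10 * T)" "arsinh (- (10 * T)) \<le> arsinh (T - \<gamma>)"
    by (rule mono, use assms in linarith)+
  ultimately show ?thesis by (simp add: arsinh_minus_real)
qed

lemma arsinh_power_16_le: "arsinh (10 * 16 ^ k) \<le> 32 * real (Suc k)"
proof -
  define x :: real where "x = 10 * 16 ^ k"
  have "(16::real) ^ k \<ge> 1" by simp
  hence x: "x \<ge> 1" "x + (x + 1) \<le> 256 * 16 ^ k" unfolding x_def by linarith+
  have "sqrt (x\<^sup>2 + 1) \<le> x + 1"
    using x by (intro real_le_lsqrt) (auto simp: power2_eq_square algebra_simps)
  hence "x + sqrt (x\<^sup>2 + 1) \<le> 16 ^ (k + 2)"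
    using x by simp
  hence "arsinh x \<le> ln (16 ^ (k + 2))"
    unfolding arsinh_real_def using x by (intro ln_mono) (auto intro: add_pos_nonneg)
  also have "\<dots> = real (k + 2) * ln 16" by (simp only: ln_realpow)
  also have "\<dots> \<le> real (k + 2) * 16"
    using ln_le_minus_one[of "16::real"] by (intro mult_left_mono) auto
  also have "\<dots> \<le> 32 * real (Suc k)" by simp
  finally show ?thesis by (simp add: x_def)
qed

context weighted_points
begin

text \<open>
  The logarithmic derivative at \<open>s\<close> of the factor \<open>E\<^bsub>d-1\<^esub> (s / \<rho>) powi n\<^sub>\<rho>\<close>.
\<close>

definition logderiv_term :: "complex \<Rightarrow> complex \<Rightarrow> complex" where
  "logderiv_term s \<rho> = of_int (n \<rho>) * s ^ (d - 1) / (\<rho> ^ (d - 1) * (s - \<rho>))"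

lemma norm_logderiv_term:
  assumes "\<rho> \<in> A"
  shows "norm (logderiv_term s \<rho>) = norm s ^ (d - 1) * (weight \<rho> * (norm \<rho> / norm (s - \<rho>)))"
proof -
  have \<rho>: "norm \<rho> \<noteq> 0" using assms zero_notin by auto
  have "norm \<rho> ^ d = norm \<rho> ^ (d - 1) * norm \<rho>" using d_pos by (cases d) auto
  thus ?thesis using \<rho> by (simp add: logderiv_term_def weight_def norm_mult norm_divide norm_power)
qed

text \<open>
  For all points alike, \<open>\<bar>\<rho>\<bar> \<le> \<bar>s - \<rho>\<bar> + \<bar>s\<bar>\<close> gives \<open>\<bar>\<rho>\<bar> / \<bar>s - \<rho>\<bar> \<le> 1 + \<bar>s\<bar> / \<delta>\<close>. This is enough for polynomial growth on vertical
  lines.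
\<close>

lemma logderiv_sum_crude_bound:
  assumes S: "(logderiv_term s has_sum S) A" and \<delta>: "\<delta> > 0" "\<And>\<rho>. \<rho> \<in> A \<Longrightarrow> norm (s - \<rho>) \<ge> \<delta>"
  shows "norm S \<le> norm s ^ (d - 1) * (infsum weight A * (1 + norm s / \<delta>))"
proof (rule norm_infsum_le[OF S])
  show "((\<lambda>\<rho>. norm s ^ (d - 1) * (weight \<rho> * (1 + norm s / \<delta>))) has_sum
      norm s ^ (d - 1) * (infsum weight A * (1 + norm s / \<delta>))) A"
    by (intro has_sum_cmult_right has_sum_cmult_left has_sum_infsum weight_summable_subset order_refl)
  fix \<rho> assume \<rho>: "\<rho> \<in> A"
  have pos: "norm (s - \<rho>) > 0" using \<delta>(1) \<delta>(2)[OF \<rho>] by linarith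
  have "norm \<rho> \<le> norm (s - \<rho>) + norm s"
    using norm_triangle_ineq4[of s "s - \<rho>"] by simp
  hence "norm \<rho> / norm (s - \<rho>) \<le> (norm (s - \<rho>) + norm s) / norm (s - \<rho>)"
    using pos by (intro divide_right_mono) auto
  also have "\<dots> = 1 + norm s / norm (s - \<rho>)" using pos by (simp add: field_simps)
  also have "\<dots> \<le> 1 + norm s / \<delta>"
    using pos \<delta>(1) \<delta>(2)[OF \<rho>] by (intro add_left_mono divide_left_mono) simp_all
  finally show "norm (logderiv_term s \<rho>) \<le> norm s ^ (d - 1) * (weight \<rho> * (1 + norm s / \<delta>))"
    unfolding norm_logderiv_term[OF \<rho>] by (intro mult_left_mono weight_nonneg) auto
qed

text \<open>
  The points of size about \<open>T\<close>. The ratio of the radii is \<open>16\<close>, so that the shells for \<open>T = 16\<^sup>k\<close> are disjoint.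
\<close>

definition shell :: "real \<Rightarrow> complex set" where
  "shell T = {\<rho> \<in> A. T / 2 < norm \<rho> \<and> norm \<rho> < 8 * T}"

text \<open>
  Bounds the contribution of the points off the shell: there \<open>\<bar>\<rho>\<bar> / \<bar>s - \<rho>\<bar>\<close> is at most \<open>2\<close> for large \<open>\<rho>\<close> and at most
  \<open>2 * \<bar>\<rho>\<bar> / T\<close> for small \<open>\<rho>\<close>.
\<close>

definition damped_weight :: "real \<Rightarrow> real" where
  "damped_weight T = (\<Sum>\<^sub>\<infinity>\<rho>\<in>A. weight \<rho> * min 1 (norm \<rho> / T))"

lemma shell_subset: "shell T \<subseteq> A"
  by (auto simp: shell_def)

lemma finite_shell: "finite (shell T)"
  by (rule finite_subset[OF _ finite_ball[of "8 * T"]]) (auto simp: shell_def)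

lemma damped_summable:
  assumes "B \<subseteq> A" "T > 0"
  shows "(\<lambda>\<rho>. weight \<rho> * min 1 (norm \<rho> / T)) summable_on B"
  using assms
  by (intro summable_on_comparison_test[OF weight_summable_subset[of B]])
    (auto intro!: mult_left_le weight_nonneg mult_nonneg_nonneg)

lemma logderiv_sum_dyadic_bound:
  assumes S: "(logderiv_term s has_sum S) A" and T: "T > 0" "T \<le> norm s" "norm s \<le> 3 * T"
    and right: "\<And>\<rho>. \<rho> \<in> A \<Longrightarrow> Re \<rho> \<le> Re s - 1"
  shows "norm S \<le> norm s ^ (d - 1) *
    (2 * damped_weight T + (\<Sum>\<rho>\<in>shell T. weight \<rho> * (8 * T * (1 / sqrt (1 + (Im s - Im \<rho>)\<^sup>2)))))"
proof (rule norm_infsum_le[OF S])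
  define h where "h = (\<lambda>\<rho>. weight \<rho> * (8 * T * (1 / sqrt (1 + (Im s - Im \<rho>)\<^sup>2))))"
  define g where "g = (\<lambda>\<rho>. 2 * (weight \<rho> * min 1 (norm \<rho> / T)) + (if \<rho> \<in> shell T then h \<rho> else 0))"
  have "((\<lambda>\<rho>. if \<rho> \<in> shell T then h \<rho> else 0) has_sum (\<Sum>\<rho>\<in>shell T. h \<rho>)) A
     \<longleftrightarrow> (h has_sum (\<Sum>\<rho>\<in>shell T. h \<rho>)) (shell T)"
    by (rule has_sum_cong_neutral) (auto simp: shell_def)
  hence "((\<lambda>\<rho>. if \<rho> \<in> shell T then h \<rho> else 0) has_sum (\<Sum>\<rho>\<in>shell T. h \<rho>)) A"
    using has_sum_finite[OF finite_shell] by blast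
  thus "((\<lambda>\<rho>. norm s ^ (d - 1) * g \<rho>) has_sum norm s ^ (d - 1) *
    (2 * damped_weight T + (\<Sum>\<rho>\<in>shell T. weight \<rho> * (8 * T * (1 / sqrt (1 + (Im s - Im \<rho>)\<^sup>2)))))) A"
    unfolding g_def damped_weight_def h_def[symmetric] using T
    by (intro has_sum_cmult_right has_sum_add has_sum_infsum damped_summable) auto
  fix \<rho> assume \<rho>: "\<rho> \<in> A"
  have "weight \<rho> * (norm \<rho> / norm (s - \<rho>)) \<le> g \<rho>"
  proof (cases "\<rho> \<in> shell T")
    case True
    have "(norm (s - \<rho>))\<^sup>2 = (Re s - Re \<rho>)\<^sup>2 + (Im s - Im \<rho>)\<^sup>2" by (simp add: cmod_power2)
    moreover have "(Re s - Re \<rho>)\<^sup>2 \<ge> 1\<^sup>2" using right[OF \<rho>] by (intro power_mono) auto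
    ultimately have "1 + (Im s - Im \<rho>)\<^sup>2 \<le> (norm (s - \<rho>))\<^sup>2" by simp
    hence "sqrt (1 + (Im s - Im \<rho>)\<^sup>2) \<le> norm (s - \<rho>)" by (intro real_le_lsqrt) auto
    hence "norm \<rho> / norm (s - \<rho>) \<le> 8 * T / sqrt (1 + (Im s - Im \<rho>)\<^sup>2)"
      using True T by (intro frac_le) (auto simp: shell_def add_pos_nonneg)
    hence "weight \<rho> * (norm \<rho> / norm (s - \<rho>)) \<le> h \<rho>"
      unfolding h_def by (intro mult_left_mono weight_nonneg) simp
    thus ?thesis using True T weight_nonneg[of \<rho>] by (simp add: g_def add_increasing)
  next
    case False
    have "norm \<rho> / norm (s - \<rho>) \<le> 2 * min 1 (norm \<rho> / T)"
    proof (cases "norm \<rho> \<le> T / 2")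
      case True
      have "T / 2 \<le> norm (s - \<rho>)" using norm_triangle_ineq2[of s \<rho>] True T by linarith
      hence "norm \<rho> / norm (s - \<rho>) \<le> norm \<rho> / (T / 2)"
        using T by (intro divide_left_mono mult_pos_pos) auto
      moreover have "min 1 (norm \<rho> / T) = norm \<rho> / T" using True T by (intro min_absorb2) simp
      ultimately show ?thesis by (simp add: mult.commute)
    next
      case large: False
      hence \<rho>8: "norm \<rho> \<ge> 8 * T" using False \<rho> by (auto simp: shell_def)
      have "norm \<rho> / 2 \<le> norm (s - \<rho>)"
        using norm_triangle_ineq2[of \<rho> s] \<rho>8 T by (simp add: norm_minus_commute)
      hence "norm \<rho> / norm (s - \<rho>) \<le> norm \<rho> / (norm \<rho> / 2)"
        using T \<rho>8 by (intro divide_left_mono mult_pos_pos) auto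
      also have "\<dots> = 2" using T \<rho>8 by auto
      finally have "norm \<rho> / norm (s - \<rho>) \<le> 2" .
      moreover have "1 \<le> norm \<rho> / T" using \<rho>8 T by (simp add: field_simps)
      ultimately show ?thesis by (simp add: min_def)
    qed
    from mult_left_mono[OF this weight_nonneg[of \<rho>]] False show ?thesis by (simp add: g_def mult_ac)
  qed
  thus "norm (logderiv_term s \<rho>) \<le> norm s ^ (d - 1) * g \<rho>"
    unfolding norm_logderiv_term[OF \<rho>] by (intro mult_left_mono) auto
qed

text \<open>
  Dominated convergence: each factor \<open>min 1 (\<bar>\<rho>\<bar> / T)\<close> tends to \<open>0\<close> and is at most \<open>1\<close>.
\<close>

lemma damped_weight_tendsto_0: "(damped_weight \<longlongrightarrow> 0) at_top"
proof (rule tendstoI)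
  fix \<epsilon> :: real assume \<epsilon>: "\<epsilon> > 0"
  obtain b0 where b0: "\<And>b. b \<ge> b0 \<Longrightarrow> infsum weight (A - ball 0 b) < \<epsilon> / 2"
    by (rule tail_weight_small[of "\<epsilon> / 2"]) (use \<epsilon> in auto)
  define b where "b = max b0 1"
  define V where "V = infsum weight A"
  have V: "V \<ge> 0" unfolding V_def by (intro infsum_nonneg weight_nonneg)
  have "eventually (\<lambda>T. T > 2 * b * V / \<epsilon>) at_top" by (rule eventually_gt_at_top)
  thus "eventually (\<lambda>T. dist (damped_weight T) 0 < \<epsilon>) at_top"
    using eventually_gt_at_top[of 0]
  proof eventually_elim
    case (elim T)
    let ?h = "\<lambda>\<rho>. weight \<rho> * min 1 (norm \<rho> / T)"
    have nonneg: "?h \<rho> \<ge> 0" for \<rho> using elim weight_nonneg by simp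
    have "damped_weight T = infsum ?h ((A \<inter> ball 0 b) \<union> (A - ball 0 b))"
      unfolding damped_weight_def by (rule arg_cong[of _ _ "infsum _"]) auto
    also have "\<dots> = infsum ?h (A \<inter> ball 0 b) + infsum ?h (A - ball 0 b)"
      using elim by (intro infsum_Un_disjoint damped_summable) auto
    also have "infsum ?h (A \<inter> ball 0 b) \<le> infsum (\<lambda>\<rho>. weight \<rho> * (b / T)) (A \<inter> ball 0 b)"
      using elim weight_nonneg
      by (intro infsum_mono damped_summable summable_on_cmult_left weight_summable_subset mult_left_mono)
        (auto intro!: divide_right_mono min.coboundedI2)
    also have "\<dots> = infsum weight (A \<inter> ball 0 b) * (b / T)" by (rule infsum_cmult_left')
    also have "\<dots> \<le> V * (b / T)"
      unfolding V_def using elim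
      by (intro mult_right_mono infsum_mono_neutral weight_summable_subset) (auto simp: weight_nonneg b_def)
    also have "infsum ?h (A - ball 0 b) \<le> infsum weight (A - ball 0 b)"
      using elim weight_nonneg
      by (intro infsum_mono damped_summable weight_summable_subset) (auto intro!: mult_left_le)
    also have "\<dots> < \<epsilon> / 2" by (rule b0) (simp add: b_def)
    finally have "damped_weight T < V * (b / T) + \<epsilon> / 2" by simp
    moreover have "V * (b / T) \<le> \<epsilon> / 2" using elim \<epsilon> by (simp add: field_simps)
    moreover have "damped_weight T \<ge> 0"
      unfolding damped_weight_def by (intro infsum_nonneg nonneg)
    ultimately have "\<bar>damped_weight T\<bar> < \<epsilon>" by linarith
    thus ?case by (simp add: dist_real_def)
  qed
qed

lemma shell_weights_summable: "summable (\<lambda>k. \<Sum>\<rho>\<in>shell (16 ^ k). weight \<rho>)"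
proof (rule summableI_nonneg_bounded)
  show "0 \<le> (\<Sum>\<rho>\<in>shell (16 ^ k). weight \<rho>)" for k by (intro sum_nonneg weight_nonneg)
  fix m
  have disj: "shell (16 ^ j) \<inter> shell (16 ^ k) = {}" if "j < k" for j k :: nat
  proof -
    have "(16::real) ^ Suc j \<le> 16 ^ k" using that by (intro power_increasing) auto
    thus ?thesis by (auto simp: shell_def)
  qed
  have "(\<Sum>k<m. \<Sum>\<rho>\<in>shell (16 ^ k). weight \<rho>) = (\<Sum>\<rho>\<in>(\<Union>k<m. shell (16 ^ k)). weight \<rho>)"
    using disj by (intro sum.UNION_disjoint[symmetric] ballI impI finite_shell)
      (auto, metis disj Int_iff empty_iff linorder_neqE_nat)
  also have "\<dots> \<le> infsum weight A"
    by (intro finite_sum_le_infsum weight_summable_subset)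
      (use shell_subset in \<open>auto simp: weight_nonneg finite_shell\<close>)
  finally show "(\<Sum>k<m. \<Sum>\<rho>\<in>shell (16 ^ k). weight \<rho>) \<le> infsum weight A" .
qed

end

section \<open>The vertical order bounds the degree\<close>

lemma norm_Complex_sq: "(norm (Complex c t))\<^sup>2 = c\<^sup>2 + t\<^sup>2"
  by (simp add: cmod_power2)

lemma abs_le_norm_Complex: "\<bar>c\<bar> \<le> norm (Complex c t)" "\<bar>t\<bar> \<le> norm (Complex c t)"
  using abs_Re_le_cmod[of "Complex c t"] abs_Im_le_cmod[of "Complex c t"] by auto

lemma integrable_inverse_square_vertical:
  assumes "c \<noteq> (0::real)"
  shows "integrable lborel (\<lambda>t. 1 / (norm (Complex c t))\<^sup>2)"
proof -
  define K where "K = max 1 (1 / c\<^sup>2)"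
  have "integrable lborel (\<lambda>t::real. K * inverse (1 + t\<^sup>2))"
    using integrable_inverse_1_plus_square by (simp add: set_integrable_def einterval_eq)
  thus ?thesis
  proof (rule Bochner_Integration.integrable_bound)
    show "AE t in lborel. norm (1 / (norm (Complex c t))\<^sup>2) \<le> norm (K * inverse (1 + t\<^sup>2))"
    proof (intro AE_I2)
      fix t :: real
      have K: "K \<ge> 1" "1 \<le> K * c\<^sup>2" using assms by (auto simp: K_def max_def field_simps)
      have "t\<^sup>2 \<le> K * t\<^sup>2" using mult_right_mono[OF K(1), of "t\<^sup>2"] by simp
      hence "1 + t\<^sup>2 \<le> K * (c\<^sup>2 + t\<^sup>2)" using K(2) by (simp add: distrib_left)
      moreover have "c\<^sup>2 + t\<^sup>2 > 0" using assms by (simp add: add_pos_nonneg)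
      moreover have "1 + t\<^sup>2 > 0" by (simp add: add_pos_nonneg)
      ultimately have "1 / (c\<^sup>2 + t\<^sup>2) \<le> K / (1 + t\<^sup>2)" by (simp add: field_simps)
      thus "norm (1 / (norm (Complex c t))\<^sup>2) \<le> norm (K * inverse (1 + t\<^sup>2))"
        using K(1) unfolding norm_Complex_sq by (simp add: inverse_eq_divide add_nonneg_nonneg)
    qed
  qed (simp add: norm_Complex_sq)
qed

context nonzero_meromorphic
begin

text \<open>
  Every polynomial \<open>Q\<close> of a factorization is covered, since the one that defines the Weierstrass genus is
  an arbitrary choice.
\<close>

lemma log_derivative_formula:
  assumes W: "weighted_points (divisor_set f - {0}) (zorder f) (convergence_exponent f)"
    and Q: "hadamard_factorization f Q" and s: "s \<notin> divisor_set f" "s \<noteq> 0"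
  obtains S where
    "(weighted_points.logderiv_term (zorder f) (convergence_exponent f) s has_sum S) (divisor_set f - {0})"
    "deriv f s / f s = of_int (zorder f 0) / s + poly (pderiv Q) s + S"
proof -
  interpret W: weighted_points "divisor_set f - {0}" "zorder f" "convergence_exponent f" by (rule W)
  define b where "b = norm s + 1"
  define U where "U = ball 0 b - divisor_set f"
  define n0 where "n0 = zorder f 0"
  define g where "g = (\<lambda>z. z powi n0 * exp (poly Q z) * W.partial_canonical b z)"
  have U: "open U" "s \<in> U" unfolding U_def using s closed_divisor by (auto simp: b_def)
  have eq: "g z = f z" if "z \<in> U" for z
  proof -
    have z: "\<not> is_pole f z" "norm z < b" using that by (auto simp: U_def divisor_set_def)
    obtain P where P: "((\<lambda>X. \<Prod>\<rho>\<in>X. weierstrass_factor (convergence_exponent f - 1) (z / \<rho>) powi zorder f \<rho>)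
         \<longlongrightarrow> P) (finite_subsets_at_top (divisor_set f - {0}))" "f z = z powi n0 * exp (poly Q z) * P"
      using Q z(1) unfolding hadamard_factorization_def n0_def by blast
    have "P = W.partial_canonical b z"
      unfolding W.partial_canonical_def
      by (rule tendsto_unique[OF finite_subsets_at_top_neq_bot P(1) W.canonical_product_tendsto[OF z(2)]])
    thus ?thesis using P(2) by (simp add: g_def)
  qed
  obtain S where S: "(W.logderiv_term s has_sum S) (divisor_set f - {0})"
    "(W.partial_canonical b has_field_derivative W.partial_canonical b s * S) (at s)"
    by (rule W.partial_canonical_deriv[of s b])
      (use s in \<open>auto simp: b_def W.logderiv_term_def[abs_def]\<close>)
  have "(g has_field_derivative
       (of_int n0 * s powi (n0 - 1) * 1 * exp (poly Q s) + exp (poly Q s) * poly (pderiv Q) s * s powi n0)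
         * W.partial_canonical b s
       + W.partial_canonical b s * S * (s powi n0 * exp (poly Q s))) (at s)"
    unfolding g_def using s
    by (intro DERIV_mult DERIV_power_int DERIV_chain2[OF DERIV_exp poly_DERIV] S DERIV_ident) auto
  also have "(of_int n0 * s powi (n0 - 1) * 1 * exp (poly Q s) + exp (poly Q s) * poly (pderiv Q) s * s powi n0)
         * W.partial_canonical b s
       + W.partial_canonical b s * S * (s powi n0 * exp (poly Q s))
     = g s * (of_int n0 / s + poly (pderiv Q) s + S)"
    using s by (simp add: g_def power_int_diff field_simps)
  finally have "(f has_field_derivative g s * (of_int n0 / s + poly (pderiv Q) s + S)) (at s)"
    by (rule has_field_derivative_transform_within_open[OF _ U eq])
  hence "deriv f s = f s * (of_int n0 / s + poly (pderiv Q) s + S)"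
    using eq[OF U(2)] by (simp add: DERIV_imp_deriv)
  hence "deriv f s / f s = of_int (zorder f 0) / s + poly (pderiv Q) s + S"
    using s by (simp add: n0_def divisor_set_eq)
  with S(1) that show thesis by blast
qed

lemma continuous_log_derivative_vertical:
  assumes "\<And>\<rho>. \<rho> \<in> divisor_set f \<Longrightarrow> Re \<rho> < c"
  shows "continuous_on UNIV (\<lambda>t. deriv f (Complex c t) / f (Complex c t))"
proof -
  have "(\<lambda>s. deriv f s / f s) holomorphic_on - divisor_set f"
    using closed_divisor holomorphic_off_divisor
    by (intro holomorphic_intros) (auto simp: divisor_set_eq)
  hence "continuous_on (- divisor_set f) (\<lambda>s. deriv f s / f s)"
    by (rule holomorphic_on_imp_continuous_on)
  moreover have "continuous_on UNIV (\<lambda>t. Complex c t)"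
    unfolding Complex_eq by (intro continuous_intros)
  moreover have "(\<lambda>t. Complex c t) ` UNIV \<subseteq> - divisor_set f"
    using assms by fastforce
  ultimately show ?thesis by (rule continuous_on_compose2)
qed

text \<open>
  The exponent does not depend on the line, as the definition of the vertical order demands.
\<close>

lemma log_derivative_vertical_bound:
  assumes W: "weighted_points (divisor_set f - {0}) (zorder f) (convergence_exponent f)"
    and Q: "hadamard_factorization f Q"
    and c: "c \<noteq> 0" "\<sigma> < c" "\<And>\<rho>. \<rho> \<in> divisor_set f \<Longrightarrow> Re \<rho> \<le> \<sigma>"
  obtains B where "B \<ge> 0"
    "\<And>t. norm (deriv f (Complex c t) / f (Complex c t))
       \<le> B * norm (Complex c t) ^ max (convergence_exponent f) (degree Q)"
proof -
  interpret W: weighted_points "divisor_set f - {0}" "zorder f" "convergence_exponent f" by (rule W)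
  define d where "d = convergence_exponent f"
  define k where "k = max d (degree Q)"
  define \<kappa> where "\<kappa> = \<bar>c\<bar>"
  define V where "V = infsum W.weight (divisor_set f - {0})"
  define n0 where "n0 = \<bar>of_int (zorder f 0) :: real\<bar>"
  define \<delta> where "\<delta> = c - \<sigma>"
  have pos: "\<kappa> > 0" "\<delta> > 0" "V \<ge> 0" "n0 \<ge> 0"
    using c unfolding \<kappa>_def \<delta>_def V_def n0_def by (auto intro!: infsum_nonneg W.weight_nonneg)
  have "degree (pderiv Q) \<le> k" by (simp add: degree_pderiv k_def)
  then obtain B1 where B1: "B1 \<ge> 0" "\<And>z. norm z \<ge> \<kappa> \<Longrightarrow> norm (poly (pderiv Q) z) \<le> B1 * norm z ^ k"
    using poly_upper_bound_off_disc[OF pos(1)] by blast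
  define B where "B = n0 / \<kappa> * (1 / \<kappa> ^ k) + B1 + V * (1 / \<kappa> ^ (k - (d - 1)) + 1 / \<delta> * (1 / \<kappa> ^ (k - d)))"
  show thesis
  proof (rule that[of B])
    show "B \<ge> 0" unfolding B_def using pos B1 by (intro add_nonneg_nonneg mult_nonneg_nonneg) auto
    fix t
    define s where "s = Complex c t"
    have s: "norm s \<ge> \<kappa>" unfolding s_def \<kappa>_def by (rule abs_le_norm_Complex)
    have dist: "norm (s - \<rho>) \<ge> \<delta>" if "\<rho> \<in> divisor_set f" for \<rho>
      using c(3)[OF that] abs_Re_le_cmod[of "s - \<rho>"] by (simp add: s_def \<delta>_def)
    have nd: "s \<notin> divisor_set f" "s \<noteq> 0" using dist[of s] pos s by auto
    obtain S where S: "(W.logderiv_term s has_sum S) (divisor_set f - {0})"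
      "deriv f s / f s = of_int (zorder f 0) / s + poly (pderiv Q) s + S"
      by (rule log_derivative_formula[OF W Q nd])
    have pw: "norm s ^ j \<le> 1 / \<kappa> ^ (k - j) * norm s ^ k" if "j \<le> k" for j
      using power_le_scaled_power[OF pos(1) s that] by simp
    have "norm (of_int (zorder f 0) / s) \<le> n0 / \<kappa>"
      using s pos by (auto simp: norm_divide n0_def intro!: frac_le)
    also have "\<dots> \<le> n0 / \<kappa> * (1 / \<kappa> ^ k * norm s ^ k)"
      using pw[of 0] pos mult_left_mono[of 1 "1 / \<kappa> ^ k * norm s ^ k" "n0 / \<kappa>"] by simp
    finally have 1: "norm (of_int (zorder f 0) / s) \<le> n0 / \<kappa> * (1 / \<kappa> ^ k) * norm s ^ k" by simp
    have "norm S \<le> norm s ^ (d - 1) * (V * (1 + norm s / \<delta>))"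
      unfolding V_def d_def using S(1) pos(2) dist by (intro W.logderiv_sum_crude_bound) auto
    also have "\<dots> = V * (norm s ^ (d - 1) + 1 / \<delta> * norm s ^ d)"
      using W.d_pos unfolding d_def by (cases "convergence_exponent f") (auto simp: field_simps)
    also have "\<dots> \<le> V * (1 / \<kappa> ^ (k - (d - 1)) * norm s ^ k + 1 / \<delta> * (1 / \<kappa> ^ (k - d) * norm s ^ k))"
      using pos by (intro mult_left_mono add_mono pw) (auto simp: k_def)
    also have "\<dots> = V * (1 / \<kappa> ^ (k - (d - 1)) + 1 / \<delta> * (1 / \<kappa> ^ (k - d))) * norm s ^ k"
      by (simp only: distrib_left distrib_right mult.assoc)
    finally have 2: "norm S \<le> V * (1 / \<kappa> ^ (k - (d - 1)) + 1 / \<delta> * (1 / \<kappa> ^ (k - d))) * norm s ^ k" .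
    have "norm (deriv f s / f s) \<le> norm (of_int (zorder f 0) / s) + norm (poly (pderiv Q) s) + norm S"
      unfolding S(2) using norm_triangle_ineq[of "of_int (zorder f 0) / s + poly (pderiv Q) s" S]
        norm_triangle_ineq[of "of_int (zorder f 0) / s" "poly (pderiv Q) s"] by linarith
    also have "\<dots> \<le> B * norm s ^ k"
      unfolding B_def distrib_right[of _ _ "norm s ^ k"] using 1 2 B1(2)[OF s] by linarith
    finally show "norm (deriv f (Complex c t) / f (Complex c t))
       \<le> B * norm (Complex c t) ^ max (convergence_exponent f) (degree Q)"
      by (simp only: s_def k_def d_def)
  qed
qed

lemma sigma1_less_real:
  assumes "sigma1 f < ereal c"
  obtains \<sigma> where "\<sigma> < c" "\<And>\<rho>. \<rho> \<in> divisor_set f \<Longrightarrow> Re \<rho> \<le> \<sigma>"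
proof -
  obtain \<sigma> where \<sigma>: "sigma1 f < ereal \<sigma>" "ereal \<sigma> < ereal c"
    using ereal_dense2[OF assms] by blast
  have "Re \<rho> \<le> \<sigma>" if "\<rho> \<in> divisor_set f" for \<rho>
  proof -
    have "ereal (Re \<rho>) \<le> sigma1 f" unfolding sigma1_def by (rule SUP_upper[OF that])
    hence "ereal (Re \<rho>) < ereal \<sigma>" using \<sigma>(1) by (rule order_le_less_trans)
    thus ?thesis by simp
  qed
  thus thesis using that[of \<sigma>] \<sigma>(2) by simp
qed

text \<open>
  Two more than the growth exponent of \<open>f'/f\<close> leaves the integrable majorant \<open>1 / \<bar>s\<bar>\<^sup>2\<close>; so the set of admissible
  exponents is not empty, and its least element is admissible.
\<close>

lemma vertical_order_integrable:
  assumes W: "weighted_points (divisor_set f - {0}) (zorder f) (convergence_exponent f)"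
    and Q: "hadamard_factorization f Q" and c: "sigma1 f < ereal c" "c \<noteq> 0"
  shows "integrable lborel (\<lambda>t. deriv f (Complex c t) / f (Complex c t) /
           of_real (norm (Complex c t) ^ vertical_order f))"
proof -
  define k where "k = max (convergence_exponent f) (degree Q)"
  have "\<forall>c::real. sigma1 f < ereal c \<and> c \<noteq> 0 \<longrightarrow>
        integrable lborel
          (\<lambda>t. deriv f (Complex c t) / f (Complex c t) / of_real (norm (Complex c t) ^ (k + 2)))"
  proof (intro allI impI)
    fix c :: real assume c: "sigma1 f < ereal c \<and> c \<noteq> 0"
    obtain \<sigma> where \<sigma>: "\<sigma> < c" "\<And>\<rho>. \<rho> \<in> divisor_set f \<Longrightarrow> Re \<rho> \<le> \<sigma>"
      by (rule sigma1_less_real[of c]) (use c in auto)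
    obtain B where B: "B \<ge> 0" "\<And>t. norm (deriv f (Complex c t) / f (Complex c t)) \<le> B * norm (Complex c t) ^ k"
      using log_derivative_vertical_bound[OF W Q _ \<sigma>] c unfolding k_def by blast
    have cont: "continuous_on UNIV (\<lambda>t. deriv f (Complex c t) / f (Complex c t))"
      using \<sigma> by (intro continuous_log_derivative_vertical) force
    have pos: "norm (Complex c t) > 0" for t
      using abs_le_norm_Complex(1)[of c t] c by linarith
    have cont2: "continuous_on UNIV (\<lambda>t. Complex c t)"
      unfolding Complex_eq by (intro continuous_intros)
    show "integrable lborel
          (\<lambda>t. deriv f (Complex c t) / f (Complex c t) / of_real (norm (Complex c t) ^ (k + 2)))"
    proof (rule Bochner_Integration.integrable_bound)
      show "integrable lborel (\<lambda>t. B * (1 / (norm (Complex c t))\<^sup>2))"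
        using c by (intro integrable_mult_right integrable_inverse_square_vertical) auto
      have "continuous_on UNIV (\<lambda>t. deriv f (Complex c t) / f (Complex c t) / of_real (norm (Complex c t) ^ (k + 2)))"
      proof (rule continuous_on_divide[OF cont])
        show "continuous_on UNIV (\<lambda>t. complex_of_real (norm (Complex c t) ^ (k + 2)))"
          by (intro continuous_intros cont2)
        have "norm (Complex c t) ^ (k + 2) \<noteq> 0" for t
          using zero_less_power[OF pos[of t], of "k + 2"] by linarith
        thus "\<forall>t\<in>UNIV. complex_of_real (norm (Complex c t) ^ (k + 2)) \<noteq> 0"
          by (simp only: of_real_eq_0_iff) blast
      qed
      thus "(\<lambda>t. deriv f (Complex c t) / f (Complex c t) / of_real (norm (Complex c t) ^ (k + 2)))
         \<in> borel_measurable lborel"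
        by (simp add: borel_measurable_continuous_onI)
      show "AE t in lborel. norm (deriv f (Complex c t) / f (Complex c t) / of_real (norm (Complex c t) ^ (k + 2)))
         \<le> norm (B * (1 / (norm (Complex c t))\<^sup>2))"
      proof (rule AE_I2)
        fix t
        have "norm (deriv f (Complex c t) / f (Complex c t)) / norm (Complex c t) ^ (k + 2)
           \<le> B * norm (Complex c t) ^ k / norm (Complex c t) ^ (k + 2)"
          by (intro divide_right_mono B(2)) auto
        also have "\<dots> = B * (1 / (norm (Complex c t))\<^sup>2)"
          using pos[of t] by (simp add: power_add power2_eq_square)
        finally show "norm (deriv f (Complex c t) / f (Complex c t) / of_real (norm (Complex c t) ^ (k + 2)))
         \<le> norm (B * (1 / (norm (Complex c t))\<^sup>2))"
          using B(1) by (simp add: norm_divide norm_power norm_mult)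
      qed
    qed
  qed
  hence "\<forall>c::real. sigma1 f < ereal c \<and> c \<noteq> 0 \<longrightarrow>
        integrable lborel
          (\<lambda>t. deriv f (Complex c t) / f (Complex c t) / of_real (norm (Complex c t) ^ vertical_order f))"
    unfolding vertical_order_def by (rule LeastI)
  thus ?thesis using c by blast
qed

text \<open>
  With \<open>F = \<bar>s\<bar>\<^bsup>-d\<^esup> \<bar>f'/f\<bar>\<close> integrable on a line at distance at least \<open>1\<close> from the divisor, a degree of at least
  \<open>d\<close> would give, for \<open>T = 16\<^sup>k\<close>, \<open>\<kappa> \<le> o(1) + 512 * (k + 1) * a\<^sub>k\<close>, where \<open>a\<^sub>k\<close> is the weight of the shell of \<open>T\<close>.
\<close>

lemma degree_less_convergence_exponent:
  assumes W: "weighted_points (divisor_set f - {0}) (zorder f) (convergence_exponent f)"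
    and Q: "hadamard_factorization f Q"
    and sigma: "sigma1 f < \<infinity>"
    and order: "vertical_order f \<le> convergence_exponent f"
  shows "degree Q < convergence_exponent f"
proof (rule ccontr)
  interpret W: weighted_points "divisor_set f - {0}" "zorder f" "convergence_exponent f" by (rule W)
  define d where "d = convergence_exponent f"
  assume "\<not> degree Q < convergence_exponent f"
  hence deg: "degree Q \<ge> d" by (simp add: d_def)
  have d1: "d \<ge> 1" using W.d_pos by (simp add: d_def)
  obtain m :: nat where m: "sigma1 f < ereal (real m)" using sigma less_PInf_Ex_of_nat by auto
  obtain \<sigma> where \<sigma>: "\<sigma> < real m" "\<And>\<rho>. \<rho> \<in> divisor_set f \<Longrightarrow> Re \<rho> \<le> \<sigma>"
    by (rule sigma1_less_real[OF m]) blast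
  \<comment> \<open>the line keeps distance 1 from the divisor, and \<open>\<bar>s\<bar> \<ge> 1\<close> on it\<close>
  define c where "c = real m + 1"
  have c: "c \<ge> 1" "sigma1 f < ereal c"
    using m by (auto simp: c_def intro: less_trans[of _ "ereal (real m)"])
  have right: "Re \<rho> \<le> c - 1" if "\<rho> \<in> divisor_set f" for \<rho>
    using \<sigma>(1) \<sigma>(2)[OF that] by (simp add: c_def)
  have norm_ge: "norm (Complex c t) \<ge> 1" for t
    using abs_le_norm_Complex(1)[of c t] c by linarith
  define F where "F = (\<lambda>t. norm (deriv f (Complex c t) / f (Complex c t)) / norm (Complex c t) ^ d)"
  have cont_F: "continuous_on UNIV F"
    unfolding F_def
  proof (rule continuous_on_divide)
    show "continuous_on UNIV (\<lambda>t. norm (deriv f (Complex c t) / f (Complex c t)))"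
      using right by (intro continuous_on_norm continuous_log_derivative_vertical) force
    show "continuous_on UNIV (\<lambda>t. norm (Complex c t) ^ d)"
      unfolding Complex_eq by (intro continuous_intros)
    have "norm (Complex c t) ^ d \<noteq> 0" for t
      using one_le_power[OF norm_ge[of t], of d] by linarith
    thus "\<forall>t\<in>UNIV. norm (Complex c t) ^ d \<noteq> 0" by blast
  qed
  have F_nonneg: "F t \<ge> 0" for t by (simp add: F_def)
  have int_F: "integrable lborel F"
  proof (rule Bochner_Integration.integrable_bound)
    show "integrable lborel (\<lambda>t. deriv f (Complex c t) / f (Complex c t) /
           of_real (norm (Complex c t) ^ vertical_order f))"
      using c by (intro vertical_order_integrable[OF W Q]) auto
    show "F \<in> borel_measurable lborel" using cont_F by (simp add: borel_measurable_continuous_onI)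
    show "AE t in lborel. norm (F t) \<le> norm (deriv f (Complex c t) / f (Complex c t) /
           of_real (norm (Complex c t) ^ vertical_order f))"
    proof (rule AE_I2)
      fix t
      have "norm (Complex c t) ^ vertical_order f \<le> norm (Complex c t) ^ d"
        using order norm_ge[of t] by (intro power_increasing) (auto simp: d_def)
      moreover have "norm (Complex c t) ^ vertical_order f > 0"
        using one_le_power[OF norm_ge[of t], of "vertical_order f"] by linarith
      ultimately have "F t \<le> norm (deriv f (Complex c t) / f (Complex c t)) / norm (Complex c t) ^ vertical_order f"
        unfolding F_def by (intro divide_left_mono mult_pos_pos) auto
      also have "\<dots> = norm (deriv f (Complex c t) / f (Complex c t) /
           of_real (norm (Complex c t) ^ vertical_order f))"
        by (simp add: norm_divide norm_power norm_mult)
      finally show "norm (F t) \<le> \<dots>" using F_nonneg by simp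
    qed
  qed
  define e where "e = (\<lambda>k::nat. integral {16^k..2*16^k} F)"
  have pow_top: "filterlim (\<lambda>k. (16::real) ^ k) at_top sequentially"
  proof (rule filterlim_at_top_mono[OF filterlim_real_sequentially always_eventually[OF allI]])
    fix k :: nat
    have "real k \<le> 2 ^ k" using of_nat_less_two_power[of k, where 'a = real] by simp
    also have "(2::real) ^ k \<le> 16 ^ k" by (intro power_mono) auto
    finally show "real k \<le> 16 ^ k" .
  qed
  have e_lim: "e \<longlonglongrightarrow> 0"
  proof -
    have "(\<lambda>k. LINT t|lborel. indicator {16^k..2*16^k} t *\<^sub>R F t) \<longlonglongrightarrow> (LINT t::real|lborel. 0)"
    proof (rule integral_dominated_convergence[where w = F])
      show "AE t in lborel. (\<lambda>k. indicator {16^k..2*16^k} t *\<^sub>R F t) \<longlonglongrightarrow> 0"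
      proof (rule AE_I2)
        fix t :: real
        have "eventually (\<lambda>k. (16::real) ^ k > t) sequentially"
          using pow_top by (simp add: filterlim_at_top_dense)
        hence "eventually (\<lambda>k. indicator {16^k..2*16^k} t *\<^sub>R F t = 0) sequentially"
          by eventually_elim (simp add: indicator_def)
        thus "(\<lambda>k. indicator {16^k..2*16^k} t *\<^sub>R F t) \<longlonglongrightarrow> 0" by (rule tendsto_eventually)
      qed
      show "AE t in lborel. norm (indicator {16^k..2*16^k} t *\<^sub>R F t) \<le> F t" for k
        using F_nonneg by (intro AE_I2) (simp add: indicator_def)
      show "(\<lambda>t. indicator {16^k..2*16^k} t *\<^sub>R F t) \<in> borel_measurable lborel" for k
        using borel_measurable_integrable[OF int_F] by measurable
    qed (use int_F in auto)
    moreover have "e = (\<lambda>k. LINT t|lborel. indicator {16^k..2*16^k} t *\<^sub>R F t)"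
    proof
      fix k
      have "set_integrable lborel {16^k..2*16^k} F"
        unfolding set_integrable_def using int_F by (intro integrable_mult_indicator) auto
      from set_borel_integral_eq_integral(2)[OF this]
      show "e k = (LINT t|lborel. indicator {16^k..2*16^k} t *\<^sub>R F t)"
        by (simp add: e_def set_lebesgue_integral_def)
    qed
    ultimately show ?thesis by simp
  qed
  have "pderiv Q \<noteq> 0" using deg d1 by (simp add: pderiv_eq_0_iff)
  then obtain \<kappa> r where \<kappa>: "\<kappa> > 0"
    "\<And>z. norm z \<ge> r \<Longrightarrow> \<kappa> * norm z ^ degree (pderiv Q) \<le> norm (poly (pderiv Q) z)"
    using poly_lower_bound_at_infinity[of "pderiv Q"] by metis
  define n0 where "n0 = \<bar>of_int (zorder f 0) :: real\<bar>"
  define a where "a = (\<lambda>k. \<Sum>\<rho>\<in>W.shell (16 ^ k). W.weight \<rho>)"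
  have main: "\<kappa> \<le> (3 * e k + n0 / 16 ^ k + 2 * W.damped_weight (16 ^ k)) + 512 * real (Suc k) * a k"
    if k: "16 ^ k \<ge> c" "16 ^ k \<ge> r" for k
  proof -
    define T :: real where "T = 16 ^ k"
    have T: "T \<ge> c" "T \<ge> r" "T \<ge> 1" using k by (auto simp: T_def)
    define X where "X = (\<lambda>t. \<Sum>\<rho>\<in>W.shell T. W.weight \<rho> * (8 * T * (1 / sqrt (1 + (t - Im \<rho>)\<^sup>2))))"
    \<comment> \<open>the formula for f'/f, solved for Q' and divided by the power d - 1 of \<open>\<bar>s\<bar>\<close>; here \<open>T \<le> \<bar>s\<bar> \<le> 3 * T\<close>\<close>
    have pointwise: "\<kappa> \<le> 3 * T * F t + n0 / T + 2 * W.damped_weight T + X t" if t: "t \<in> {T..2*T}" for t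
    proof -
      define s where "s = Complex c t"
      have s_ge: "norm s \<ge> T" using abs_le_norm_Complex(2)[where t=t and c=c] t by (simp add: s_def)
      have s_le: "norm s \<le> 3 * T"
        using cmod_le[of s] t T c by (simp add: s_def)
      have s1: "norm s \<ge> 1" using s_ge T by simp
      have nd: "s \<notin> divisor_set f" "s \<noteq> 0" using right[of s] s1 by (auto simp: s_def)
      obtain S where S: "(W.logderiv_term s has_sum S) (divisor_set f - {0})"
        "deriv f s / f s = of_int (zorder f 0) / s + poly (pderiv Q) s + S"
        by (rule log_derivative_formula[OF W Q nd])
      have S_le: "norm S \<le> norm s ^ (d - 1) * (2 * W.damped_weight T + X t)"
        using W.logderiv_sum_dyadic_bound[OF S(1), of T] T s_ge s_le right
        by (simp add: X_def d_def s_def)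
      have "\<kappa> * norm s ^ (d - 1) \<le> \<kappa> * norm s ^ degree (pderiv Q)"
        using \<kappa>(1) s1 deg by (intro mult_left_mono power_increasing) (auto simp: degree_pderiv)
      also have "\<dots> \<le> norm (poly (pderiv Q) s)" using s_ge T by (intro \<kappa>(2)) simp
      also have "\<dots> \<le> norm (deriv f s / f s) + norm (of_int (zorder f 0) / s) + norm S"
      proof -
        have eq: "poly (pderiv Q) s = deriv f s / f s - of_int (zorder f 0) / s - S" using S(2) by simp
        show ?thesis
          unfolding eq using norm_triangle_ineq4[of "deriv f s / f s - of_int (zorder f 0) / s" S]
            norm_triangle_ineq4[of "deriv f s / f s" "of_int (zorder f 0) / s"] by linarith
      qed
      finally have le: "\<kappa> * norm s ^ (d - 1) \<le> norm (deriv f s / f s) + norm (of_int (zorder f 0) / s) + norm S" .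
      have 1: "norm (deriv f s / f s) = norm s ^ (d - 1) * (norm s * F t)"
      proof -
        have "norm s ^ d = norm s ^ (d - 1) * norm s" using d1 by (cases d) auto
        moreover have "norm (deriv f s / f s) = norm s ^ d * F t"
          using nd(2) by (simp add: F_def s_def[symmetric])
        ultimately show ?thesis by simp
      qed
      have 2: "norm (of_int (zorder f 0) / s) \<le> norm s ^ (d - 1) * (n0 / T)"
      proof -
        have "norm (of_int (zorder f 0) / s) \<le> n0 / T"
          unfolding norm_divide n0_def norm_of_int using s_ge T by (intro divide_left_mono mult_pos_pos) auto
        also have "\<dots> \<le> norm s ^ (d - 1) * (n0 / T)"
          using mult_right_mono[OF one_le_power[OF s1, of "d - 1"], of "n0 / T"] T by (simp add: n0_def)
        finally show ?thesis .
      qed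
      have "norm s ^ (d - 1) * \<kappa> \<le> norm s ^ (d - 1) * (norm s * F t + n0 / T + (2 * W.damped_weight T + X t))"
        using le 1 2 S_le unfolding distrib_left[of "norm s ^ (d - 1)"] mult.commute[of \<kappa>] by linarith
      moreover have "norm s ^ (d - 1) > 0" using one_le_power[OF s1, of "d - 1"] by linarith
      ultimately have "\<kappa> \<le> norm s * F t + n0 / T + (2 * W.damped_weight T + X t)"
        by (simp only: mult_le_cancel_left_pos)
      moreover have "norm s * F t \<le> 3 * T * F t" using s_le F_nonneg by (intro mult_right_mono) auto
      ultimately show ?thesis by linarith
    qed
    have cont_sqrt: "continuous_on {T..2*T} (\<lambda>t. 1 / sqrt (1 + (t - \<gamma>)\<^sup>2))" for \<gamma>
      by (intro continuous_intros ballI) (auto simp: add_pos_nonneg add_nonneg_eq_0_iff)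
    have cont_X: "continuous_on {T..2*T} X"
      unfolding X_def by (intro continuous_on_sum continuous_on_mult continuous_on_const cont_sqrt)
    have cont_F': "continuous_on {T..2*T} F" using cont_F continuous_on_subset by blast
    have "T * \<kappa> = integral {T..2*T} (\<lambda>_. \<kappa>)" using T by simp
    also have "\<dots> \<le> integral {T..2*T} (\<lambda>t. 3 * T * F t + (n0 / T + 2 * W.damped_weight T) + X t)"
      using pointwise
      by (intro integral_le integrable_continuous_real continuous_intros cont_F' cont_X) (auto simp: algebra_simps)
    also have "\<dots> = 3 * T * integral {T..2*T} F + T * (n0 / T + 2 * W.damped_weight T) + integral {T..2*T} X"
    proof (rule integral_unique)
      have const: "((\<lambda>_. n0 / T + 2 * W.damped_weight T) has_integral T * (n0 / T + 2 * W.damped_weight T)) {T..2*T}"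
        using has_integral_const_real[of "n0 / T + 2 * W.damped_weight T" T "2 * T"] T by simp
      show "((\<lambda>t. 3 * T * F t + (n0 / T + 2 * W.damped_weight T) + X t) has_integral
          3 * T * integral {T..2*T} F + T * (n0 / T + 2 * W.damped_weight T) + integral {T..2*T} X) {T..2*T}"
        by (intro has_integral_add const has_integral_mult_right integrable_integral
            integrable_continuous_real cont_F' cont_X)
    qed
    finally have total: "T * \<kappa> \<le> 3 * T * integral {T..2*T} F + T * (n0 / T + 2 * W.damped_weight T)
        + integral {T..2*T} X" .
    have "integral {T..2*T} X \<le> (\<Sum>\<rho>\<in>W.shell T. W.weight \<rho> * (8 * T * (2 * arsinh (10 * T))))"
    proof -
      have "integral {T..2*T} X = (\<Sum>\<rho>\<in>W.shell T. integral {T..2*T} (\<lambda>t. W.weight \<rho> * (8 * T * (1 / sqrt (1 + (t - Im \<rho>)\<^sup>2)))))"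
        unfolding X_def
        by (intro integral_sum W.finite_shell integrable_continuous_real continuous_on_mult continuous_on_const cont_sqrt)
      also have "\<dots> = (\<Sum>\<rho>\<in>W.shell T. W.weight \<rho> * (8 * T * integral {T..2*T} (\<lambda>t. 1 / sqrt (1 + (t - Im \<rho>)\<^sup>2))))"
        by (simp only: integral_mult_right)
      also have "\<dots> \<le> (\<Sum>\<rho>\<in>W.shell T. W.weight \<rho> * (8 * T * (2 * arsinh (10 * T))))"
      proof (intro sum_mono mult_left_mono W.weight_nonneg integral_inverse_sqrt_le)
        fix \<rho> assume "\<rho> \<in> W.shell T"
        thus "\<bar>Im \<rho>\<bar> \<le> 8 * T" using abs_Im_le_cmod[of \<rho>] by (simp add: W.shell_def)
      qed (use T in auto)
      finally show ?thesis .
    qed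
    also have "\<dots> = T * (16 * arsinh (10 * T) * a k)"
      unfolding a_def T_def sum_distrib_left by (intro sum.cong) (auto simp: algebra_simps)
    also have "\<dots> \<le> T * (16 * (32 * real (Suc k)) * a k)"
      using arsinh_power_16_le[of k] T unfolding T_def a_def
      by (intro mult_left_mono mult_right_mono sum_nonneg W.weight_nonneg) auto
    finally have "integral {T..2*T} X \<le> T * (512 * real (Suc k) * a k)" by simp
    moreover have "3 * T * integral {T..2*T} F = T * (3 * e k)" by (simp add: e_def T_def)
    ultimately have "T * \<kappa> \<le> T * (3 * e k + (n0 / T + 2 * W.damped_weight T) + 512 * real (Suc k) * a k)"
      using total unfolding distrib_left[of T] by linarith
    hence "\<kappa> \<le> 3 * e k + (n0 / T + 2 * W.damped_weight T) + 512 * real (Suc k) * a k"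
      using T by (subst (asm) mult_le_cancel_left_pos) auto
    thus ?thesis by (simp add: T_def)
  qed
  have "eventually (\<lambda>k. (16::real) ^ k \<ge> c \<and> 16 ^ k \<ge> r) sequentially"
    using pow_top by (auto simp: filterlim_at_top intro: eventually_conj)
  hence ev: "eventually (\<lambda>k. \<kappa> \<le> (3 * e k + n0 / 16 ^ k + 2 * W.damped_weight (16 ^ k)) + 512 * real (Suc k) * a k) sequentially"
    by eventually_elim (use main in blast)
  have "(\<lambda>k. 3 * e k + n0 / 16 ^ k + 2 * W.damped_weight (16 ^ k)) \<longlonglongrightarrow> 3 * 0 + 0 + 2 * 0"
    by (intro tendsto_intros e_lim real_tendsto_divide_at_top[OF tendsto_const pow_top]
        filterlim_compose[OF W.damped_weight_tendsto_0 pow_top])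
  hence lim: "(\<lambda>k. 3 * e k + n0 / 16 ^ k + 2 * W.damped_weight (16 ^ k)) \<longlonglongrightarrow> 0" by simp
  show False
    by (rule harmonic_weights_contradiction[OF _ lim \<kappa>(1) _ ev])
      (use W.shell_weights_summable in \<open>auto simp: a_def\<close>)
qed

end

theorem corollary13:
  fixes f :: "complex \<Rightarrow> complex"
  assumes "LLD f"
    and "convergence_exponent f \<ge> 1"
    and "vertical_order f \<le> convergence_exponent f"
  shows "genus f = hadamard_genus f
       \<and> hadamard_genus f = int (convergence_exponent f) - 1
       \<and> int (convergence_exponent f) - 1 \<ge> int (weierstrass_genus f)"
proof -
  interpret nonzero_meromorphic f
    using assms(1) by unfold_locales (auto simp: LLD_def finite_order_meromorphic_def)
  have order: "meromorphic_order f < \<infinity>" and sigma: "sigma1 f < \<infinity>"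
    using assms(1) by (auto simp: LLD_def finite_order_meromorphic_def)
  obtain Q0 where "hadamard_factorization f Q0"
    by (rule hadamard_factorization_exists[OF order assms(2)])
  hence Q: "hadamard_factorization f (SOME Q. hadamard_factorization f Q)"
    by (rule someI)
  have "weierstrass_genus f < convergence_exponent f"
    unfolding weierstrass_genus_def
    by (rule degree_less_convergence_exponent[OF weighted_divisor[OF order assms(2)] Q sigma assms(3)])
  thus ?thesis
    by (simp add: genus_def hadamard_genus_def)
qed

end
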